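(* Let $\phi$ be a (non-constant) finite Blaschke product with a fixed point $w\in\mathbb{D}$, and let $\nu_w$ be the harmonic measure on $\mathbb{S}^1$ with pole at $w$. Fix $\alpha\in(0,1]$. Then, with respect to $\nu_w$: - $\phi$ is not mixing if and only if $|\phi'(w)|=1$; - $\phi$ is exponentially mixing on $C^\alpha$ if and only if $|\phi'(w)|<1$; - $\phi$ is mixing at a double exponential rate if and only if $\phi'(w)=0$.
   Context: $\mathbb{D}$ is the open unit disk, $\mathbb{S}^1=\{|z|=1\}$, $d\mu(z)=\frac{1}{2\pi i}\frac{dz}{z}$ is normalized Lebesgue measure on $\mathbb{S}^1$. A finite Blaschke product is a map $\phi(z)=e^{i\psi}\prod_{i=1}^q\frac{z-\lambda_i}{1-\overline{\lambda_i}z}$ with $\psi\in[0,2\pi)$, $|\lambda_i|<1$, $q\ge1$. The harmonic measure with pole at $w\in\mathbb{D}$ is $d\nu_w(z)=\frac{1-|w|^2}{|z-w|^2}\,d\mu(z)$; it is preserved by a finite Blaschke product fixing $w$. With $\phi^n$ the $n$-fold iterate, the correlation function is $\mathcal{C}_{f,g}(n)=\left|\int_{\mathbb{S}^1}(f\circ\phi^n)\,\overline{g}\,d\nu_w-\int_{\mathbb{S}^1}f\,d\nu_w\int_{\mathbb{S}^1}\overline{g}\,d\nu_w\right|$. - $\phi$ is (strongly) mixing if $\mathcal{C}_{f,g}(n)\to0$ as $n\to\infty$ for all $f,g\in L_2(\mathbb{S}^1,\nu_w)$. - $C^\alpha$ is the space of $\alpha$-H\"older continuous functions on $\mathbb{S}^1$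 with the usual H\"older norm. $\phi$ is exponentially mixing on $C^\alpha$ if there exist $\kappa,C>0$ such that $\mathcal{C}_{f,g}(n)\le Ce^{-\kappa n}\|f\|_{C^\alpha}\|g\|_{C^\alpha}$ for all $f,g\in C^\alpha$ and all $n\ge1$. - For $0<\theta<1$, $\mathcal{H}_\theta$ is the closure of the linear combinations of $z^k$, $k\in\mathbb{Z}$, with respect to $\|f\|_\theta=\sqrt{\sum_{k\in\mathbb{Z}}|f_k|^2\theta^{-2|k|}}$, where $f_k$ are the Fourier coefficients of $f$. $\phi$ is mixing at a double exponential rate if for some $0<\theta<1$ there exist $\beta,\gamma,C>0$ such that $\mathcal{C}_{f,g}(n)\le Ce^{-\beta e^{\gamma n}}\|f\|_\theta\|g\|_\theta$ for all $f,g\in\mathcal{H}_\theta$ and all $n\ge1$. *)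

theory Defs
  imports "HOL-Analysis.Analysis"
begin

text \<open>
  Functions on the unit circle are functions \<^typ>\<open>complex \<Rightarrow> complex\<close> of which only the values on
  \<^term>\<open>sphere 0 1 :: complex set\<close> matter; accordingly the measures below live on the subspace
  \<^term>\<open>sphere 0 1 :: complex set\<close>.
\<close>

text \<open>The product is required only on the closed disc, which avoids the poles and contains all
  iterates of points of the disc and of the circle.\<close>

definition finite_blaschke :: "(complex \<Rightarrow> complex) \<Rightarrow> bool" where
  "finite_blaschke \<phi> \<longleftrightarrow>
    (\<exists>(\<psi>::real) (q::nat) (a::nat \<Rightarrow> complex).
        0 \<le> \<psi> \<and> \<psi> < 2 * pi \<and> 1 \<le> q \<and> (\<forall>i<q. cmod (a i) < 1) \<and>
        (\<forall>z\<in>cball 0 1. \<phi> z = cis \<psi> * (\<Prod>i<q. (z - a i) / (1 - cnj (a i) * z))))"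

text \<open>With \<open>z = cis t\<close>, the measure \<open>dz / (2 \<pi> i z)\<close> is \<open>dt / (2 \<pi>)\<close>.\<close>

definition circle_measure :: "complex measure" where
  "circle_measure =
     distr (uniform_measure lborel {0..<2 * pi}) (restrict_space borel (sphere 0 1)) cis"

definition harmonic_measure :: "complex \<Rightarrow> complex measure" where
  "harmonic_measure w =
     density circle_measure (\<lambda>z. ennreal ((1 - (cmod w)\<^sup>2) / (cmod (z - w))\<^sup>2))"

definition L2_functions :: "complex measure \<Rightarrow> (complex \<Rightarrow> complex) set" where
  "L2_functions N = {f \<in> borel_measurable N. integrable N (\<lambda>z. (cmod (f z))\<^sup>2)}"

definition correlation ::
  "complex measure \<Rightarrow> (complex \<Rightarrow> complex) \<Rightarrow> (complex \<Rightarrow> complex) \<Rightarrow> (complex \<Rightarrow> complex) \<Rightarrow> nat \<Rightarrow> real"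
  where
  "correlation N \<phi> f g n =
     cmod ((LINT z|N. f ((\<phi> ^^ n) z) * cnj (g z)) - (LINT z|N. f z) * (LINT z|N. cnj (g z)))"

definition mixing :: "complex measure \<Rightarrow> (complex \<Rightarrow> complex) \<Rightarrow> bool" where
  "mixing N \<phi> \<longleftrightarrow>
     (\<forall>f\<in>L2_functions N. \<forall>g\<in>L2_functions N. (\<lambda>n. correlation N \<phi> f g n) \<longlonglongrightarrow> 0)"

definition holder_space :: "real \<Rightarrow> (complex \<Rightarrow> complex) set" where
  "holder_space \<alpha> =
     {f. \<exists>K. \<forall>x\<in>sphere 0 1. \<forall>y\<in>sphere 0 1. cmod (f x - f y) \<le> K * cmod (x - y) powr \<alpha>}"

text \<open>The real suprema are meaningful only for \<^term>\<open>f \<in> holder_space \<alpha>\<close>.\<close>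

definition holder_norm :: "real \<Rightarrow> (complex \<Rightarrow> complex) \<Rightarrow> real" where
  "holder_norm \<alpha> f =
     (SUP x\<in>sphere 0 1. cmod (f x)) +
     (SUP (x, y)\<in>{(x, y). x \<in> sphere 0 1 \<and> y \<in> sphere 0 1 \<and> x \<noteq> y}.
        cmod (f x - f y) / cmod (x - y) powr \<alpha>)"

definition exponentially_mixing_on_holder ::
  "complex measure \<Rightarrow> (complex \<Rightarrow> complex) \<Rightarrow> real \<Rightarrow> bool" where
  "exponentially_mixing_on_holder N \<phi> \<alpha> \<longleftrightarrow>
     (\<exists>\<kappa>>0. \<exists>C>0. \<forall>f\<in>holder_space \<alpha>. \<forall>g\<in>holder_space \<alpha>. \<forall>n\<ge>1.
        correlation N \<phi> f g n \<le> C * exp (- \<kappa> * real n) * holder_norm \<alpha> f * holder_norm \<alpha> g)"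

definition fourier_coeff :: "(complex \<Rightarrow> complex) \<Rightarrow> int \<Rightarrow> complex" where
  "fourier_coeff f k = (LINT z|circle_measure. f z * z powi (- k))"

definition trig_polynomials :: "(complex \<Rightarrow> complex) set" where
  "trig_polynomials = {\<lambda>z. \<Sum>k\<in>K. c k * z powi k | (c :: int \<Rightarrow> complex) K. finite K}"

definition theta_norm_finite :: "real \<Rightarrow> (complex \<Rightarrow> complex) \<Rightarrow> bool" where
  "theta_norm_finite \<theta> f \<longleftrightarrow>
     (\<lambda>k::int. (cmod (fourier_coeff f k))\<^sup>2 * \<theta> powi (- 2 * \<bar>k\<bar>)) summable_on UNIV"

definition theta_norm :: "real \<Rightarrow> (complex \<Rightarrow> complex) \<Rightarrow> real" where
  "theta_norm \<theta> f =
     sqrt (\<Sum>\<^sub>\<infinity>k::int. (cmod (fourier_coeff f k))\<^sup>2 * \<theta> powi (- 2 * \<bar>k\<bar>))"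

text \<open>The closure is taken inside \<open>L\<^sub>2\<close> of the circle. Since \<^const>\<open>infsum\<close> is 0 for a divergent
  series, convergence of the series defining the norm is required explicitly.\<close>

definition H_theta :: "real \<Rightarrow> (complex \<Rightarrow> complex) set" where
  "H_theta \<theta> = {f \<in> L2_functions circle_measure. \<forall>\<epsilon>>0. \<exists>p\<in>trig_polynomials.
       theta_norm_finite \<theta> (\<lambda>z. f z - p z) \<and> theta_norm \<theta> (\<lambda>z. f z - p z) < \<epsilon>}"

definition double_exponentially_mixing ::
  "complex measure \<Rightarrow> (complex \<Rightarrow> complex) \<Rightarrow> bool" where
  "double_exponentially_mixing N \<phi> \<longleftrightarrow>
     (\<exists>\<theta>. 0 < \<theta> \<and> \<theta> < 1 \<and>
       (\<exists>\<beta>>0. \<exists>\<gamma>>0. \<exists>C>0. \<forall>f\<in>H_theta \<theta>. \<forall>g\<in>H_theta \<theta>. \<forall>n\<ge>1.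
          correlation N \<phi> f g n
            \<le> C * exp (- \<beta> * exp (\<gamma> * real n)) * theta_norm \<theta> f * theta_norm \<theta> g))"

end

theory Submission
  imports Defs "HOL-Complex_Analysis.Complex_Analysis"
begin

text \<open>
  Write \<open>\<nu>\<close> for the harmonic measure with pole \<open>w\<close> and \<open>\<lambda>\<close> for the derivative of \<open>\<phi>\<close> at \<open>w\<close>.
  Integrating a function of the disc algebra against \<open>\<nu>\<close> evaluates it at \<open>w\<close>
  (\<open>harmonic_mean_value\<close>). Hence \<open>\<nu>\<close> and its image under \<open>\<phi>\<close> have the same moments \<open>w\<^sup>k\<close>, and
  \<open>\<phi>\<close> preserves \<open>\<nu>\<close>. Moreover, for \<open>j \<ge> 0\<close> the correlation of \<open>z\<^sup>j\<close> with \<open>z\<^sup>k\<close> vanishes if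
  \<open>k \<le> 0\<close>, and for \<open>k \<ge> 1\<close> it is, up to the factor \<open>1 - |w|\<^sup>2\<close>, the modulus of a Taylor coefficient
  at 0 of \<open>((\<phi>\<^sup>n)\<^sup>j - w\<^sup>j) / ((z - w) (1 - cnj w z))\<close>. Cauchy's inequality on a circle of radius
  \<open>r > |w|\<close> therefore bounds every correlation of monomials by the distance of \<open>\<phi>\<^sup>n\<close> from \<open>w\<close> on
  that circle (\<open>correlation_monomials\<close>).

  The Schwarz lemma controls this distance. A Moebius map taking \<open>w\<close> to 0 conjugates \<open>\<phi>\<close> to a
  self-map \<open>F\<close> of the disc with \<open>F 0 = 0\<close> and derivative \<open>\<lambda>\<close> at 0. If \<open>|\<lambda>| = 1\<close>, then \<open>F\<close> is a
  rotation, and the Moebius map is an eigenfunction of mean zero and modulus one whose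
  autocorrelation is constantly 1, which excludes mixing and exponential mixing. If \<open>|\<lambda>| < 1\<close>, the
  Schwarz-Pick inequality says that \<open>|z| / (1 - |z|)\<close> shrinks at each step by the factor
  \<open>s = (1 + |\<lambda>|) / 2\<close>, so \<open>\<phi>\<^sup>n z\<close> differs from \<open>w\<close> by at most a constant times
  \<open>s\<^sup>n / (1 - |z|)\<close> (\<open>iterate_bound\<close>). If \<open>\<lambda> = 0\<close>, then \<open>|F z| \<le> |z|\<^sup>2\<close>, and the distance is
  double exponentially small on compact subsets of the disc.

  It remains to pass from monomials to functions. For mixing this is the density of
  trigonometric polynomials in \<open>L\<^sub>2\<close>. A Hoelder function is within a multiple of \<open>M\<^bsup>-\<alpha>/2\<^esup>\<close> of a
  trigonometric polynomial of degree \<open>M\<close> with bounded coefficients (\<open>trig_approx_holder\<close>). Using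
  Cauchy's inequality at distance of order \<open>1 / M\<close> from the unit circle, the correlations of these
  polynomials cost only a factor \<open>M\<^sup>4\<close> against \<open>s\<^sup>n\<close>, and \<open>M\<close> can be taken exponentially large in
  \<open>n\<close>. For functions in \<open>H\<^sub>\<theta>\<close> the Fourier coefficients decay like \<open>\<theta>\<^sup>|\<^sup>k\<^sup>|\<close>, which for small \<open>\<theta>\<close>
  absorbs the factor \<open>r\<^bsup>-|k|\<^esup>\<close> in the bound for monomials.

  Conversely, summing the Taylor series above at \<open>w\<close> expresses \<open>\<lambda>\<^sup>n\<close> as a power series in \<open>w\<close> whose
  coefficients are the covariances of \<open>z\<close> with the powers \<open>z\<^sup>k\<close>, \<open>k \<ge> 1\<close>
  (\<open>covariance_power_series\<close>). Double exponential mixing makes each coefficient double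
  exponentially small, with a loss of \<open>\<theta>\<^sup>-\<^sup>k\<close>. Interpolation with the trivial bound 2 makes this
  loss summable against \<open>|w|\<^sup>k\<close>, so \<open>\<lambda>\<^sup>n\<close> decays double exponentially, and \<open>\<lambda> = 0\<close>.
\<close>

section \<open>Integration over the circle\<close>

lemma space_circle_measure [simp]: "space circle_measure = sphere 0 1"
  by (simp add: circle_measure_def space_restrict_space)

lemma sets_circle_measure [simp, measurable_cong]:
  "sets circle_measure = sets (restrict_space borel (sphere 0 1))"
  by (simp add: circle_measure_def)

lemma space_harmonic_measure [simp]: "space (harmonic_measure w) = sphere 0 1"
  by (simp add: harmonic_measure_def)

lemma sets_harmonic_measure [simp, measurable_cong]:
  "sets (harmonic_measure w) = sets (restrict_space borel (sphere 0 1))"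
  by (simp add: harmonic_measure_def)

lemma measurable_cis_circle:
  "cis \<in> measurable (uniform_measure lborel {0..<2 * pi}) (restrict_space borel (sphere 0 1))"
  by (intro measurable_restrict_space2)
     (auto simp: uniform_measure_def intro!: borel_measurable_continuous_onI continuous_intros)

lemma uniform_measure_interval:
  "uniform_measure lborel {0..<2 * pi} =
     density lborel (\<lambda>t. ennreal (indicator {0..<2 * pi} t / (2 * pi)))"
  unfolding uniform_measure_def
  by (intro density_cong)
     (auto simp: divide_ennreal[symmetric] ennreal_mult[symmetric] indicator_def ennreal_1[symmetric] simp del: ennreal_1)

lemma continuous_on_circle_measurable:
  assumes "sets N = sets (restrict_space borel (sphere 0 1 :: complex set))"
    and "continuous_on (sphere 0 1) f"
  shows "f \<in> borel_measurable N"
  using borel_measurable_continuous_on_restrict[OF assms(2)] assms(1)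
  by (simp cong: measurable_cong_sets)

lemma emeasure_circle_measure: "emeasure circle_measure (sphere 0 1) = 1"
proof -
  have "emeasure circle_measure (sphere 0 1) =
    emeasure (uniform_measure lborel {0..<2 * pi}) (cis -` sphere 0 1 \<inter> UNIV)"
    unfolding circle_measure_def
    by (subst emeasure_distr[OF measurable_cis_circle])
       (auto simp: sets_restrict_space uniform_measure_def)
  also have "cis -` sphere 0 1 \<inter> UNIV = (UNIV :: real set)" by auto
  also have "emeasure (uniform_measure lborel {0..<2 * pi}) UNIV = 1"
    by (subst emeasure_uniform_measure) (auto simp: divide_ennreal)
  finally show ?thesis .
qed

lemma finite_measure_circle: "finite_measure circle_measure"
  by (rule finite_measureI) (simp add: emeasure_circle_measure)

lemma measure_circle: "measure circle_measure (sphere 0 1) = 1"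
  by (simp add: measure_def emeasure_circle_measure)

lemma integrable_bounded_circle:
  fixes f :: "complex \<Rightarrow> 'b :: {banach, second_countable_topology}"
  assumes "finite_measure N" "sets N = sets (restrict_space borel (sphere 0 1 :: complex set))"
    and "continuous_on (sphere 0 1) f"
  shows "integrable N f"
proof -
  have sp: "space N = sphere 0 1"
    using sets_eq_imp_space_eq[OF assms(2)] by (simp add: space_restrict_space)
  have "compact (f ` sphere 0 1)"
    using assms(3) by (intro compact_continuous_image) auto
  then obtain B where "\<And>x. x \<in> sphere 0 1 \<Longrightarrow> norm (f x) \<le> B"
    using compact_imp_bounded bounded_iff by (metis imageI)
  then show ?thesis
    using assms sp by (intro finite_measure.integrable_const_bound[where B = B])
      (auto intro!: continuous_on_circle_measurable AE_I2)
qed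

text \<open>
  The parametrization by \<open>cis\<close> turns the measure into \<open>dt / (2 \<pi>)\<close>; the half-open interval in
  its definition differs from the closed one by a null set. This formula brings Cauchy's theorem
  to bear on circle integrals.
\<close>

lemma circle_integral_contour:
  assumes f: "continuous_on (sphere 0 1) f"
  shows "((\<lambda>z. f z / z) has_contour_integral (2 * pi * \<i> * (LINT z|circle_measure. f z)))
           (circlepath 0 1)"
proof -
  have cf: "continuous_on UNIV (\<lambda>t. f (cis t))"
    by (intro continuous_on_compose2[OF f] continuous_intros) auto
  have mf: "f \<in> borel_measurable (restrict_space borel (sphere 0 1))"
    by (rule borel_measurable_continuous_on_restrict[OF f])
  have mft [measurable]: "(\<lambda>t. f (cis t)) \<in> borel_measurable borel"
    by (rule borel_measurable_continuous_onI[OF cf])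
  have int: "set_integrable lborel {0..2*pi} (\<lambda>t. f (cis t))"
    unfolding set_integrable_def
    by (intro borel_integrable_compact continuous_on_subset[OF cf]) auto
  have "(LINT z|circle_measure. f z) =
    (LINT t|density lborel (\<lambda>t. ennreal (indicator {0..<2 * pi} t / (2 * pi))). f (cis t))"
    unfolding circle_measure_def
    by (subst integral_distr[OF measurable_cis_circle mf]) (simp add: uniform_measure_interval)
  also have "\<dots> = (LINT t|lborel. (indicator {0..<2 * pi} t / (2 * pi)) *\<^sub>R f (cis t))"
    by (intro integral_density) auto
  also have "\<dots> = (LINT t|lborel. (1 / (2*pi)) *\<^sub>R (indicator {0..2 * pi} t *\<^sub>R f (cis t)))"
  proof (rule integral_cong_AE)
    have "AE t in lborel. t \<noteq> 2 * pi" by (rule AE_lborel_singleton)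
    then show "AE x in lborel. (indicator {0..<2 * pi} x / (2 * pi)) *\<^sub>R f (cis x) =
         (1 / (2 * pi)) *\<^sub>R indicator {0..2 * pi} x *\<^sub>R f (cis x)"
      by eventually_elim (auto simp: indicator_def)
  qed measurable
  also have "\<dots> = (1 / (2*pi)) *\<^sub>R integral {0..2*pi} (\<lambda>t. f (cis t))"
    by (subst integral_scaleR_right)
       (simp only: set_borel_integral_eq_integral(2)[OF int, unfolded set_lebesgue_integral_def])
  finally have eq: "2 * pi * \<i> * (LINT z|circle_measure. f z) = \<i> * integral {0..2*pi} (\<lambda>t. f (cis t))"
    by (simp add: scaleR_conv_of_real)
  have "((\<lambda>t. \<i> * f (cis t)) has_integral \<i> * integral {0..2*pi} (\<lambda>t. f (cis t))) {0..2*pi}"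
    by (intro has_integral_mult_right integrable_integral set_borel_integral_eq_integral(1) int)
  then have "((\<lambda>z. f z / z) has_contour_integral (\<i> * integral {0..2*pi} (\<lambda>t. f (cis t))))
        (part_circlepath 0 1 0 (2*pi))"
    by (subst has_contour_integral_part_circlepath_iff) (auto simp: mult_ac)
  then show ?thesis unfolding eq by (simp add: circlepath_def)
qed

section \<open>The disc algebra and harmonic measure\<close>

definition disc_algebra :: "(complex \<Rightarrow> complex) set" where
  "disc_algebra = {F. F holomorphic_on ball 0 1 \<and> continuous_on (cball 0 1) F}"

lemma disc_algebra_mult: "F \<in> disc_algebra \<Longrightarrow> G \<in> disc_algebra \<Longrightarrow> (\<lambda>z. F z * G z) \<in> disc_algebra"
  and disc_algebra_diff: "F \<in> disc_algebra \<Longrightarrow> G \<in> disc_algebra \<Longrightarrow> (\<lambda>z. F z - G z) \<in> disc_algebra"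
  and disc_algebra_const: "(\<lambda>z. c) \<in> disc_algebra"
  and disc_algebra_ident: "(\<lambda>z. z) \<in> disc_algebra"
  and disc_algebra_power: "F \<in> disc_algebra \<Longrightarrow> (\<lambda>z. F z ^ n) \<in> disc_algebra"
  by (auto simp: disc_algebra_def intro!: holomorphic_intros continuous_intros)

lemma disc_algebra_continuous_circle: "F \<in> disc_algebra \<Longrightarrow> continuous_on (sphere 0 1) F"
  by (auto simp: disc_algebra_def elim: continuous_on_subset)

lemma circle_integral_unique:
  assumes "continuous_on (sphere 0 1) f"
    and "(g has_contour_integral 2 * pi * \<i> * I) (circlepath 0 1)"
    and "\<And>z. cmod z = 1 \<Longrightarrow> g z = f z / z"
  shows "(LINT z|circle_measure. f z) = I"
proof -
  have "((\<lambda>z. f z / z) has_contour_integral 2 * pi * \<i> * I) (circlepath 0 1)"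
    using assms(2) by (rule has_contour_integral_eq) (use assms(3) in auto)
  from has_contour_integral_unique[OF this circle_integral_contour[OF assms(1)]]
  show ?thesis by simp
qed

text \<open>
  Cauchy's integral formula for derivatives holds up to the boundary, so no holomorphic
  extension of \<open>F\<close> beyond the closed disc is required.
\<close>

lemma circle_integral_coefficient:
  assumes F: "F \<in> disc_algebra"
  shows "(LINT z|circle_measure. F z * z powi (- int m)) = (deriv ^^ m) F 0 / fact m"
proof (rule circle_integral_unique)
  show "continuous_on (sphere 0 1) (\<lambda>z. F z * z powi (- int m))"
    by (intro continuous_intros disc_algebra_continuous_circle[OF F]) auto
  have "((\<lambda>u. F u / (u - 0) ^ Suc m) has_contour_integral 2 * pi * \<i> / fact m * (deriv ^^ m) F 0)
     (circlepath 0 1)"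
    using F by (intro Cauchy_has_contour_integral_higher_derivative_circlepath) (auto simp: disc_algebra_def)
  then show "((\<lambda>u. F u / u ^ Suc m) has_contour_integral
      2 * pi * \<i> * ((deriv ^^ m) F 0 / fact m)) (circlepath 0 1)" by simp
qed (auto simp: power_int_minus field_simps)

text \<open>
  On the unit circle \<open>cnj z = 1 / z\<close>, so the Poisson kernel is the restriction of a rational
  function; in this form Cauchy's formula applies to it.
\<close>

lemma poisson_kernel_circle:
  fixes z w :: complex
  assumes "cmod z = 1" "cmod w < 1"
  shows "complex_of_real ((1 - (cmod w)\<^sup>2) / (cmod (z - w))\<^sup>2) =
    (1 - (cmod w)\<^sup>2) * z / ((z - w) * (1 - cnj w * z))"
proof -
  have "z * cnj z = 1" using assms(1) by (metis complex_norm_square of_real_1 one_power2)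
  then have eq: "(z - w) * (1 - cnj w * z) = z * ((z - w) * cnj (z - w))"
    by (simp add: algebra_simps)
  have "z \<noteq> 0" using assms by auto
  then show ?thesis unfolding eq complex_norm_square[symmetric] of_real_divide by simp
qed

lemma norm_one_minus_cnj_mult_ge:
  assumes "cmod z \<le> 1"
  shows "1 - cmod w \<le> cmod (1 - cnj w * z)"
proof -
  have "cmod w * cmod z \<le> cmod w * 1" using assms by (intro mult_left_mono) auto
  then show ?thesis using norm_triangle_ineq2[of 1 "cnj w * z"] by (simp add: norm_mult)
qed

lemma one_minus_cnj_mult_nonzero: "cmod w < 1 \<Longrightarrow> cmod z \<le> 1 \<Longrightarrow> 1 - cnj w * z \<noteq> 0"
  using norm_one_minus_cnj_mult_ge[of z w] by auto

lemma harmonic_integral: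
  fixes f :: "complex \<Rightarrow> 'b :: {banach, second_countable_topology}"
  assumes w: "cmod w < 1" and f: "f \<in> borel_measurable (restrict_space borel (sphere 0 1))"
  shows "(LINT z|harmonic_measure w. f z) =
     (LINT z|circle_measure. ((1 - (cmod w)\<^sup>2) / (cmod (z - w))\<^sup>2) *\<^sub>R f z)"
  unfolding harmonic_measure_def
proof (rule integral_density)
  show "f \<in> borel_measurable circle_measure" using f by (simp cong: measurable_cong_sets)
  show "(\<lambda>z. (1 - (cmod w)\<^sup>2) / (cmod (z - w))\<^sup>2) \<in> borel_measurable circle_measure"
    using w by (intro continuous_on_circle_measurable continuous_intros) auto
  show "AE z in circle_measure. 0 \<le> (1 - (cmod w)\<^sup>2) / (cmod (z - w))\<^sup>2"
    using w by (intro AE_I2 divide_nonneg_nonneg) (auto simp: abs_square_le_1)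
qed

text \<open>
  The factor \<open>z - w\<close> of the rational form of the Poisson kernel makes this Cauchy's formula at
  \<open>w\<close>; the remaining factor takes the value 1 there.
\<close>

lemma harmonic_mean_value:
  assumes F: "F \<in> disc_algebra" and w: "cmod w < 1"
  shows "(LINT z|harmonic_measure w. F z) = F w"
proof -
  note nz = one_minus_cnj_mult_nonzero[OF w]
  define G where "G = (\<lambda>z. (1 - (cmod w)\<^sup>2) * F z / (1 - cnj w * z))"
  have "G holomorphic_on ball 0 1" "continuous_on (cball 0 1) G"
    unfolding G_def using F nz
    by (auto intro!: holomorphic_intros continuous_intros simp: disc_algebra_def)
  then have c: "((\<lambda>u. G u / (u - w)) has_contour_integral 2 * pi * \<i> * G w) (circlepath 0 1)"
    using Cauchy_integral_circlepath[of 0 1 G w] w by simp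
  have "(LINT z|harmonic_measure w. F z) =
     (LINT z|circle_measure. ((1 - (cmod w)\<^sup>2) / (cmod (z - w))\<^sup>2) *\<^sub>R F z)"
    by (intro harmonic_integral w borel_measurable_continuous_on_restrict disc_algebra_continuous_circle F)
  also have "\<dots> = G w"
  proof (rule circle_integral_unique[OF _ c])
    show "continuous_on (sphere 0 1) (\<lambda>z. ((1 - (cmod w)\<^sup>2) / (cmod (z - w))\<^sup>2) *\<^sub>R F z)"
      using w by (intro continuous_intros disc_algebra_continuous_circle F) auto
    show "G z / (z - w) = (((1 - (cmod w)\<^sup>2) / (cmod (z - w))\<^sup>2) *\<^sub>R F z) / z" if "cmod z = 1" for z
    proof -
      have "z \<noteq> 0" "z \<noteq> w" "1 - cnj w * z \<noteq> 0" using that nz[of z] w by auto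
      then show ?thesis unfolding scaleR_conv_of_real poisson_kernel_circle[OF that w] G_def
        by simp
    qed
  qed
  also have "G w = F w"
  proof -
    have "cnj w * w = (cmod w)\<^sup>2" by (metis complex_norm_square mult.commute)
    moreover have "1 - cnj w * w \<noteq> 0" using nz[of w] w by simp
    ultimately show ?thesis unfolding G_def by simp
  qed
  finally show ?thesis .
qed

lemma sphere_measure_harmonic:
  assumes w: "cmod w < 1"
  shows "finite_measure (harmonic_measure w)" "measure (harmonic_measure w) (sphere 0 1) = 1"
proof -
  have ne: "emeasure (harmonic_measure w) (sphere 0 1) \<noteq> \<infinity>"
  proof -
    have "continuous_on (sphere 0 1) (\<lambda>z. (1 - (cmod w)\<^sup>2) / (cmod (z - w))\<^sup>2)"
      using w by (intro continuous_intros) auto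
    then have "integrable circle_measure (\<lambda>z. (1 - (cmod w)\<^sup>2) / (cmod (z - w))\<^sup>2)"
      by (intro integrable_bounded_circle finite_measure_circle) auto
    moreover have "0 \<le> (1 - (cmod w)\<^sup>2) / (cmod (z - w))\<^sup>2" for z
      using w by (intro divide_nonneg_nonneg) (auto simp: abs_square_le_1)
    ultimately have "(\<integral>\<^sup>+ z. ennreal ((1 - (cmod w)\<^sup>2) / (cmod (z - w))\<^sup>2) \<partial>circle_measure) < \<infinity>"
      by (simp add: real_integrable_def less_top[symmetric])
    moreover have "emeasure (harmonic_measure w) (sphere 0 1) = 
       (\<integral>\<^sup>+ z. ennreal ((1 - (cmod w)\<^sup>2) / (cmod (z - w))\<^sup>2) \<partial>circle_measure)"
      unfolding harmonic_measure_def
      by (subst emeasure_density)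
         (use w in \<open>auto simp: sets_restrict_space simp del: divide_ennreal intro!: nn_integral_cong continuous_on_circle_measurable continuous_intros measurable_compose[OF _ measurable_ennreal] split: split_indicator\<close>)
    ultimately show ?thesis by simp
  qed
  show fin: "finite_measure (harmonic_measure w)"
    by (rule finite_measureI) (use ne in simp)
  have "(LINT z|harmonic_measure w. (1::complex)) = 1"
    using harmonic_mean_value[OF disc_algebra_const w, of 1] .
  then show "measure (harmonic_measure w) (sphere 0 1) = 1"
    by (simp add: of_real_eq_1_iff scaleR_conv_of_real)
qed

text \<open>
  The singularity of the quotient at \<open>w\<close> is removable. The denominator is chosen to cancel that
  of the Poisson kernel.
\<close>

lemma disc_algebra_factor:
  assumes F: "F \<in> disc_algebra" and w: "cmod w < 1" and Fw: "F w = 0"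
  obtains H where "H \<in> disc_algebra" "\<And>z. cmod z \<le> 1 \<Longrightarrow> F z = (z - w) * (1 - cnj w * z) * H z"
    "H w = deriv F w / (1 - (cmod w)\<^sup>2)"
proof
  note nz = one_minus_cnj_mult_nonzero[OF w]
  define h where "h z = (if z = w then deriv F w else (F z - F w) / (z - w))" for z
  define H where "H z = h z / (1 - cnj w * z)" for z
  have hol: "h holomorphic_on ball 0 1"
    unfolding h_def using F w by (intro pole_lemma) (auto simp: disc_algebra_def interior_open)
  have c2: "continuous_on (cball 0 1 - {w}) h"
  proof -
    have "continuous_on (cball 0 1 - {w}) (\<lambda>z. (F z - F w) / (z - w))"
      using F by (intro continuous_intros) (auto simp: disc_algebra_def elim: continuous_on_subset)
    then show ?thesis by (rule continuous_on_eq) (auto simp: h_def)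
  qed
  have "continuous_on (ball 0 1 \<union> (cball 0 1 - {w})) h"
  proof (rule continuous_on_Un_local_open)
    have *: "ball 0 1 \<union> (cball 0 1 - {w}) = cball 0 1" using w by auto
    show "openin (top_of_set (ball 0 1 \<union> (cball 0 1 - {w}))) (ball 0 1)"
      unfolding * by (intro open_subset) auto 
    show "openin (top_of_set (ball 0 1 \<union> (cball 0 1 - {w}))) (cball 0 1 - {w})"
      unfolding * by (simp add: openin_delete)
  qed (use hol c2 holomorphic_on_imp_continuous_on in auto)
  moreover have "ball 0 1 \<union> (cball 0 1 - {w}) = cball 0 1" using w by auto
  ultimately have cont: "continuous_on (cball 0 1) h" by simp
  show "H \<in> disc_algebra"
    using hol cont nz unfolding disc_algebra_def H_def
    by (auto intro!: holomorphic_intros continuous_intros)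
  show "F z = (z - w) * (1 - cnj w * z) * H z" if "cmod z \<le> 1" for z
    using nz[OF that] Fw by (auto simp: H_def h_def)
  show "H w = deriv F w / (1 - (cmod w)\<^sup>2)"
  proof -
    have "cnj w * w = (cmod w)\<^sup>2" by (metis complex_norm_square mult.commute)
    then show ?thesis unfolding H_def h_def by simp
  qed
qed

text \<open>
  The Poisson kernel cancels the two explicit factors of \<open>F\<close> and contributes a factor \<open>z\<close>, which
  shifts the index of the Taylor coefficient by one.
\<close>

lemma harmonic_coefficient:
  assumes H: "H \<in> disc_algebra" and w: "cmod w < 1"
    and F: "\<And>z. cmod z = 1 \<Longrightarrow> F z = (z - w) * (1 - cnj w * z) * H z"
  shows "(LINT z|harmonic_measure w. F z * z powi (- int (Suc m))) =
     complex_of_real (1 - (cmod w)\<^sup>2) * ((deriv ^^ m) H 0 / fact m)"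
proof -
  have cF: "continuous_on (sphere 0 1) F"
  proof (rule continuous_on_eq)
    show "continuous_on (sphere 0 1) (\<lambda>z. (z - w) * (1 - cnj w * z) * H z)"
      by (intro continuous_intros disc_algebra_continuous_circle[OF H])
  qed (use F in auto)
  have "(LINT z|harmonic_measure w. F z * z powi (- int (Suc m))) =
     (LINT z|circle_measure. ((1 - (cmod w)\<^sup>2) / (cmod (z - w))\<^sup>2) *\<^sub>R (F z * z powi (- int (Suc m))))"
    by (intro harmonic_integral w borel_measurable_continuous_on_restrict continuous_intros cF) auto
  also have "\<dots> = (LINT z|circle_measure. (1 - (cmod w)\<^sup>2) * (H z * z powi (- int m)))"
  proof (rule Bochner_Integration.integral_cong[OF refl])
    fix z assume "z \<in> space circle_measure"
    then have z: "cmod z = 1" by simp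
    then have "z \<noteq> 0" "z \<noteq> w" "1 - cnj w * z \<noteq> 0" using w one_minus_cnj_mult_nonzero[OF w, of z] by auto
    moreover have "z powi (- int (Suc m)) = z powi (- int m) / z"
      using \<open>z \<noteq> 0\<close> by (simp only: power_int_minus power_int_of_nat) (simp add: field_simps)
    ultimately show "((1 - (cmod w)\<^sup>2) / (cmod (z - w))\<^sup>2) *\<^sub>R (F z * z powi (- int (Suc m))) =
       (1 - (cmod w)\<^sup>2) * (H z * z powi (- int m))"
      unfolding scaleR_conv_of_real poisson_kernel_circle[OF z w] F[OF z]
      by simp
  qed
  also have "\<dots> = (1 - (cmod w)\<^sup>2) * (LINT z|circle_measure. H z * z powi (- int m))" by simp
  finally show ?thesis by (simp add: circle_integral_coefficient[OF H])
qed

section \<open>Trigonometric approximation of Hoelder continuous functions\<close>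

lemma circle_monomial_integral:
  "(LINT z|circle_measure. z powi k) = (if k = 0 then 1 else 0)"
proof (cases "k \<le> 0")
  case True
  then show ?thesis
    using circle_integral_coefficient[OF disc_algebra_const, of 1 "nat (- k)"] by auto
next
  case False
  then show ?thesis
    using circle_integral_coefficient[OF disc_algebra_power[OF disc_algebra_ident], of "nat k" 0]
    by (simp add: power_int_def)
qed

lemma integrable_circle:
  fixes f :: "complex \<Rightarrow> 'b :: {banach, second_countable_topology}"
  shows "continuous_on (sphere 0 1) f \<Longrightarrow> integrable circle_measure f"
  by (rule integrable_bounded_circle[OF finite_measure_circle sets_circle_measure])

lemma cnj_circle: "cmod z = 1 \<Longrightarrow> cnj z = inverse z"
  using complex_norm_square[of z] by (intro inverse_unique[symmetric]) simp

text \<open>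
  For \<open>|u| = 1\<close> we have \<open>|1 + u|\<^sup>2 = (1 + u)\<^sup>2 / u\<close>, and the binomial theorem applies to the
  \<open>n\<close>th power.
\<close>

lemma norm_one_plus_power:
  assumes "cmod u = 1"
  shows "complex_of_real (cmod (1 + u) ^ (2 * n)) =
    (\<Sum>i\<le>2 * n. of_nat ((2 * n) choose i) * u powi (int i - int n))"
proof -
  have u: "u \<noteq> 0" using assms by auto
  have "complex_of_real (cmod (1 + u) ^ (2 * n)) = ((1 + u) * cnj (1 + u)) ^ n"
    by (metis complex_norm_square of_real_power power_mult)
  also have "(1 + u) * cnj (1 + u) = (1 + u)\<^sup>2 * inverse u"
    using u by (simp add: cnj_circle[OF assms] field_simps power2_eq_square)
  also have "\<dots> ^ n = (u + 1) ^ (2 * n) * inverse u ^ n"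
    by (simp add: power_mult power_mult_distrib add.commute)
  also have "\<dots> = (\<Sum>i\<le>2 * n. of_nat ((2 * n) choose i) * u powi (int i - int n))"
    unfolding binomial_ring sum_distrib_right
    using u by (intro sum.cong refl) (simp add: power_int_diff field_simps power_inverse)
  finally show ?thesis .
qed

text \<open>
  The kernel \<open>|1 + u|\<^bsup>2n\<^esup>\<close>, of total mass \<open>(2n choose n)\<close>, is a nonnegative trigonometric
  polynomial of degree \<open>n\<close> concentrated near \<open>u = 1\<close> (de la Vallee Poussin's kernel).
  Convolution with it multiplies the Fourier coefficients by binomial coefficients.
\<close>

lemma binomial_kernel_integral:
  fixes f :: "complex \<Rightarrow> complex"
  assumes x: "cmod x = 1" and f: "continuous_on (sphere 0 1) f"
  shows "(LINT z|circle_measure. f z * cmod (1 + x * cnj z) ^ (2 * n)) =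
    (\<Sum>i\<le>2 * n. of_nat ((2 * n) choose i) * fourier_coeff f (int i - int n) * x powi (int i - int n))"
proof -
  have "(LINT z|circle_measure. f z * cmod (1 + x * cnj z) ^ (2 * n)) =
    (LINT z|circle_measure. (\<Sum>i\<le>2 * n. of_nat ((2 * n) choose i) * (f z * z powi (- (int i - int n))) * x powi (int i - int n)))"
  proof (rule Bochner_Integration.integral_cong[OF refl])
    fix z assume "z \<in> space circle_measure"
    then have z: "cmod z = 1" by simp
    then have "z \<noteq> 0" by auto
    then have *: "(x * cnj z) powi k = x powi k * z powi (- k)" for k
      by (simp add: power_int_mult_distrib cnj_circle[OF z] power_int_inverse power_int_minus)
    have "complex_of_real (cmod (1 + x * cnj z) ^ (2 * n)) = 
      (\<Sum>i\<le>2 * n. of_nat ((2 * n) choose i) * (x * cnj z) powi (int i - int n))"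
      by (rule norm_one_plus_power) (simp add: norm_mult x z)
    then show "f z * cmod (1 + x * cnj z) ^ (2 * n) = 
       (\<Sum>i\<le>2 * n. of_nat ((2 * n) choose i) * (f z * z powi (- (int i - int n))) * x powi (int i - int n))"
      unfolding * by (simp add: sum_distrib_left mult_ac)
  qed
  also have "\<dots> = (\<Sum>i\<le>2 * n. LINT z|circle_measure. of_nat ((2 * n) choose i) * (f z * z powi (- (int i - int n))) * x powi (int i - int n))"
    using f by (intro Bochner_Integration.integral_sum integrable_circle continuous_intros) auto
  also have "\<dots> = (\<Sum>i\<le>2 * n. of_nat ((2 * n) choose i) * fourier_coeff f (int i - int n) * x powi (int i - int n))"
    by (simp add: fourier_coeff_def)
  finally show ?thesis .
qed

lemma fourier_coeff_const: "fourier_coeff (\<lambda>z. c) k = (if k = 0 then c else 0)"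
  by (simp add: fourier_coeff_def circle_monomial_integral)

lemma binomial_kernel_mass:
  assumes x: "cmod x = 1"
  shows "(LINT z|circle_measure. cmod (1 + x * cnj z) ^ (2 * n)) = real ((2 * n) choose n)"
proof -
  have "complex_of_real (LINT z|circle_measure. cmod (1 + x * cnj z) ^ (2 * n)) = 
     (LINT z|circle_measure. (1 :: complex) * cmod (1 + x * cnj z) ^ (2 * n))" 
    by (simp only: mult_1 integral_complex_of_real)
  also have "\<dots> = (\<Sum>i\<le>2 * n. of_nat ((2 * n) choose i) * (if int i - int n = 0 then 1 else 0) * x powi (int i - int n))"
    by (subst binomial_kernel_integral[OF x]) (simp_all add: fourier_coeff_const)
  also have "\<dots> = (\<Sum>i\<le>2 * n. if i = n then of_nat ((2 * n) choose n) else 0)"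
    by (intro sum.cong) auto
  also have "\<dots> = complex_of_real (real ((2 * n) choose n))" by simp
  finally show ?thesis unfolding of_real_eq_iff .
qed

lemma central_binomial_Suc:
  "real ((2 * Suc n) choose Suc n) = (4 - 2 / (real n + 1)) * real ((2 * n) choose n)"
proof -
  have "Suc n * ((2 * Suc n) choose Suc n) = Suc n * (2 * ((2 * n + 1) choose n))"
    using Suc_times_binomial_eq[of "2 * n + 1" n] by (simp add: mult_ac)
  then have 1: "(2 * Suc n) choose Suc n = 2 * ((2 * n + 1) choose n)"
    using nat_mult_eq_cancel1[OF zero_less_Suc] by blast
  have "Suc n * ((2 * n + 1) choose Suc n) = (2 * n + 1) * ((2 * n) choose n)"
    using Suc_times_binomial_eq[of "2 * n" n] by simp
  moreover have "(2 * n + 1) choose Suc n = (2 * n + 1) choose n"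
    using binomial_symmetric[of n "2 * n + 1"] by simp
  ultimately have "Suc n * ((2 * n + 1) choose n) = (2 * n + 1) * ((2 * n) choose n)"
    by simp
  then have "real (Suc n * ((2 * n + 1) choose n)) = real ((2 * n + 1) * ((2 * n) choose n))" by simp
  then have 2: "real ((2 * n + 1) choose n) * (real n + 1) = (2 * real n + 1) * real ((2 * n) choose n)"
    by (simp add: algebra_simps)
  have "real ((2 * Suc n) choose Suc n) * (real n + 1) = (4 - 2 / (real n + 1)) * real ((2 * n) choose n) * (real n + 1)"
    unfolding 1 using 2 by (simp add: field_simps)
  moreover have "real n + 1 \<noteq> 0" by simp
  ultimately show ?thesis using mult_right_cancel by blast
qed

text \<open>
  By the parallelogram law \<open>|1 - u|\<^sup>2 = 4 - |1 + u|\<^sup>2\<close>, so the second moment of the kernel about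
  \<open>u = 1\<close> is a difference of two consecutive masses. Relative to the mass it is of order
  \<open>1 / n\<close>.
\<close>

lemma binomial_kernel_variance:
  assumes x: "cmod x = 1"
  shows "(LINT z|circle_measure. cmod (1 + x * cnj z) ^ (2 * n) * (cmod (1 - x * cnj z))\<^sup>2) =
    2 / (real n + 1) * real ((2 * n) choose n)"
proof -
  have "(LINT z|circle_measure. cmod (1 + x * cnj z) ^ (2 * n) * (cmod (1 - x * cnj z))\<^sup>2) =
    (LINT z|circle_measure. 4 * cmod (1 + x * cnj z) ^ (2 * n) - cmod (1 + x * cnj z) ^ (2 * Suc n))"
  proof (rule Bochner_Integration.integral_cong[OF refl])
    fix z assume "z \<in> space circle_measure"
    then have "cmod (x * cnj z) = 1" using x by (simp add: norm_mult)
    define u where "u = x * cnj z"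
    have "(cmod (1 - u))\<^sup>2 + (cmod (1 + u))\<^sup>2 = 2 + 2 * (cmod u)\<^sup>2"
      unfolding cmod_power2 by (simp add: power2_eq_square algebra_simps)
    also have "\<dots> = 4" using \<open>cmod (x * cnj z) = 1\<close> by (simp add: u_def)
    finally have *: "(cmod (1 - u))\<^sup>2 = 4 - (cmod (1 + u))\<^sup>2" by simp
    show "cmod (1 + x * cnj z) ^ (2 * n) * (cmod (1 - x * cnj z))\<^sup>2 = 
      4 * cmod (1 + x * cnj z) ^ (2 * n) - cmod (1 + x * cnj z) ^ (2 * Suc n)"
      unfolding u_def[symmetric] * by (simp add: algebra_simps power2_eq_square)
  qed
  also have "\<dots> = 4 * (LINT z|circle_measure. cmod (1 + x * cnj z) ^ (2 * n)) - (LINT z|circle_measure. cmod (1 + x * cnj z) ^ (2 * Suc n))"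
    by (subst Bochner_Integration.integral_diff)
       (auto intro!: integrable_circle continuous_intros simp del: power_Suc)
  also have "\<dots> = 2 / (real n + 1) * real ((2 * n) choose n)"
    unfolding binomial_kernel_mass[OF x] central_binomial_Suc by (simp add: algebra_simps)
  finally show ?thesis .
qed

text \<open>
  Bounds the \<open>\<alpha>\<close>-th moment of a distance by its second moment, which is the only one available
  for the binomial kernel.
\<close>

lemma powr_le_square_interpolation:
  fixes d \<delta> \<alpha> :: real
  assumes "0 \<le> d" "0 < \<delta>" "0 < \<alpha>" "\<alpha> \<le> 2"
  shows "d powr \<alpha> \<le> \<delta> powr \<alpha> + \<delta> powr (\<alpha> - 2) * d\<^sup>2"
proof (cases "d \<le> \<delta>")
  case True
  then have "d powr \<alpha> \<le> \<delta> powr \<alpha>" using assms by (intro powr_mono2) auto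
  moreover have "0 \<le> \<delta> powr (\<alpha> - 2) * d\<^sup>2" by simp
  ultimately show ?thesis by linarith
next
  case False
  then have d: "d > 0" using assms by auto
  have "d powr \<alpha> = d powr (\<alpha> - 2) * d\<^sup>2"
    using d by (simp add: powr_diff powr_numeral)
  also have "\<dots> \<le> \<delta> powr (\<alpha> - 2) * d\<^sup>2"
    using False assms by (intro mult_right_mono powr_mono2') auto
  also have "\<dots> \<le> \<delta> powr \<alpha> + \<delta> powr (\<alpha> - 2) * d\<^sup>2" by simp
  finally show ?thesis .
qed

lemma holder_continuous:
  fixes f :: "complex \<Rightarrow> complex"
  assumes "0 < \<alpha>" 
    and "\<And>x y. cmod x = 1 \<Longrightarrow> cmod y = 1 \<Longrightarrow> cmod (f x - f y) \<le> K * cmod (x - y) powr \<alpha>"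
  shows "continuous_on (sphere 0 1) f"
  unfolding continuous_on_def
proof
  fix x :: complex assume x: "x \<in> sphere 0 1"
  have "((\<lambda>y. K * cmod (y - x) powr \<alpha>) \<longlongrightarrow> K * cmod (x - x) powr \<alpha>) (at x within sphere 0 1)"
    using assms(1) by (intro tendsto_intros) auto
  then have "((\<lambda>y. K * cmod (y - x) powr \<alpha>) \<longlongrightarrow> 0) (at x within sphere 0 1)" using assms(1) by simp
  then have "((\<lambda>y. f y - f x) \<longlongrightarrow> 0) (at x within sphere 0 1)"
    by (rule Lim_null_comparison[rotated])
       (use x assms(2) in \<open>auto simp: eventually_at_topological\<close>)
  then show "(f \<longlongrightarrow> f x) (at x within sphere 0 1)" by (rule LIM_zero_cancel)
qed

lemma norm_fourier_coeff_le:
  fixes f :: "complex \<Rightarrow> complex"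
  assumes "continuous_on (sphere 0 1) f" "\<And>z. cmod z = 1 \<Longrightarrow> cmod (f z) \<le> B"
  shows "cmod (fourier_coeff f k) \<le> B"
proof -
  have "cmod (fourier_coeff f k) \<le> (LINT z|circle_measure. cmod (f z * z powi (- k)))"
    unfolding fourier_coeff_def by (rule integral_norm_bound)
  also have "\<dots> \<le> (LINT z|circle_measure. B)"
    using assms by (intro integral_mono integrable_circle continuous_intros)
      (auto simp: norm_mult norm_power_int)
  also have "\<dots> = B" by (simp add: measure_circle)
  finally show ?thesis .
qed

text \<open>
  Convolve \<open>f\<close> with the normalized binomial kernel. Its typical width is \<open>N\<^bsup>-1/2\<^esup>\<close>, which
  explains the exponent \<open>\<alpha> / 2\<close>; the coefficients are Fourier coefficients of \<open>f\<close> times weights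
  in \<open>[0, 1]\<close>. The bound on the coefficients matters later, when the degree grows exponentially
  with time.
\<close>

lemma trig_approx_holder:
  fixes f :: "complex \<Rightarrow> complex"
  assumes \<alpha>: "0 < \<alpha>" "\<alpha> \<le> 2" and K: "0 \<le> K"
    and f: "\<And>x y. cmod x = 1 \<Longrightarrow> cmod y = 1 \<Longrightarrow> cmod (f x - f y) \<le> K * cmod (x - y) powr \<alpha>"
    and B: "\<And>x. cmod x = 1 \<Longrightarrow> cmod (f x) \<le> B" and N: "N > 0"
  obtains a where "\<And>k. cmod (a k) \<le> B"
    "\<And>x. cmod x = 1 \<Longrightarrow> cmod (f x - (\<Sum>k\<in>{- int N..int N}. a k * x powi k)) \<le> 3 * K * real N powr (- \<alpha> / 2)"
proof
  define C where "C = real ((2 * N) choose N)"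
  have C: "C > 0" by (simp add: C_def)
  define a where "a k = of_real (real ((2 * N) choose nat (k + int N)) / C) * fourier_coeff f k" for k
  have cf: "continuous_on (sphere 0 1) f" using holder_continuous[OF \<alpha>(1) f] by blast
  have B0: "0 \<le> B" using order_trans[OF norm_ge_zero B[of 1]] by simp
  show "cmod (a k) \<le> B" for k
  proof -
    have "real ((2 * N) choose nat (k + int N)) \<le> C"
      unfolding C_def of_nat_le_iff by (rule binomial_maximum')
    then have "cmod (of_real (real ((2 * N) choose nat (k + int N)) / C)) \<le> 1"
      unfolding norm_of_real using C by auto
    moreover have "cmod (fourier_coeff f k) \<le> B" by (rule norm_fourier_coeff_le[OF cf B])
    ultimately have "cmod (a k) \<le> 1 * B"
      unfolding a_def norm_mult by (intro mult_mono) auto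
    then show ?thesis by simp
  qed
  fix x assume x: "cmod x = 1"
  let ?K = "\<lambda>z. cmod (1 + x * cnj z) ^ (2 * N)"
  have "(\<Sum>k\<in>{- int N..int N}. a k * x powi k) = (\<Sum>i\<le>2 * N. a (int i - int N) * x powi (int i - int N))"
    by (rule sum.reindex_bij_witness[of _ "\<lambda>i. int i - int N" "\<lambda>k. nat (k + int N)"]) auto
  also have "\<dots> = (\<Sum>i\<le>2 * N. of_nat ((2 * N) choose i) * fourier_coeff f (int i - int N) * x powi (int i - int N)) / C"
    unfolding sum_divide_distrib by (intro sum.cong) (auto simp: a_def)
  also have "\<dots> = (LINT z|circle_measure. f z * ?K z) / C"
    by (subst binomial_kernel_integral[OF x cf]) (rule refl)
  finally have p: "(\<Sum>k\<in>{- int N..int N}. a k * x powi k) = (LINT z|circle_measure. f z * ?K z) / C" .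
  have "(LINT z|circle_measure. (f x - f z) * ?K z) = f x * (LINT z|circle_measure. ?K z) - (LINT z|circle_measure. f z * ?K z)"
    unfolding left_diff_distrib
    by (subst Bochner_Integration.integral_diff)
       (intro integrable_circle continuous_intros cf,
        intro integrable_circle continuous_intros cf,
        simp only: integral_mult_right_zero integral_complex_of_real)
  also have "\<dots> = C * (f x - (\<Sum>k\<in>{- int N..int N}. a k * x powi k))"
    unfolding p binomial_kernel_mass[OF x] C_def[symmetric] using C by (simp add: right_diff_distrib)
  finally have "C * cmod (f x - (\<Sum>k\<in>{- int N..int N}. a k * x powi k)) = cmod (LINT z|circle_measure. (f x - f z) * ?K z)"
    using C by (simp add: norm_mult)
  also have "\<dots> \<le> (LINT z|circle_measure. cmod ((f x - f z) * ?K z))" by (rule integral_norm_bound)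
  \<comment> \<open>The standard deviation of the kernel, up to a constant; it balances the two terms of the interpolation.\<close>
  also define \<delta> where "\<delta> = real N powr (- 1 / 2)"
  have \<delta>: "\<delta> > 0" using N by (simp add: \<delta>_def)
  have "(LINT z|circle_measure. cmod ((f x - f z) * ?K z)) \<le>
    (LINT z|circle_measure. K * \<delta> powr \<alpha> * ?K z + K * \<delta> powr (\<alpha> - 2) * (?K z * (cmod (1 - x * cnj z))\<^sup>2))"
  proof (intro integral_mono)
    fix z assume "z \<in> space circle_measure"
    then have z: "cmod z = 1" by simp
    then have "x - z = z * - (1 - x * cnj z)" 
      by (simp add: cnj_circle[OF z] field_simps) (use z in auto)
    then have xz: "cmod (x - z) = cmod (1 - x * cnj z)" using z by (metis mult_1 norm_minus_cancel norm_mult)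
    have "cmod (f x - f z) \<le> K * cmod (x - z) powr \<alpha>" by (rule f[OF x z])
    also have "\<dots> \<le> K * (\<delta> powr \<alpha> + \<delta> powr (\<alpha> - 2) * (cmod (1 - x * cnj z))\<^sup>2)"
      unfolding xz using \<alpha> \<delta> K by (intro mult_left_mono powr_le_square_interpolation) auto
    finally have "cmod (f x - f z) * ?K z \<le> K * (\<delta> powr \<alpha> + \<delta> powr (\<alpha> - 2) * (cmod (1 - x * cnj z))\<^sup>2) * ?K z"
      by (intro mult_right_mono) auto
    moreover have "cmod ((f x - f z) * ?K z) = cmod (f x - f z) * ?K z"
      by (simp add: norm_mult norm_power)
    ultimately show "cmod ((f x - f z) * ?K z) \<le> K * \<delta> powr \<alpha> * ?K z + K * \<delta> powr (\<alpha> - 2) * (?K z * (cmod (1 - x * cnj z))\<^sup>2)"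
      by (simp add: algebra_simps)
  qed (intro integrable_circle continuous_intros cf)+
  also have "\<dots> = K * \<delta> powr \<alpha> * C + K * \<delta> powr (\<alpha> - 2) * (2 / (real N + 1) * C)"
    by (subst Bochner_Integration.integral_add)
       (intro integrable_circle continuous_intros, intro integrable_circle continuous_intros, 
        simp only: integral_mult_right_zero binomial_kernel_mass[OF x] binomial_kernel_variance[OF x] C_def)
  also have "\<dots> = C * (K * (\<delta> powr \<alpha> + \<delta> powr (\<alpha> - 2) * (2 / (real N + 1))))"
    by (simp add: algebra_simps)
  finally have "cmod (f x - (\<Sum>k\<in>{- int N..int N}. a k * x powi k)) \<le> K * (\<delta> powr \<alpha> + \<delta> powr (\<alpha> - 2) * (2 / (real N + 1)))"
    using C by simp
  moreover have "\<delta> powr \<alpha> + \<delta> powr (\<alpha> - 2) * (2 / (real N + 1)) \<le> 3 * real N powr (- \<alpha> / 2)"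
  proof -
    have "\<delta> powr \<alpha> + \<delta> powr (\<alpha> - 2) * (2 / (real N + 1)) \<le> \<delta> powr \<alpha> + \<delta> powr (\<alpha> - 2) * (2 / real N)"
      using N by (intro add_left_mono mult_left_mono divide_left_mono) auto
    also have "\<dots> = 3 * real N powr (- \<alpha> / 2)"
      using N by (simp add: \<delta>_def powr_powr powr_diff field_simps)
    finally show ?thesis .
  qed
  from order_trans[OF calculation mult_left_mono[OF this K]]
  show "cmod (f x - (\<Sum>k\<in>{- int N..int N}. a k * x powi k)) \<le> 3 * K * real N powr (- \<alpha> / 2)"
    by (simp add: mult_ac)
qed

section \<open>Measures on the circle are determined by their moments\<close>

lemma trig_polynomial_add:
  assumes "p \<in> trig_polynomials" "q \<in> trig_polynomials"
  shows "(\<lambda>z. p z + q z) \<in> trig_polynomials"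
proof -
  obtain c K where p: "p = (\<lambda>z. \<Sum>k\<in>K. c k * z powi k)" "finite K"
    using assms(1) by (auto simp: trig_polynomials_def)
  obtain d L where q: "q = (\<lambda>z. \<Sum>k\<in>L. d k * z powi k)" "finite L"
    using assms(2) by (auto simp: trig_polynomials_def)
  let ?e = "\<lambda>k. (if k \<in> K then c k else 0) + (if k \<in> L then d k else 0)"
  have "(\<Sum>k\<in>K \<union> L. ?e k * z powi k) = p z + q z" for z
  proof -
    have "(\<Sum>k\<in>K \<union> L. ?e k * z powi k) =
      (\<Sum>k\<in>K \<union> L. (if k \<in> K then c k * z powi k else 0)) + (\<Sum>k\<in>K \<union> L. (if k \<in> L then d k * z powi k else 0))"
      unfolding sum.distrib[symmetric] by (intro sum.cong) (auto simp: algebra_simps)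
    also have "\<dots> = p z + q z"
      using p q by (simp add: sum.inter_restrict[symmetric] Int_absorb1 Int_absorb2)
    finally show ?thesis .
  qed
  then have "(\<lambda>z. p z + q z) = (\<lambda>z. \<Sum>k\<in>K \<union> L. ?e k * z powi k)" by auto
  then show ?thesis unfolding trig_polynomials_def using p(2) q(2)
    by (intro CollectI exI[of _ ?e] exI[of _ "K \<union> L"]) simp
qed

lemma trig_polynomial_cmult:
  assumes "p \<in> trig_polynomials"
  shows "(\<lambda>z. a * p z) \<in> trig_polynomials"
proof -
  obtain c K where p: "p = (\<lambda>z. \<Sum>k\<in>K. c k * z powi k)" "finite K"
    using assms(1) by (auto simp: trig_polynomials_def)
  then have "(\<lambda>z. a * p z) = (\<lambda>z. \<Sum>k\<in>K. (a * c k) * z powi k)"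
    by (simp add: sum_distrib_left mult.assoc)
  then show ?thesis unfolding trig_polynomials_def using p(2) by (intro CollectI exI[of _ "\<lambda>k. a * c k"] exI[of _ K]) simp
qed

lemma trig_polynomial_sum: 
  "finite K \<Longrightarrow> (\<lambda>z. \<Sum>k\<in>K. c k * z powi k) \<in> trig_polynomials"
  by (auto simp: trig_polynomials_def)

lemma trig_polynomial_const: "(\<lambda>z. a) \<in> trig_polynomials"
  using trig_polynomial_sum[of "{0}" "\<lambda>_. a"] by simp

lemma trig_polynomial_continuous: "p \<in> trig_polynomials \<Longrightarrow> continuous_on (sphere 0 1) p"
  by (auto simp: trig_polynomials_def intro!: continuous_intros)

lemma lipschitz_trig_approx:
  fixes f :: "complex \<Rightarrow> complex"
  assumes K: "0 \<le> K" and f: "\<And>x y. cmod x = 1 \<Longrightarrow> cmod y = 1 \<Longrightarrow> cmod (f x - f y) \<le> K * cmod (x - y)"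
    and e: "\<epsilon> > 0"
  obtains p where "p \<in> trig_polynomials" "\<And>x. cmod x = 1 \<Longrightarrow> cmod (f x - p x) \<le> \<epsilon>"
proof -
  have f': "cmod (f x - f y) \<le> K * cmod (x - y) powr 1" if "cmod x = 1" "cmod y = 1" for x y
    using f[OF that] by simp
  have B: "cmod (f x) \<le> cmod (f 1) + K * 2" if "cmod x = 1" for x
  proof -
    have "cmod (f x - f 1) \<le> K * cmod (x - 1)" using f that by auto
    also have "\<dots> \<le> K * 2" using K that norm_triangle_ineq4[of x 1] by (intro mult_left_mono) auto
    finally show ?thesis using norm_triangle_sub[of "f x" "f 1"] by linarith
  qed
  define t where "t = (3 * K / \<epsilon>)\<^sup>2"
  define N where "N = nat \<lceil>t\<rceil> + 1"
  have N: "N > 0" "t \<le> real N" using real_nat_ceiling_ge[of t] by (simp_all add: N_def)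
  have "\<exists>a :: int \<Rightarrow> complex. \<forall>x. cmod x = 1 \<longrightarrow> cmod (f x - (\<Sum>k\<in>{- int N..int N}. a k * x powi k)) \<le> 3 * K * real N powr (- 1 / 2)"
  proof (rule trig_approx_holder[OF zero_less_one _ K f' B N(1)])
    fix a :: "int \<Rightarrow> complex"
    assume "\<And>x. cmod x = 1 \<Longrightarrow> cmod (f x - (\<Sum>k\<in>{- int N..int N}. a k * x powi k)) \<le> 3 * K * real N powr (- 1 / 2)"
    then show ?thesis by (intro exI[of _ a]) simp
  qed auto
  then obtain a where a: "\<And>x. cmod x = 1 \<Longrightarrow> cmod (f x - (\<Sum>k\<in>{- int N..int N}. a k * x powi k)) \<le> 3 * K * real N powr (- 1 / 2)"
    by blast
  have "3 * K * real N powr (- 1 / 2) = 3 * K / sqrt N"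
    by (simp add: powr_minus powr_half_sqrt field_simps)
  also have "\<dots> \<le> \<epsilon>"
  proof -
    have "3 * K / \<epsilon> \<le> sqrt N" using N(2) unfolding t_def by (rule real_le_rsqrt)
    then show ?thesis using N(1) e by (simp add: field_simps)
  qed
  finally show ?thesis
    using a by (intro that[OF trig_polynomial_sum[of "{- int N..int N}" a]]) (auto intro: order_trans)
qed

text \<open>
  Lipschitz functions decreasing to the indicator function of a nonempty closed set; they link
  measures of sets to integrals of functions that have good trigonometric approximations.
\<close>

definition closed_cutoff :: "'a :: metric_space set \<Rightarrow> nat \<Rightarrow> 'a \<Rightarrow> real" where
  "closed_cutoff F n x = max 0 (1 - real n * infdist x F)"

lemma closed_cutoff_bounds: "0 \<le> closed_cutoff F n x" "closed_cutoff F n x \<le> 1"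
  by (auto simp: closed_cutoff_def infdist_nonneg)

lemma closed_cutoff_lipschitz: "\<bar>closed_cutoff F n x - closed_cutoff F n y\<bar> \<le> real n * dist x y"
proof -
  have "\<bar>infdist x F - infdist y F\<bar> \<le> dist x y" by (rule infdist_triangle_abs)
  then have "real n * \<bar>infdist x F - infdist y F\<bar> \<le> real n * dist x y" by (intro mult_left_mono) auto
  moreover have "\<bar>real n * infdist x F - real n * infdist y F\<bar> = real n * \<bar>infdist x F - infdist y F\<bar>"
    by (simp add: abs_mult right_diff_distrib[symmetric])
  ultimately show ?thesis unfolding closed_cutoff_def by linarith
qed

lemma closed_cutoff_tendsto:
  assumes "closed F" "F \<noteq> {}"
  shows "(\<lambda>n. closed_cutoff F n x) \<longlonglongrightarrow> indicator F x"
proof (cases "x \<in> F")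
  case True
  then show ?thesis by (simp add: closed_cutoff_def)
next
  case False
  then have pos: "infdist x F > 0" using assms in_closed_iff_infdist_zero[of F x] infdist_nonneg[of x F] by force
  have "eventually (\<lambda>n. closed_cutoff F n x = 0) sequentially"
  proof -
    obtain n0 :: nat where "1 / infdist x F < real n0" using reals_Archimedean2 by blast
    then have "1 \<le> real n * infdist x F" if "n \<ge> n0" for n
    proof -
      have "1 \<le> real n0 * infdist x F" using \<open>1 / infdist x F < real n0\<close> pos by (simp add: field_simps)
      also have "\<dots> \<le> real n * infdist x F" using that pos by (intro mult_right_mono) auto
      finally show ?thesis .
    qed
    then show ?thesis by (intro eventually_sequentiallyI[of n0]) (simp add: closed_cutoff_def)
  qed
  then show ?thesis using False by (simp add: tendsto_eventually)
qed

lemma closed_cutoff_trig_approx: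
  assumes "\<epsilon> > 0"
  obtains p where "p \<in> trig_polynomials" "\<And>x. cmod x = 1 \<Longrightarrow> cmod (complex_of_real (closed_cutoff F n x) - p x) \<le> \<epsilon>"
proof (rule lipschitz_trig_approx[of "real n" "\<lambda>x. of_real (closed_cutoff F n x)" \<epsilon>])
  show "cmod (complex_of_real (closed_cutoff F n x) - complex_of_real (closed_cutoff F n y)) \<le> real n * cmod (x - y)" for x y
    using closed_cutoff_lipschitz[of F n x y] by (simp add: dist_norm flip: of_real_diff)
qed (use assms that in auto)

lemma circle_sets_generated:
  "sets (restrict_space borel (sphere 0 1 :: complex set)) = 
     sigma_sets (sphere 0 1) {F. closed F \<and> F \<subseteq> sphere 0 1}"
proof -
  have "sets (restrict_space borel (sphere 0 1 :: complex set)) = 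
    (\<inter>) (sphere 0 1) ` sigma_sets UNIV (Collect closed)"
    by (simp add: sets_restrict_space borel_eq_closed)
  also have "\<dots> = sigma_sets (sphere 0 1) ((\<inter>) (sphere 0 1) ` Collect closed)"
    by (rule sigma_sets_Int[of _ UNIV]) (auto simp: sigma_sets.Basic)
  also have "(\<inter>) (sphere 0 1 :: complex set) ` Collect closed = {F. closed F \<and> F \<subseteq> sphere 0 1}"
    by (auto simp: image_iff closed_Int)
  finally show ?thesis .
qed

locale finite_circle_measure = finite_measure N for N :: "complex measure" +
  assumes sets_N: "sets N = sets (restrict_space borel (sphere 0 1))"
begin

lemma space_N: "space N = sphere 0 1"
  using sets_eq_imp_space_eq[OF sets_N] by (simp add: space_restrict_space)

lemma closed_in_sets: "closed F \<Longrightarrow> F \<subseteq> sphere 0 1 \<Longrightarrow> F \<in> sets N"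
  unfolding sets_N circle_sets_generated by (auto intro: sigma_sets.Basic)

lemma cutoff_measurable: "closed_cutoff F n \<in> borel_measurable N"
proof (intro continuous_on_circle_measurable sets_N)
  show "continuous_on (sphere 0 1) (closed_cutoff F n)"
    unfolding closed_cutoff_def by (intro continuous_intros)
qed

lemma cutoff_integral_tendsto:
  assumes "closed F" "F \<noteq> {}" "F \<subseteq> sphere 0 1"
  shows "(\<lambda>n. LINT z|N. closed_cutoff F n z) \<longlonglongrightarrow> measure N F"
proof -
  have "(\<lambda>n. LINT z|N. closed_cutoff F n z) \<longlonglongrightarrow> (LINT z|N. indicator F z)"
  proof (rule integral_dominated_convergence[where w = "\<lambda>_. 1"])
    show "AE x in N. (\<lambda>n. closed_cutoff F n x) \<longlonglongrightarrow> indicator F x"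
      using closed_cutoff_tendsto[OF assms(1,2)] by simp
    show "AE x in N. norm (closed_cutoff F n x) \<le> 1" for n
      by (rule AE_I2) (simp add: closed_cutoff_bounds)
  qed (use cutoff_measurable closed_in_sets[OF assms(1,3)] in auto)
  also have "(LINT z|N. indicator F z) = measure N F"
    using assms(3) space_N by (simp add: Int_absorb2)
  finally show ?thesis .
qed

lemma integrable_continuous: 
  fixes f :: "complex \<Rightarrow> 'b :: {banach, second_countable_topology}"
  shows "continuous_on (sphere 0 1) f \<Longrightarrow> integrable N f"
  by (rule integrable_bounded_circle[OF finite_measure_axioms sets_N])

lemma integral_dist_le:
  fixes f g :: "complex \<Rightarrow> complex"
  assumes "integrable N f" "integrable N g" "\<And>z. cmod z = 1 \<Longrightarrow> cmod (f z - g z) \<le> e"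
  shows "cmod ((LINT z|N. f z) - (LINT z|N. g z)) \<le> e * measure N (sphere 0 1)"
proof -
  have "cmod ((LINT z|N. f z) - (LINT z|N. g z)) = cmod (LINT z|N. f z - g z)"
    using assms by simp
  also have "\<dots> \<le> (LINT z|N. cmod (f z - g z))" by (rule integral_norm_bound)
  also have "\<dots> \<le> (LINT z|N. e)" using assms by (intro integral_mono) (auto simp: space_N)
  finally show ?thesis by (simp add: space_N mult.commute)
qed

end

text \<open>
  Moments of negative order are conjugates of those of positive order on the circle, so the two
  measures integrate all trigonometric polynomials equally, hence all Lipschitz functions, hence
  they agree on the closed sets, which form a generator stable under intersection.
\<close>

lemma circle_measure_eqI:
  assumes "finite_circle_measure M" "finite_circle_measure N"
    and moments: "\<And>k :: nat. (LINT z|M. z ^ k) = (LINT z|N. z ^ k)"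
  shows "M = N"
proof -
  interpret M: finite_circle_measure M by fact
  interpret N: finite_circle_measure N by fact
  have powi: "(LINT z|M. z powi k) = (LINT z|N. z powi k)" for k
  proof (cases "k \<ge> 0")
    case True
    then show ?thesis using moments[of "nat k"] by (simp add: power_int_def)
  next
    case False
    have "z powi k = cnj (z ^ nat (- k))" if "cmod z = 1" for z
      using False cnj_circle[OF that] by (simp add: power_int_def)
    then have "(LINT z|M. z powi k) = (LINT z|M. cnj (z ^ nat (- k)))" "(LINT z|N. z powi k) = (LINT z|N. cnj (z ^ nat (- k)))"
      by (auto intro!: Bochner_Integration.integral_cong simp: M.space_N N.space_N)
    then show ?thesis by (simp only: Bochner_Integration.integral_cnj moments)
  qed
  have trig: "(LINT z|M. p z) = (LINT z|N. p z)" if tp: "p \<in> trig_polynomials" for p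
  proof -
    obtain c K where p: "p = (\<lambda>z. \<Sum>k\<in>K. c k * z powi k)" "finite K"
      using tp by (auto simp: trig_polynomials_def)
    have "(LINT z|M. p z) = (\<Sum>k\<in>K. LINT z|M. c k * z powi k)"
      unfolding p by (intro Bochner_Integration.integral_sum M.integrable_continuous continuous_intros) auto
    moreover have "(LINT z|N. p z) = (\<Sum>k\<in>K. LINT z|N. c k * z powi k)"
      unfolding p by (intro Bochner_Integration.integral_sum N.integrable_continuous continuous_intros) auto
    ultimately show ?thesis using powi by simp
  qed
  have cutoff: "(LINT z|M. closed_cutoff F n z) = (LINT z|N. closed_cutoff F n z)" for F n
  proof -
    let ?h = "\<lambda>z. complex_of_real (closed_cutoff F n z)"
    have ch: "continuous_on (sphere 0 1) ?h" unfolding closed_cutoff_def by (intro continuous_intros)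
    have "cmod ((LINT z|M. ?h z) - (LINT z|N. ?h z)) \<le> e * (measure M (sphere 0 1) + measure N (sphere 0 1))" if e: "e > 0" for e
    proof -
      obtain p where p: "p \<in> trig_polynomials" "\<And>x. cmod x = 1 \<Longrightarrow> cmod (?h x - p x) \<le> e"
        using closed_cutoff_trig_approx[OF e] by blast
      have "cmod ((LINT z|M. ?h z) - (LINT z|M. p z)) \<le> e * measure M (sphere 0 1)"
        by (intro M.integral_dist_le M.integrable_continuous ch trig_polynomial_continuous p)
      moreover have "cmod ((LINT z|N. ?h z) - (LINT z|N. p z)) \<le> e * measure N (sphere 0 1)"
        by (intro N.integral_dist_le N.integrable_continuous ch trig_polynomial_continuous p)
      ultimately show ?thesis
        using norm_triangle_ineq4[of "(LINT z|M. ?h z) - (LINT z|N. p z)" "(LINT z|N. ?h z) - (LINT z|N. p z)"]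
        unfolding trig[OF p(1)] distrib_left by simp
    qed
    note bound = this
    have "cmod ((LINT z|M. ?h z) - (LINT z|N. ?h z)) \<le> 0 + e" if "e > 0" for e
    proof -
      define S where "S = measure M (sphere 0 1) + measure N (sphere 0 1)"
      have "S \<ge> 0" by (simp add: S_def)
      have "e / (S + 1) * S \<le> e" using that \<open>S \<ge> 0\<close> by (simp add: field_simps)
      moreover have "e / (S + 1) > 0" using that \<open>S \<ge> 0\<close> by simp
      ultimately show ?thesis using bound[of "e / (S + 1)"] unfolding S_def by linarith
    qed
    then have "cmod ((LINT z|M. ?h z) - (LINT z|N. ?h z)) \<le> 0"
      by (rule field_le_epsilon)
    then show ?thesis by simp
  qed
  have eq: "measure M F = measure N F" if "closed F" "F \<subseteq> sphere 0 1" for F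
  proof (cases "F = {}")
    case False
    show ?thesis
      using M.cutoff_integral_tendsto[OF that(1) False that(2)] N.cutoff_integral_tendsto[OF that(1) False that(2)]
      unfolding cutoff by (rule LIMSEQ_unique)
  qed simp
  show ?thesis
  proof (rule measure_eqI_generator_eq[where A = "\<lambda>_. sphere 0 1"])
    show "Int_stable {F :: complex set. closed F \<and> F \<subseteq> sphere 0 1}" by (auto simp: Int_stable_def)
    show "emeasure M X = emeasure N X" if "X \<in> {F. closed F \<and> F \<subseteq> sphere 0 1}" for X
      using eq that by (simp add: M.emeasure_eq_measure N.emeasure_eq_measure)
  qed (auto simp: M.sets_N N.sets_N circle_sets_generated)
qed

section \<open>Density of trigonometric polynomials in \<open>L\<^sub>2\<close>\<close>

definition l2_norm :: "complex measure \<Rightarrow> (complex \<Rightarrow> complex) \<Rightarrow> real" where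
  "l2_norm N f = sqrt (LINT z|N. (cmod (f z))\<^sup>2)"

text \<open>
  The functions that are \<open>L\<^sub>2\<close> limits of trigonometric polynomials; the density theorem below
  says that this is all of \<open>L\<^sub>2\<close>.
\<close>

definition trig_closure :: "complex measure \<Rightarrow> (complex \<Rightarrow> complex) set" where
  "trig_closure N = {f \<in> L2_functions N. \<forall>\<epsilon>>0. \<exists>p\<in>trig_polynomials. (LINT z|N. (cmod (f z - p z))\<^sup>2) < \<epsilon>}"

lemma l2_norm_nonneg: "0 \<le> l2_norm N f"
  by (simp add: l2_norm_def integral_nonneg_AE)

lemma l2_norm_square: "(l2_norm N f)\<^sup>2 = (LINT z|N. (cmod (f z))\<^sup>2)"
  by (simp add: l2_norm_def integral_nonneg_AE)

lemma norm_square_add_le: "(cmod (a + b))\<^sup>2 \<le> 2 * (cmod a)\<^sup>2 + 2 * (cmod b)\<^sup>2"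
proof -
  have "(cmod (a + b))\<^sup>2 \<le> (cmod a + cmod b)\<^sup>2" by (intro power_mono norm_triangle_ineq) auto
  also have "\<dots> \<le> 2 * (cmod a)\<^sup>2 + 2 * (cmod b)\<^sup>2"
    using sum_squares_bound[of "cmod a" "cmod b"] by (simp add: power2_sum)
  finally show ?thesis .
qed

lemma L2_functions_measurable: "f \<in> L2_functions N \<Longrightarrow> f \<in> borel_measurable N"
  and L2_functions_integrable: "f \<in> L2_functions N \<Longrightarrow> integrable N (\<lambda>z. (cmod (f z))\<^sup>2)"
  by (simp_all add: L2_functions_def)

lemma L2_functions_add:
  assumes "f \<in> L2_functions N" "g \<in> L2_functions N"
  shows "(\<lambda>z. f z + g z) \<in> L2_functions N"
proof -
  note [measurable] = assms[THEN L2_functions_measurable]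
  have "integrable N (\<lambda>z. (cmod (f z + g z))\<^sup>2)"
  proof (rule Bochner_Integration.integrable_bound)
    show "integrable N (\<lambda>z. 2 * (cmod (f z))\<^sup>2 + 2 * (cmod (g z))\<^sup>2)"
      using assms[THEN L2_functions_integrable] by simp
  qed (auto intro!: AE_I2 norm_square_add_le)
  then show ?thesis by (simp add: L2_functions_def)
qed

lemma L2_functions_cmult:
  assumes "f \<in> L2_functions N"
  shows "(\<lambda>z. c * f z) \<in> L2_functions N"
  using assms by (auto simp: L2_functions_def norm_mult power_mult_distrib)

lemma L2_functions_diff:
  assumes "f \<in> L2_functions N" "g \<in> L2_functions N"
  shows "(\<lambda>z. f z - g z) \<in> L2_functions N"
  using L2_functions_add[OF assms(1) L2_functions_cmult[OF assms(2), of "-1"]] by simp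

lemma L2_functions_product:
  assumes "f \<in> L2_functions N" "g \<in> L2_functions N"
  shows "integrable N (\<lambda>z. f z * cnj (g z))"
proof (rule Bochner_Integration.integrable_bound)
  note [measurable] = assms[THEN L2_functions_measurable]
  show "integrable N (\<lambda>z. (cmod (f z))\<^sup>2 + (cmod (g z))\<^sup>2)"
    using assms[THEN L2_functions_integrable] by simp
  have [measurable]: "cnj \<in> borel_measurable borel"
    by (intro borel_measurable_continuous_onI continuous_intros)
  show "(\<lambda>z. f z * cnj (g z)) \<in> borel_measurable N"
    by measurable
  have "cmod (f z * cnj (g z)) \<le> norm ((cmod (f z))\<^sup>2 + (cmod (g z))\<^sup>2)" for z
  proof -
    have "2 * (cmod (f z) * cmod (g z)) \<le> (cmod (f z))\<^sup>2 + (cmod (g z))\<^sup>2"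
      using sum_squares_bound[of "cmod (f z)" "cmod (g z)"] by simp
    moreover have "0 \<le> cmod (f z) * cmod (g z)" by simp
    ultimately have "cmod (f z) * cmod (g z) \<le> (cmod (f z))\<^sup>2 + (cmod (g z))\<^sup>2" by linarith
    then show ?thesis by (simp add: norm_mult)
  qed
  then show "AE z in N. cmod (f z * cnj (g z)) \<le> norm ((cmod (f z))\<^sup>2 + (cmod (g z))\<^sup>2)" by simp
qed

text \<open>
  Transferred from the inequality for nonnegative integrals, since both sides are finite here.
\<close>

lemma L2_cauchy_schwarz:
  assumes "f \<in> L2_functions N" "g \<in> L2_functions N"
  shows "cmod (LINT z|N. f z * cnj (g z)) \<le> l2_norm N f * l2_norm N g"
proof -
  note [measurable] = assms[THEN L2_functions_measurable]
  have int: "integrable N (\<lambda>z. cmod (f z) * cmod (g z))"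
    using integrable_norm[OF L2_functions_product[OF assms]] by (simp add: norm_mult)
  have eq: "(\<integral>\<^sup>+z. ennreal (cmod (f z)) * ennreal (cmod (g z)) \<partial>N) = ennreal (LINT z|N. cmod (f z) * cmod (g z))"
    using nn_integral_eq_integral[OF int] by (simp add: ennreal_mult)
  have sq: "(\<integral>\<^sup>+z. (ennreal (cmod (h z)))\<^sup>2 \<partial>N) = ennreal (LINT z|N. (cmod (h z))\<^sup>2)" if "h \<in> L2_functions N" for h
    using nn_integral_eq_integral[OF L2_functions_integrable[OF that]] by (simp add: ennreal_power)
  have "ennreal ((LINT z|N. cmod (f z) * cmod (g z))\<^sup>2) \<le> ennreal ((LINT z|N. (cmod (f z))\<^sup>2) * (LINT z|N. (cmod (g z))\<^sup>2))"
    using Cauchy_Schwarz_nn_integral[of "\<lambda>z. ennreal (cmod (f z))" N "\<lambda>z. ennreal (cmod (g z))"]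
    unfolding eq sq[OF assms(1)] sq[OF assms(2)]
    by (simp add: ennreal_power ennreal_mult integral_nonneg_AE)
  then have "(LINT z|N. cmod (f z) * cmod (g z))\<^sup>2 \<le> (l2_norm N f * l2_norm N g)\<^sup>2"
    by (simp add: l2_norm_square power_mult_distrib ennreal_le_iff integral_nonneg_AE)
  then have "(LINT z|N. cmod (f z) * cmod (g z)) \<le> l2_norm N f * l2_norm N g"
    by (rule power2_le_imp_le) (simp add: l2_norm_nonneg)
  moreover have "cmod (LINT z|N. f z * cnj (g z)) \<le> (LINT z|N. cmod (f z * cnj (g z)))"
    by (rule integral_norm_bound)
  ultimately show ?thesis by (simp add: norm_mult)
qed

context finite_circle_measure
begin

lemma L2_bounded:
  assumes "f \<in> borel_measurable N" "\<And>z. cmod z = 1 \<Longrightarrow> cmod (f z) \<le> B"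
  shows "f \<in> L2_functions N"
proof -
  note [measurable] = assms(1)
  have "integrable N (\<lambda>z. (cmod (f z))\<^sup>2)"
    by (rule integrable_const_bound[where B = "B\<^sup>2"]) 
       (auto intro!: AE_I2 power_mono assms simp: space_N)
  then show ?thesis by (simp add: L2_functions_def)
qed

lemma L2_continuous: "continuous_on (sphere 0 1) f \<Longrightarrow> f \<in> L2_functions N"
  unfolding L2_functions_def
  by (auto intro!: continuous_on_circle_measurable sets_N integrable_continuous continuous_intros)

lemma l2_norm_le_bound:
  assumes "f \<in> L2_functions N" "\<And>z. cmod z = 1 \<Longrightarrow> cmod (f z) \<le> B"
  shows "(l2_norm N f)\<^sup>2 \<le> B\<^sup>2 * measure N (sphere 0 1)"
proof -
  have "(LINT z|N. (cmod (f z))\<^sup>2) \<le> (LINT z|N. B\<^sup>2)"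
    using assms by (intro integral_mono L2_functions_integrable power_mono) (auto simp: space_N)
  then show ?thesis by (simp add: l2_norm_square space_N mult.commute)
qed

lemma trig_L2: "p \<in> trig_polynomials \<Longrightarrow> p \<in> L2_functions N"
  by (intro L2_continuous trig_polynomial_continuous)

lemma trig_closure_limit:
  assumes f: "f \<in> L2_functions N"
    and g: "\<And>\<epsilon>. \<epsilon> > 0 \<Longrightarrow> \<exists>g\<in>trig_closure N. (LINT z|N. (cmod (f z - g z))\<^sup>2) < \<epsilon>"
  shows "f \<in> trig_closure N"
  unfolding trig_closure_def
proof safe
  fix \<epsilon> :: real assume \<epsilon>: "\<epsilon> > 0"
  obtain g where g: "g \<in> trig_closure N" "(LINT z|N. (cmod (f z - g z))\<^sup>2) < \<epsilon> / 4"
    using g[of "\<epsilon> / 4"] \<epsilon> by auto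
  then obtain p where p: "p \<in> trig_polynomials" "(LINT z|N. (cmod (g z - p z))\<^sup>2) < \<epsilon> / 4"
    using \<epsilon> unfolding trig_closure_def by (auto dest!: spec[of _ "\<epsilon> / 4"])
  have g2: "g \<in> L2_functions N" using g by (simp add: trig_closure_def)
  have i: "integrable N (\<lambda>z. (cmod (f z - g z))\<^sup>2)" "integrable N (\<lambda>z. (cmod (g z - p z))\<^sup>2)"
     "integrable N (\<lambda>z. (cmod (f z - p z))\<^sup>2)"
    by (intro L2_functions_integrable L2_functions_diff f g2 trig_L2 p)+
  have "(LINT z|N. (cmod (f z - p z))\<^sup>2) \<le> (LINT z|N. 2 * (cmod (f z - g z))\<^sup>2 + 2 * (cmod (g z - p z))\<^sup>2)"
    using i norm_square_add_le[of "f z - g z" "g z - p z" for z]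
    by (intro integral_mono Bochner_Integration.integrable_add integrable_mult_right) auto
  also have "\<dots> < \<epsilon>" using i g(2) p(2) by simp
  finally show "\<exists>p\<in>trig_polynomials. (LINT z|N. (cmod (f z - p z))\<^sup>2) < \<epsilon>" using p(1) by blast
qed (use f in auto)

text \<open>
  The one limit theorem behind the density proof: it is used for closed sets (cutoff functions),
  countable unions (partial sums) and general functions (simple functions).
\<close>

lemma trig_closure_dominated_limit:
  assumes f: "f \<in> L2_functions N" and g: "\<And>i :: nat. g i \<in> trig_closure N"
    and lim: "\<And>z. cmod z = 1 \<Longrightarrow> (\<lambda>i. g i z) \<longlonglongrightarrow> f z"
    and dom: "\<And>i z. cmod z = 1 \<Longrightarrow> (cmod (f z - g i z))\<^sup>2 \<le> u z" and u: "integrable N u"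
  shows "f \<in> trig_closure N"
proof (rule trig_closure_limit[OF f])
  fix \<epsilon> :: real assume \<epsilon>: "\<epsilon> > 0"
  have [measurable]: "f \<in> borel_measurable N" "g i \<in> borel_measurable N" for i
    using f g by (auto simp: trig_closure_def L2_functions_def)
  have "(\<lambda>i. LINT z|N. (cmod (f z - g i z))\<^sup>2) \<longlonglongrightarrow> (LINT z|N. 0)"
  proof (rule integral_dominated_convergence[where w = u])
    have "(\<lambda>i. (cmod (f z - g i z))\<^sup>2) \<longlonglongrightarrow> (cmod (f z - f z))\<^sup>2" if "cmod z = 1" for z
      by (intro tendsto_intros lim that)
    then show "AE z in N. (\<lambda>i. (cmod (f z - g i z))\<^sup>2) \<longlonglongrightarrow> 0"
      by (intro AE_I2) (simp add: space_N)
    show "AE z in N. norm ((cmod (f z - g i z))\<^sup>2) \<le> u z" for i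
      by (intro AE_I2) (simp add: space_N dom)
  qed (use u in auto)
  then have "eventually (\<lambda>i. (LINT z|N. (cmod (f z - g i z))\<^sup>2) < \<epsilon>) sequentially"
    using \<epsilon> by (intro order_tendstoD(2)) auto
  then show "\<exists>g\<in>trig_closure N. (LINT z|N. (cmod (f z - g z))\<^sup>2) < \<epsilon>"
    using g by (auto simp: eventually_sequentially)
qed

lemma trig_closure_uniform:
  assumes f: "f \<in> L2_functions N"
    and p: "\<And>\<epsilon>. \<epsilon> > 0 \<Longrightarrow> \<exists>p\<in>trig_polynomials. \<forall>z. cmod z = 1 \<longrightarrow> cmod (f z - p z) \<le> \<epsilon>"
  shows "f \<in> trig_closure N"
  unfolding trig_closure_def
proof safe
  fix \<epsilon> :: real assume \<epsilon>: "\<epsilon> > 0"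
  \<comment> \<open>Adding 1 to the mass avoids a case distinction for the zero measure.\<close>
  define \<delta> where "\<delta> = sqrt (\<epsilon> / (2 * (measure N (sphere 0 1) + 1)))"
  have m: "measure N (sphere 0 1) + 1 > 0" using measure_nonneg[of N "sphere 0 1"] by linarith
  then have \<delta>: "\<delta> > 0" "\<delta>\<^sup>2 = \<epsilon> / (2 * (measure N (sphere 0 1) + 1))" using \<epsilon> by (auto simp: \<delta>_def)
  obtain p where p: "p \<in> trig_polynomials" "\<And>z. cmod z = 1 \<Longrightarrow> cmod (f z - p z) \<le> \<delta>"
    using p[OF \<delta>(1)] by blast
  have "(LINT z|N. (cmod (f z - p z))\<^sup>2) \<le> \<delta>\<^sup>2 * measure N (sphere 0 1)"
    unfolding l2_norm_square[symmetric]
    by (intro l2_norm_le_bound L2_functions_diff f trig_L2 p)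
  also have "\<dots> = (\<epsilon> / 2) * (measure N (sphere 0 1) / (measure N (sphere 0 1) + 1))" unfolding \<delta>(2) by simp
  also have "\<dots> \<le> (\<epsilon> / 2) * 1" using \<epsilon> m by (intro mult_left_mono) auto
  also have "\<dots> < \<epsilon>" using \<epsilon> by simp
  finally show "\<exists>p\<in>trig_polynomials. (LINT z|N. (cmod (f z - p z))\<^sup>2) < \<epsilon>" using p(1) by blast
qed (use f in auto)

lemma trig_closure_add:
  assumes "f \<in> trig_closure N" "g \<in> trig_closure N"
  shows "(\<lambda>z. f z + g z) \<in> trig_closure N"
  unfolding trig_closure_def
proof safe
  have L2: "f \<in> L2_functions N" "g \<in> L2_functions N" using assms by (auto simp: trig_closure_def)
  then show "(\<lambda>z. f z + g z) \<in> L2_functions N" by (rule L2_functions_add)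
  fix \<epsilon> :: real assume \<epsilon>: "\<epsilon> > 0"
  then have \<epsilon>4: "\<epsilon> / 4 > 0" by simp
  obtain p where p: "p \<in> trig_polynomials" "(LINT z|N. (cmod (f z - p z))\<^sup>2) < \<epsilon> / 4"
    using assms(1) \<epsilon>4 unfolding trig_closure_def by blast
  obtain q where q: "q \<in> trig_polynomials" "(LINT z|N. (cmod (g z - q z))\<^sup>2) < \<epsilon> / 4"
    using assms(2) \<epsilon>4 unfolding trig_closure_def by blast
  have i: "integrable N (\<lambda>z. (cmod (f z - p z))\<^sup>2)" "integrable N (\<lambda>z. (cmod (g z - q z))\<^sup>2)"
     "integrable N (\<lambda>z. (cmod ((f z + g z) - (p z + q z)))\<^sup>2)"
    by (intro L2_functions_integrable L2_functions_diff L2_functions_add L2 trig_L2 p q)+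
  have "(cmod ((f z + g z) - (p z + q z)))\<^sup>2 \<le> 2 * (cmod (f z - p z))\<^sup>2 + 2 * (cmod (g z - q z))\<^sup>2" for z
    using norm_square_add_le[of "f z - p z" "g z - q z"] by (simp add: algebra_simps)
  then have "(LINT z|N. (cmod ((f z + g z) - (p z + q z)))\<^sup>2) \<le> (LINT z|N. 2 * (cmod (f z - p z))\<^sup>2 + 2 * (cmod (g z - q z))\<^sup>2)"
    using i by (intro integral_mono Bochner_Integration.integrable_add integrable_mult_right)
  also have "\<dots> < \<epsilon>" using i p(2) q(2) by simp
  finally show "\<exists>p\<in>trig_polynomials. (LINT z|N. (cmod ((f z + g z) - p z))\<^sup>2) < \<epsilon>"
    by (rule bexI[OF _ trig_polynomial_add[OF p(1) q(1)]])
qed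

lemma trig_closure_cmult:
  assumes "f \<in> trig_closure N"
  shows "(\<lambda>z. c * f z) \<in> trig_closure N"
  unfolding trig_closure_def
proof safe
  have L2: "f \<in> L2_functions N" using assms by (auto simp: trig_closure_def)
  then show "(\<lambda>z. c * f z) \<in> L2_functions N" by (rule L2_functions_cmult)
  fix \<epsilon> :: real assume \<epsilon>: "\<epsilon> > 0"
  have c: "(cmod c)\<^sup>2 + 1 > 0" using zero_le_power2[of "cmod c"] by linarith
  then have "\<epsilon> / ((cmod c)\<^sup>2 + 1) > 0" using \<epsilon> by simp
  then obtain p where p: "p \<in> trig_polynomials" "(LINT z|N. (cmod (f z - p z))\<^sup>2) < \<epsilon> / ((cmod c)\<^sup>2 + 1)"
    using assms(1) unfolding trig_closure_def by blast
  have "(LINT z|N. (cmod (c * f z - c * p z))\<^sup>2) = (cmod c)\<^sup>2 * (LINT z|N. (cmod (f z - p z))\<^sup>2)"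
    by (simp add: norm_mult power_mult_distrib flip: right_diff_distrib)
  also have "\<dots> \<le> ((cmod c)\<^sup>2 + 1) * (LINT z|N. (cmod (f z - p z))\<^sup>2)"
    by (intro mult_right_mono) (auto simp: integral_nonneg_AE)
  also have "\<dots> < \<epsilon>" using p(2) c by (simp add: field_simps)
  finally show "\<exists>p\<in>trig_polynomials. (LINT z|N. (cmod (c * f z - p z))\<^sup>2) < \<epsilon>"
    by (rule bexI[OF _ trig_polynomial_cmult[OF p(1)]])
qed

lemma trig_closure_const: "(\<lambda>z. c) \<in> trig_closure N"
  by (intro trig_closure_uniform L2_continuous continuous_intros bexI[of _ "\<lambda>z. c"] trig_polynomial_const) auto

lemma trig_closure_sum:
  assumes "finite A" "\<And>a. a \<in> A \<Longrightarrow> f a \<in> trig_closure N"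
  shows "(\<lambda>z. \<Sum>a\<in>A. f a z) \<in> trig_closure N"
  using assms by (induction A) (auto intro: trig_closure_const trig_closure_add)

lemma trig_closure_indicator_closed:
  assumes F: "closed F" "F \<subseteq> sphere 0 1"
  shows "(indicator F :: complex \<Rightarrow> complex) \<in> trig_closure N"
proof (cases "F = {}")
  case True
  then show ?thesis using trig_closure_const[of 0] by (simp add: indicator_def[abs_def])
next
  case False
  have FN: "F \<in> sets N" by (rule closed_in_sets[OF F])
  show ?thesis
  proof (rule trig_closure_dominated_limit[where u = "\<lambda>_. 1"])
    show "(indicator F :: complex \<Rightarrow> complex) \<in> L2_functions N"
      by (rule L2_bounded[where B = 1]) (use FN in \<open>auto simp: indicator_def\<close>)
    show "(\<lambda>z. complex_of_real (closed_cutoff F i z)) \<in> trig_closure N" for i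
    proof (rule trig_closure_uniform)
      show "(\<lambda>z. complex_of_real (closed_cutoff F i z)) \<in> L2_functions N"
        by (rule L2_bounded[where B = 1]) (use cutoff_measurable[of F i] in \<open>auto simp: closed_cutoff_bounds\<close>)
      show "\<exists>p\<in>trig_polynomials. \<forall>z. cmod z = 1 \<longrightarrow> cmod (of_real (closed_cutoff F i z) - p z) \<le> \<epsilon>" if "\<epsilon> > 0" for \<epsilon>
        using closed_cutoff_trig_approx[OF that, of F i] by metis
    qed
    fix z :: complex
    have "(\<lambda>i. complex_of_real (closed_cutoff F i z)) \<longlonglongrightarrow> of_real (indicator F z)"
      by (intro tendsto_of_real closed_cutoff_tendsto F False)
    then show "(\<lambda>i. complex_of_real (closed_cutoff F i z)) \<longlonglongrightarrow> indicator F z"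
      by (simp add: of_real_indicator)
    fix i
    have "\<bar>indicator F z - closed_cutoff F i z\<bar> \<le> 1"
      using closed_cutoff_bounds[of F i z] by (auto simp: indicator_def)
    then have "(\<bar>indicator F z - closed_cutoff F i z\<bar>)\<^sup>2 \<le> 1" by (simp add: abs_square_le_1)
    moreover have "cmod (indicator F z - of_real (closed_cutoff F i z)) = \<bar>indicator F z - closed_cutoff F i z\<bar>"
      by (metis norm_of_real of_real_diff of_real_indicator)
    ultimately show "(cmod (indicator F z - of_real (closed_cutoff F i z)))\<^sup>2 \<le> 1" by simp
  qed auto
qed

text \<open>
  The measurable sets whose indicator function can be approximated form a Dynkin system that
  contains the closed sets.
\<close>

lemma trig_closure_indicator:
  assumes A: "A \<in> sets N"
  shows "(indicator A :: complex \<Rightarrow> complex) \<in> trig_closure N"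
proof -
  have L2: "(indicator B :: complex \<Rightarrow> complex) \<in> L2_functions N" if "B \<in> sets N" for B
    by (rule L2_bounded[where B = 1]) (use that in \<open>auto simp: indicator_def\<close>)
  have gen: "sets N = sigma_sets (sphere 0 1) {F. closed F \<and> F \<subseteq> sphere 0 1}"
    by (simp add: sets_N circle_sets_generated)
  have "Int_stable {F :: complex set. closed F \<and> F \<subseteq> sphere 0 1}" by (auto simp: Int_stable_def)
  moreover have "{F :: complex set. closed F \<and> F \<subseteq> sphere 0 1} \<subseteq> Pow (sphere 0 1)" by auto
  moreover have "A \<in> sigma_sets (sphere 0 1) {F. closed F \<and> F \<subseteq> sphere 0 1}" using A gen by simp
  ultimately show ?thesis
  proof (induction A rule: sigma_sets_induct_disjoint)
    case (basic A)
    then show ?case by (intro trig_closure_indicator_closed) auto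
  next
    case empty
    show ?case by (rule trig_closure_indicator_closed) auto
  next
    case (compl A)
    have "(\<lambda>z. 1 + (-1) * indicator A z :: complex) \<in> trig_closure N"
      by (intro trig_closure_add trig_closure_cmult trig_closure_const compl)
    then show ?case
    proof (rule trig_closure_dominated_limit[where g = "\<lambda>_ z. 1 + (-1) * indicator A z" and u = "\<lambda>_. 0", rotated])
      show "(indicator (sphere 0 1 - A) :: complex \<Rightarrow> complex) \<in> L2_functions N"
        using compl gen space_N by (intro L2) (metis sets.compl_sets)
    qed (auto simp: indicator_def)
  next
    case (union A)
    have AN: "A i \<in> sets N" for i using union(2) gen by auto
    show ?case
    proof (rule trig_closure_dominated_limit[where u = "\<lambda>_. 1"])
      show "(indicator (\<Union>i. A i) :: complex \<Rightarrow> complex) \<in> L2_functions N"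
        using AN by (intro L2) auto
      show "(\<lambda>z. \<Sum>i<n. indicator (A i) z :: complex) \<in> trig_closure N" for n
        using union by (intro trig_closure_sum) auto
      fix z :: complex
      have ind: "(\<Sum>i<n. indicator (A i) z) = (indicator (\<Union>i<n. A i) z :: complex)" for n
        using union(1) by (intro indicator_UN_disjoint[symmetric]) (auto intro: disjoint_family_on_mono)
      show "(\<lambda>n. \<Sum>i<n. indicator (A i) z :: complex) \<longlonglongrightarrow> indicator (\<Union>i. A i) z"
        unfolding ind by (rule LIMSEQ_indicator_UN)
      show "(cmod (indicator (\<Union>i. A i) z - (\<Sum>i<n. indicator (A i) z)))\<^sup>2 \<le> 1" for n
        unfolding ind by (auto simp: indicator_def)
    qed auto
  qed
qed

text \<open>
  A measurable function is a pointwise limit of simple functions bounded by twice its modulus,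
  and simple functions are combinations of indicator functions.
\<close>

theorem trig_polynomials_dense:
  assumes f: "f \<in> L2_functions N" and \<epsilon>: "\<epsilon> > 0"
  obtains p where "p \<in> trig_polynomials" "(LINT z|N. (cmod (f z - p z))\<^sup>2) < \<epsilon>"
proof -
  obtain s where s: "\<And>i. simple_function N (s i)"
    "\<And>x. x \<in> space N \<Longrightarrow> (\<lambda>i. s i x) \<longlonglongrightarrow> f x"
    "\<And>i x. x \<in> space N \<Longrightarrow> dist (s i x) 0 \<le> 2 * dist (f x) 0"
    using borel_measurable_implies_sequence_metric[OF L2_functions_measurable[OF f], of 0] by blast
  define S where "S i x = (\<Sum>y\<in>s i ` space N. y * indicator (s i -` {y} \<inter> space N) x)" for i x
  have S: "S i x = s i x" if "x \<in> space N" for i x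
  proof -
    have fin: "finite (s i ` space N)" using s(1)[of i] by (rule simple_functionD)
    have "S i x = (\<Sum>y\<in>s i ` space N. if y = s i x then y else 0)"
      unfolding S_def using that by (intro sum.cong) (auto simp: indicator_def)
    also have "\<dots> = s i x" using that fin by simp
    finally show ?thesis .
  qed
  have "f \<in> trig_closure N"
  proof (rule trig_closure_dominated_limit[where g = S and u = "\<lambda>z. 9 * (cmod (f z))\<^sup>2"])
    show "S i \<in> trig_closure N" for i
      unfolding S_def[abs_def] using s(1)[of i]
      by (intro trig_closure_sum trig_closure_cmult trig_closure_indicator) (auto dest: simple_functionD)
    fix z :: complex assume z: "cmod z = 1"
    then have z: "z \<in> space N" by (simp add: space_N)
    show "(\<lambda>i. S i z) \<longlonglongrightarrow> f z" using s(2) z by (simp add: S)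
    fix i
    have "cmod (f z - S i z) \<le> cmod (f z) + cmod (s i z)" unfolding S[OF z] by (rule norm_triangle_ineq4)
    also have "\<dots> \<le> 3 * cmod (f z)" using s(3)[OF z, of i] by (simp add: dist_norm)
    finally have "(cmod (f z - S i z))\<^sup>2 \<le> (3 * cmod (f z))\<^sup>2" by (intro power_mono) auto
    then show "(cmod (f z - S i z))\<^sup>2 \<le> 9 * (cmod (f z))\<^sup>2" by (simp add: power_mult_distrib)
  qed (use f L2_functions_integrable[OF f] in auto)
  then show ?thesis using \<epsilon> that unfolding trig_closure_def by blast
qed

end

section \<open>Correlations of a measure preserving circle map\<close>

text \<open>
  The complex number whose modulus is the correlation. It is linear in \<open>f\<close> and conjugate linear
  in \<open>g\<close>, which the correlation is not.
\<close>

definition covariance :: "complex measure \<Rightarrow> (complex \<Rightarrow> complex) \<Rightarrow> (complex \<Rightarrow> complex) \<Rightarrow> (complex \<Rightarrow> complex) \<Rightarrow> nat \<Rightarrow> complex"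
  where "covariance N \<phi> f g n = (LINT z|N. f ((\<phi> ^^ n) z) * cnj (g z)) - (LINT z|N. f z) * (LINT z|N. cnj (g z))"

lemma correlation_eq: "correlation N \<phi> f g n = cmod (covariance N \<phi> f g n)"
  by (simp add: correlation_def covariance_def)

lemma correlation_nonneg: "0 \<le> correlation N \<phi> f g n"
  by (simp add: correlation_def)

locale circle_system = finite_circle_measure +
  fixes \<phi> :: "complex \<Rightarrow> complex"
  assumes mass_one: "measure N (sphere 0 1) = 1"
    and measurable_map: "\<phi> \<in> measurable N N"
    and preserves: "distr N N \<phi> = N"
begin

lemma iterate_measurable: "\<phi> ^^ n \<in> measurable N N"
  using measurable_map by (induction n) (auto simp: measurable_ident comp_def id_def intro: measurable_compose)

lemma iterate_circle: "cmod z = 1 \<Longrightarrow> cmod ((\<phi> ^^ n) z) = 1"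
  using measurable_space[OF iterate_measurable, of z n] by (simp add: space_N)

lemma iterate_preserves: "distr N N (\<phi> ^^ n) = N"
proof (induction n)
  case (Suc n)
  have "distr N N (\<phi> ^^ Suc n) = distr (distr N N (\<phi> ^^ n)) N \<phi>"
    by (simp add: distr_distr measurable_map iterate_measurable)
  then show ?case by (simp only: Suc preserves)
qed (simp add: distr_id2 id_def)

lemma integral_iterate:
  fixes f :: "complex \<Rightarrow> 'b :: {banach, second_countable_topology}"
  assumes "f \<in> borel_measurable N"
  shows "(LINT z|N. f ((\<phi> ^^ n) z)) = (LINT z|N. f z)"
  using integral_distr[OF iterate_measurable[of n] assms] by (simp add: iterate_preserves)

lemma iterate_L2:
  assumes "f \<in> L2_functions N"
  shows "(\<lambda>z. f ((\<phi> ^^ n) z)) \<in> L2_functions N"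
proof -
  have m: "(\<lambda>z. (cmod (f z))\<^sup>2) \<in> borel_measurable N"
    using L2_functions_measurable[OF assms] by measurable
  have "integrable (distr N N (\<phi> ^^ n)) (\<lambda>z. (cmod (f z))\<^sup>2)"
    unfolding iterate_preserves by (rule L2_functions_integrable[OF assms])
  then have "integrable N (\<lambda>z. (cmod (f ((\<phi> ^^ n) z)))\<^sup>2)"
    using integrable_distr_eq[OF iterate_measurable m] by simp
  moreover have "(\<lambda>z. f ((\<phi> ^^ n) z)) \<in> borel_measurable N"
    by (rule measurable_compose[OF iterate_measurable L2_functions_measurable[OF assms]])
  ultimately show ?thesis by (simp add: L2_functions_def)
qed

lemma iterate_l2_norm:
  assumes "f \<in> L2_functions N"
  shows "l2_norm N (\<lambda>z. f ((\<phi> ^^ n) z)) = l2_norm N f"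
proof -
  have "(\<lambda>z. (cmod (f z))\<^sup>2) \<in> borel_measurable N"
    using L2_functions_measurable[OF assms] by measurable
  from integral_iterate[OF this] show ?thesis by (simp add: l2_norm_def)
qed

lemma one_L2: "(\<lambda>z. 1) \<in> L2_functions N"
  by (intro L2_continuous continuous_intros)

lemma l2_norm_one: "l2_norm N (\<lambda>z. 1) = 1"
  by (simp add: l2_norm_def space_N mass_one)

lemma L2_integrable: "f \<in> L2_functions N \<Longrightarrow> integrable N f"
  using L2_functions_product[OF _ one_L2] by simp

lemma norm_integral_le_l2_norm: "f \<in> L2_functions N \<Longrightarrow> cmod (LINT z|N. f z) \<le> l2_norm N f"
  using L2_cauchy_schwarz[OF _ one_L2] by (simp add: l2_norm_one)

lemma l2_norm_le:
  assumes "f \<in> L2_functions N" "\<And>z. cmod z = 1 \<Longrightarrow> cmod (f z) \<le> B"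
  shows "l2_norm N f \<le> B"
proof -
  have "0 \<le> B" using order_trans[OF norm_ge_zero assms(2)[of 1]] by simp
  then show ?thesis
    using l2_norm_le_bound[OF assms] l2_norm_nonneg unfolding mass_one by (auto intro: power2_le_imp_le)
qed

lemma correlation_le:
  assumes f: "f \<in> L2_functions N" and g: "g \<in> L2_functions N"
  shows "correlation N \<phi> f g n \<le> 2 * l2_norm N f * l2_norm N g"
proof -
  have "correlation N \<phi> f g n \<le> cmod (LINT z|N. f ((\<phi> ^^ n) z) * cnj (g z)) + cmod ((LINT z|N. f z) * (LINT z|N. cnj (g z)))"
    unfolding correlation_def by (rule norm_triangle_ineq4)
  moreover have "cmod (LINT z|N. f ((\<phi> ^^ n) z) * cnj (g z)) \<le> l2_norm N f * l2_norm N g"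
    using L2_cauchy_schwarz[OF iterate_L2[OF f] g] by (simp add: iterate_l2_norm[OF f])
  moreover have "cmod ((LINT z|N. f z) * (LINT z|N. cnj (g z))) \<le> l2_norm N f * l2_norm N g"
    unfolding norm_mult using norm_integral_le_l2_norm[OF f] norm_integral_le_l2_norm[OF g]
    by (intro mult_mono) (auto simp: l2_norm_nonneg)
  ultimately show ?thesis by simp
qed

lemma covariance_add_left:
  assumes "f \<in> L2_functions N" "f' \<in> L2_functions N" "g \<in> L2_functions N"
  shows "covariance N \<phi> (\<lambda>z. f z + f' z) g n = covariance N \<phi> f g n + covariance N \<phi> f' g n"
  unfolding covariance_def
  using L2_functions_product[OF iterate_L2[OF assms(1)] assms(3)] L2_functions_product[OF iterate_L2[OF assms(2)] assms(3)]
    L2_integrable[OF assms(1)] L2_integrable[OF assms(2)]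
  by (simp add: algebra_simps)

lemma covariance_add_right:
  assumes "f \<in> L2_functions N" "g \<in> L2_functions N" "g' \<in> L2_functions N"
  shows "covariance N \<phi> f (\<lambda>z. g z + g' z) n = covariance N \<phi> f g n + covariance N \<phi> f g' n"
  unfolding covariance_def
  using L2_functions_product[OF iterate_L2[OF assms(1)] assms(2)] L2_functions_product[OF iterate_L2[OF assms(1)] assms(3)]
    L2_integrable[OF assms(2)] L2_integrable[OF assms(3)]
  by (simp add: algebra_simps)

lemma covariance_cmult_left: "covariance N \<phi> (\<lambda>z. c * f z) g n = c * covariance N \<phi> f g n"
  and covariance_cmult_right: "covariance N \<phi> f (\<lambda>z. c * g z) n = cnj c * covariance N \<phi> f g n"
  unfolding covariance_def by (simp_all add: algebra_simps)

lemma L2_functions_sum: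
  "finite A \<Longrightarrow> (\<And>a. a \<in> A \<Longrightarrow> f a \<in> L2_functions N) \<Longrightarrow> (\<lambda>z. \<Sum>a\<in>A. f a z) \<in> L2_functions N"
  by (induction A rule: finite_induct) (auto intro!: L2_functions_add L2_continuous[of "\<lambda>z. 0"])

lemma correlation_sum_le:
  assumes "finite K" "finite L" "\<And>k. k \<in> K \<Longrightarrow> f k \<in> L2_functions N" "\<And>l. l \<in> L \<Longrightarrow> g l \<in> L2_functions N"
  shows "correlation N \<phi> (\<lambda>z. \<Sum>k\<in>K. a k * f k z) (\<lambda>z. \<Sum>l\<in>L. b l * g l z) n \<le>
    (\<Sum>k\<in>K. \<Sum>l\<in>L. cmod (a k) * cmod (b l) * correlation N \<phi> (f k) (g l) n)"
proof -
  have zl: "covariance N \<phi> (\<lambda>z. 0) h n = 0" "covariance N \<phi> h (\<lambda>z. 0) n = 0" for h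
    by (simp_all add: covariance_def)
  have right: "covariance N \<phi> h (\<lambda>z. \<Sum>l\<in>L. b l * g l z) n = (\<Sum>l\<in>L. cnj (b l) * covariance N \<phi> h (g l) n)"
    if h: "h \<in> L2_functions N" for h
    using assms(2,4)
  proof (induction L rule: finite_induct)
    case (insert l L)
    then show ?case
      by (simp add: covariance_add_right covariance_cmult_right h L2_functions_cmult L2_functions_sum)
  qed (simp add: zl)
  have left: "covariance N \<phi> (\<lambda>z. \<Sum>k\<in>K. a k * f k z) h n = (\<Sum>k\<in>K. a k * covariance N \<phi> (f k) h n)"
    if h: "h \<in> L2_functions N" for h
    using assms(1,3)
  proof (induction K rule: finite_induct)
    case (insert l L)
    then show ?case
      by (simp add: covariance_add_left covariance_cmult_left h L2_functions_cmult L2_functions_sum)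
  qed (simp add: zl)
  have "covariance N \<phi> (\<lambda>z. \<Sum>k\<in>K. a k * f k z) (\<lambda>z. \<Sum>l\<in>L. b l * g l z) n = 
    (\<Sum>k\<in>K. a k * (\<Sum>l\<in>L. cnj (b l) * covariance N \<phi> (f k) (g l) n))"
    using assms by (subst left) (auto intro!: L2_functions_sum L2_functions_cmult sum.cong simp: right)
  also have "cmod \<dots> \<le> (\<Sum>k\<in>K. \<Sum>l\<in>L. cmod (a k) * cmod (b l) * correlation N \<phi> (f k) (g l) n)"
    unfolding sum_distrib_left
    by (intro order_trans[OF norm_sum] sum_mono) (simp add: correlation_eq norm_mult mult.assoc)
  finally show ?thesis by (simp add: correlation_eq)
qed

text \<open>
  Correlations depend continuously on both functions in \<open>L\<^sub>2\<close>, uniformly in \<open>n\<close>, because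
  composition with a measure preserving map is an isometry. All three mixing statements reduce
  to trigonometric polynomials through this estimate.
\<close>

lemma correlation_perturb:
  assumes "f \<in> L2_functions N" "g \<in> L2_functions N" "p \<in> L2_functions N" "q \<in> L2_functions N"
  shows "correlation N \<phi> f g n \<le> correlation N \<phi> p q n + 2 * l2_norm N (\<lambda>z. f z - p z) * l2_norm N g
     + 2 * l2_norm N p * l2_norm N (\<lambda>z. g z - q z)"
proof -
  have "covariance N \<phi> f g n = covariance N \<phi> (\<lambda>z. f z - p z) g n + covariance N \<phi> p g n"
    using covariance_add_left[OF L2_functions_diff[OF assms(1,3)] assms(3) assms(2)] by simp
  also have "covariance N \<phi> p g n = covariance N \<phi> p (\<lambda>z. g z - q z) n + covariance N \<phi> p q n"
    using covariance_add_right[OF assms(3) L2_functions_diff[OF assms(2,4)] assms(4)] by simp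
  finally have "correlation N \<phi> f g n \<le> correlation N \<phi> (\<lambda>z. f z - p z) g n
       + (correlation N \<phi> p (\<lambda>z. g z - q z) n + correlation N \<phi> p q n)"
    unfolding correlation_eq by (auto intro!: order_trans[OF norm_triangle_ineq] add_left_mono norm_triangle_ineq)
  moreover have "correlation N \<phi> (\<lambda>z. f z - p z) g n \<le> 2 * l2_norm N (\<lambda>z. f z - p z) * l2_norm N g"
    by (intro correlation_le L2_functions_diff assms)
  moreover have "correlation N \<phi> p (\<lambda>z. g z - q z) n \<le> 2 * l2_norm N p * l2_norm N (\<lambda>z. g z - q z)"
    by (intro correlation_le L2_functions_diff assms)
  ultimately show ?thesis by linarith
qed

lemma correlation_cong:
  assumes "\<And>z. cmod z = 1 \<Longrightarrow> f z = f' z" "\<And>z. cmod z = 1 \<Longrightarrow> g z = g' z"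
  shows "correlation N \<phi> f g n = correlation N \<phi> f' g' n"
proof -
  have "(LINT z|N. f ((\<phi> ^^ n) z) * cnj (g z)) = (LINT z|N. f' ((\<phi> ^^ n) z) * cnj (g' z))"
    "(LINT z|N. f z) = (LINT z|N. f' z)" "(LINT z|N. cnj (g z)) = (LINT z|N. cnj (g' z))"
    by (intro Bochner_Integration.integral_cong refl; simp add: space_N assms iterate_circle)+
  then show ?thesis by (simp add: correlation_def)
qed

lemma correlation_cnj: "correlation N \<phi> (\<lambda>z. cnj (f z)) (\<lambda>z. cnj (g z)) n = correlation N \<phi> f g n"
proof -
  have "covariance N \<phi> (\<lambda>z. cnj (f z)) (\<lambda>z. cnj (g z)) n = cnj (covariance N \<phi> f g n)"
    unfolding covariance_def by (simp flip: Bochner_Integration.integral_cnj)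
  then show ?thesis by (simp add: correlation_eq)
qed

text \<open>
  Conjugation reduces negative powers in the first argument to positive ones, for which the
  iterates are holomorphic.
\<close>

lemma correlation_powi_uminus:
  "correlation N \<phi> (\<lambda>z. z powi (- j)) (\<lambda>z. z powi (- k)) n = correlation N \<phi> (\<lambda>z. z powi j) (\<lambda>z. z powi k) n"
proof -
  have "correlation N \<phi> (\<lambda>z. z powi (- j)) (\<lambda>z. z powi (- k)) n =
    correlation N \<phi> (\<lambda>z. cnj (z powi j)) (\<lambda>z. cnj (z powi k)) n"
    by (rule correlation_cong)
       (simp_all add: cnj_circle power_int_minus power_int_inverse)
  then show ?thesis by (simp only: correlation_cnj)
qed

lemma mixing_if_monomials:
  assumes "\<And>j k. (\<lambda>n. correlation N \<phi> (\<lambda>z. z powi j) (\<lambda>z. z powi k) n) \<longlonglongrightarrow> 0"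
  shows "mixing N \<phi>"
  unfolding mixing_def
proof (intro ballI)
  have trig: "(\<lambda>n. correlation N \<phi> p q n) \<longlonglongrightarrow> 0" if p: "p \<in> trig_polynomials" and q: "q \<in> trig_polynomials" for p q
  proof -
    obtain a K where K: "p = (\<lambda>z. \<Sum>k\<in>K. a k * z powi k)" "finite K"
      using p by (auto simp: trig_polynomials_def)
    obtain b L where L: "q = (\<lambda>z. \<Sum>k\<in>L. b k * z powi k)" "finite L"
      using q by (auto simp: trig_polynomials_def)
    have "(\<lambda>n. \<Sum>k\<in>K. \<Sum>l\<in>L. cmod (a k) * cmod (b l) * correlation N \<phi> (\<lambda>z. z powi k) (\<lambda>z. z powi l) n) 
       \<longlonglongrightarrow> (\<Sum>k\<in>K. \<Sum>l\<in>L. cmod (a k) * cmod (b l) * 0)"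
      by (intro tendsto_sum tendsto_mult tendsto_const assms)
    then have lim: "(\<lambda>n. \<Sum>k\<in>K. \<Sum>l\<in>L. cmod (a k) * cmod (b l) * correlation N \<phi> (\<lambda>z. z powi k) (\<lambda>z. z powi l) n) \<longlonglongrightarrow> 0"
      by simp
    have le: "correlation N \<phi> p q n \<le> (\<Sum>k\<in>K. \<Sum>l\<in>L. cmod (a k) * cmod (b l) * correlation N \<phi> (\<lambda>z. z powi k) (\<lambda>z. z powi l) n)" for n
      unfolding K(1) L(1)
      by (rule correlation_sum_le[OF K(2) L(2)]) (auto intro!: L2_continuous continuous_intros)
    show ?thesis
      by (rule tendsto_sandwich[OF _ _ tendsto_const lim]) (auto simp: correlation_nonneg le)
  qed
  fix f g assume f: "f \<in> L2_functions N" and g: "g \<in> L2_functions N"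
  have approx: "\<exists>p\<in>trig_polynomials. l2_norm N (\<lambda>z. h z - p z) < \<delta>" if h: "h \<in> L2_functions N" and \<delta>: "\<delta> > 0" for h \<delta>
  proof -
    obtain p where "p \<in> trig_polynomials" "(LINT z|N. (cmod (h z - p z))\<^sup>2) < \<delta>\<^sup>2"
      using trig_polynomials_dense[OF h, of "\<delta>\<^sup>2"] \<delta> by auto
    then show ?thesis
      using \<delta> by (intro bexI[of _ p]) (auto simp: l2_norm_def real_sqrt_less_iff intro: real_less_lsqrt)
  qed
  show "(\<lambda>n. correlation N \<phi> f g n) \<longlonglongrightarrow> 0"
  proof (rule LIMSEQ_I)
    fix e :: real assume e: "e > 0"
    have pos: "l2_norm N h + 1 > 0" for h using l2_norm_nonneg[of N h] by linarith
    obtain p where p: "p \<in> trig_polynomials" "l2_norm N (\<lambda>z. f z - p z) < e / (6 * (l2_norm N g + 1))"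
      using approx[OF f divide_pos_pos[OF e mult_pos_pos[OF _ pos[of g]], of 6]] by auto
    \<comment> \<open>The norm of \<open>p\<close> enters the error, so \<open>p\<close> is chosen before \<open>q\<close>.\<close>
    obtain q where q: "q \<in> trig_polynomials" "l2_norm N (\<lambda>z. g z - q z) < e / (6 * (l2_norm N p + 1))"
      using approx[OF g divide_pos_pos[OF e mult_pos_pos[OF _ pos[of p]], of 6]] by auto
    have cancel: "e / (6 * x) * x = e / 6" if "x > 0" for x using that by simp
    have 1: "2 * l2_norm N (\<lambda>z. f z - p z) * l2_norm N g \<le> e / 3"
    proof -
      have "l2_norm N (\<lambda>z. f z - p z) * l2_norm N g \<le> e / (6 * (l2_norm N g + 1)) * (l2_norm N g + 1)"
        using p(2) e pos[of g] by (intro mult_mono) (auto simp: l2_norm_nonneg)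
      also have "\<dots> = e / 6" by (rule cancel[OF pos])
      finally show ?thesis by simp
    qed
    have 2: "2 * l2_norm N p * l2_norm N (\<lambda>z. g z - q z) \<le> e / 3"
    proof -
      have "l2_norm N p * l2_norm N (\<lambda>z. g z - q z) \<le> (l2_norm N p + 1) * (e / (6 * (l2_norm N p + 1)))"
        using q(2) e pos[of p] by (intro mult_mono) (auto simp: l2_norm_nonneg)
      also have "\<dots> = e / 6" unfolding mult.commute[of "l2_norm N p + 1"] by (rule cancel[OF pos])
      finally show ?thesis by simp
    qed
    have "eventually (\<lambda>n. correlation N \<phi> p q n < e / 3) sequentially"
      using trig[OF p(1) q(1)] e by (intro order_tendstoD(2)) auto
    then have "eventually (\<lambda>n. correlation N \<phi> f g n < e) sequentially"
    proof eventually_elim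
      case (elim n)
      have "correlation N \<phi> f g n \<le> correlation N \<phi> p q n + 2 * l2_norm N (\<lambda>z. f z - p z) * l2_norm N g
         + 2 * l2_norm N p * l2_norm N (\<lambda>z. g z - q z)"
        by (intro correlation_perturb f g trig_L2 p q)
      then show ?case using elim 1 2 by linarith
    qed
    then show "\<exists>no. \<forall>n\<ge>no. norm (correlation N \<phi> f g n - 0) < e"
      by (simp add: eventually_sequentially correlation_nonneg)
  qed
qed

end

lemma finite_circle_measure_harmonic: "cmod w < 1 \<Longrightarrow> finite_circle_measure (harmonic_measure w)"
  by (simp add: finite_circle_measure_def finite_circle_measure_axioms_def sphere_measure_harmonic)

interpretation circle: finite_circle_measure circle_measure
  by (simp add: finite_circle_measure_def finite_circle_measure_axioms_def finite_measure_circle)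

text \<open>
  The image of harmonic measure under \<open>\<phi>\<close> has the moments \<open>\<integral> \<phi>\<^sup>k d\<nu> = (\<phi> w)\<^sup>k = w\<^sup>k\<close>, which are
  those of harmonic measure itself.
\<close>

lemma circle_system_harmonic:
  assumes \<phi>: "\<phi> \<in> disc_algebra" "\<And>z. cmod z = 1 \<Longrightarrow> cmod (\<phi> z) = 1" and w: "cmod w < 1" "\<phi> w = w"
  shows "circle_system (harmonic_measure w) \<phi>"
proof -
  interpret finite_circle_measure "harmonic_measure w" by (rule finite_circle_measure_harmonic[OF w(1)])
  have m: "\<phi> \<in> measurable (harmonic_measure w) (harmonic_measure w)"
  proof -
    have "\<phi> \<in> measurable (harmonic_measure w) (restrict_space borel (sphere 0 1))"
      using \<phi> by (intro measurable_restrict_space2 continuous_on_circle_measurable sets_N disc_algebra_continuous_circle)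
         (auto simp: space_N)
    then show ?thesis by (simp cong: measurable_cong_sets)
  qed
  have "distr (harmonic_measure w) (harmonic_measure w) \<phi> = harmonic_measure w"
  proof (rule circle_measure_eqI)
    show "finite_circle_measure (distr (harmonic_measure w) (harmonic_measure w) \<phi>)"
      unfolding finite_circle_measure_def finite_circle_measure_axioms_def
      using finite_measure_distr[OF m] by simp
    show "finite_circle_measure (harmonic_measure w)" by (rule finite_circle_measure_axioms)
    fix k :: nat
    have "(LINT z|distr (harmonic_measure w) (harmonic_measure w) \<phi>. z ^ k) = (LINT z|harmonic_measure w. \<phi> z ^ k)"
      by (intro integral_distr m continuous_on_circle_measurable sets_N continuous_intros)
    also have "\<dots> = \<phi> w ^ k" by (intro harmonic_mean_value disc_algebra_power \<phi> w)
    also have "\<dots> = (LINT z|harmonic_measure w. z ^ k)"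
      using harmonic_mean_value[OF disc_algebra_power[OF disc_algebra_ident] w(1), of k] by (simp add: w)
    finally show "(LINT z|distr (harmonic_measure w) (harmonic_measure w) \<phi>. z ^ k) = (LINT z|harmonic_measure w. z ^ k)" .
  qed
  then show ?thesis
    using m by unfold_locales (simp_all add: sphere_measure_harmonic[OF w(1)])
qed

section \<open>Moebius maps and the Schwarz lemma\<close>

definition disc_moebius :: "complex \<Rightarrow> complex \<Rightarrow> complex" where
  "disc_moebius w z = (z - w) / (1 - cnj w * z)"

lemma disc_moebius_identity:
  "(cmod (1 - cnj w * z))\<^sup>2 - (cmod (z - w))\<^sup>2 = (1 - (cmod w)\<^sup>2) * (1 - (cmod z)\<^sup>2)"
  unfolding cmod_power2 by (simp add: power2_eq_square algebra_simps)

lemma disc_moebius_defect: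
  assumes "cmod w < 1" "cmod z \<le> 1"
  shows "1 - (cmod (disc_moebius w z))\<^sup>2 = (1 - (cmod w)\<^sup>2) * (1 - (cmod z)\<^sup>2) / (cmod (1 - cnj w * z))\<^sup>2"
proof -
  have nz: "(cmod (1 - cnj w * z))\<^sup>2 \<noteq> 0" using one_minus_cnj_mult_nonzero[OF assms] by simp
  have "(cmod (disc_moebius w z))\<^sup>2 = (cmod (z - w))\<^sup>2 / (cmod (1 - cnj w * z))\<^sup>2"
    by (simp add: disc_moebius_def norm_divide power_divide)
  then show ?thesis
    unfolding disc_moebius_identity[symmetric] by (simp only: diff_divide_distrib divide_self[OF nz])
qed

lemma disc_moebius_circle: "cmod w < 1 \<Longrightarrow> cmod z = 1 \<Longrightarrow> cmod (disc_moebius w z) = 1"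
  using disc_moebius_defect[of w z] by (simp add: power2_eq_1_iff) (smt (verit) norm_ge_zero)

lemma disc_moebius_ball: 
  assumes "cmod w < 1" "cmod z < 1" 
  shows "cmod (disc_moebius w z) < 1"
proof -
  have "1 - cnj w * z \<noteq> 0" using one_minus_cnj_mult_nonzero[of w z] assms by simp
  then have "0 < (1 - (cmod w)\<^sup>2) * (1 - (cmod z)\<^sup>2) / (cmod (1 - cnj w * z))\<^sup>2"
    using assms by (intro divide_pos_pos mult_pos_pos) (auto simp: abs_square_less_1)
  then have "(cmod (disc_moebius w z))\<^sup>2 < 1"
    using disc_moebius_defect[of w z] assms by simp
  then show ?thesis by (simp add: abs_square_less_1)
qed

lemma disc_moebius_disc_algebra:
  assumes "cmod w < 1"
  shows "disc_moebius w \<in> disc_algebra"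
  using one_minus_cnj_mult_nonzero[OF assms]
  by (auto simp: disc_algebra_def disc_moebius_def[abs_def] intro!: holomorphic_intros continuous_intros)

lemma disc_moebius_inverse:
  assumes "cmod w < 1" "cmod z \<le> 1"
  shows "disc_moebius (- w) (disc_moebius w z) = z"
proof -
  have nz: "1 - cnj w * z \<noteq> 0" using one_minus_cnj_mult_nonzero[OF assms] .
  have ww: "1 - cnj w * w \<noteq> 0" using one_minus_cnj_mult_nonzero[of w w] assms by simp
  have "disc_moebius w z + w = (z * (1 - cnj w * w)) / (1 - cnj w * z)"
    using nz by (simp add: disc_moebius_def field_simps)
  moreover have "1 + cnj w * disc_moebius w z = (1 - cnj w * w) / (1 - cnj w * z)"
    using nz by (simp add: disc_moebius_def field_simps)
  ultimately show ?thesis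
    using nz ww by (simp add: disc_moebius_def[of "- w"])
qed

text \<open>
  A Moebius map brings a point closer to the unit circle by at most a constant factor. This
  carries estimates that degenerate near the boundary from the fixed point 0 to the fixed point
  \<open>w\<close>.
\<close>

lemma disc_moebius_gap:
  assumes "cmod w < 1" "cmod z \<le> 1"
  shows "(1 - (cmod w)\<^sup>2) * (1 - cmod z) / 8 \<le> 1 - cmod (disc_moebius w z)"
proof -
  let ?m = "cmod (disc_moebius w z)"
  have m1: "?m \<le> 1" using disc_moebius_ball[of w z] disc_moebius_circle[of w z] assms by fastforce
  have w2: "(cmod w)\<^sup>2 < 1" using assms by (simp add: abs_square_less_1)
  have "cmod (1 - cnj w * z) \<le> 1 + cmod (cnj w * z)" using norm_triangle_ineq4[of 1 "cnj w * z"] by simp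
  also have "\<dots> \<le> 2" using assms mult_mono[of "cmod w" 1 "cmod z" 1] by (simp add: norm_mult)
  finally have "(cmod (1 - cnj w * z))\<^sup>2 \<le> 2\<^sup>2" by (intro power_mono) auto
  moreover have "(cmod (1 - cnj w * z))\<^sup>2 > 0" using one_minus_cnj_mult_nonzero[OF assms] by simp
  moreover have "0 \<le> (1 - (cmod w)\<^sup>2) * (1 - (cmod z)\<^sup>2)"
    using w2 assms by (intro mult_nonneg_nonneg) (auto simp: abs_square_le_1)
  ultimately have "(1 - (cmod w)\<^sup>2) * (1 - (cmod z)\<^sup>2) / 4 \<le> 1 - ?m\<^sup>2"
    unfolding disc_moebius_defect[OF assms] by (intro divide_left_mono) auto
  moreover have "(1 - (cmod w)\<^sup>2) * (1 - cmod z) \<le> (1 - (cmod w)\<^sup>2) * (1 - (cmod z)\<^sup>2)"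
    using w2 assms mult_left_mono[of "cmod z" 1 "cmod z"] by (intro mult_left_mono) (auto simp: power2_eq_square)
  moreover have "1 - ?m\<^sup>2 \<le> 2 * (1 - ?m)"
    using mult_nonneg_nonneg[of "1 - ?m" "1 - ?m"] m1 by (simp add: power2_eq_square algebra_simps)
  moreover have "b / 8 \<le> m" if "a / 4 \<le> q" "b \<le> a" "q \<le> 2 * m" for a b q m :: real
    using that by linarith
  ultimately show ?thesis by blast
qed

lemma norm_diff_le_disc_moebius:
  assumes "cmod w < 1" "cmod z \<le> 1"
  shows "cmod (z - w) \<le> 2 * cmod (disc_moebius w z)"
proof -
  have nz: "1 - cnj w * z \<noteq> 0" using one_minus_cnj_mult_nonzero[OF assms] .
  have "cmod (1 - cnj w * z) \<le> 1 + cmod (cnj w * z)" using norm_triangle_ineq4[of 1 "cnj w * z"] by simp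
  also have "\<dots> \<le> 2" using assms mult_mono[of "cmod w" 1 "cmod z" 1] by (simp add: norm_mult)
  finally have "cmod (1 - cnj w * z) * cmod (disc_moebius w z) \<le> 2 * cmod (disc_moebius w z)"
    by (intro mult_right_mono) auto
  moreover have "z - w = (1 - cnj w * z) * disc_moebius w z" using nz by (simp add: disc_moebius_def)
  ultimately show ?thesis by (metis norm_mult)
qed

text \<open>
  Each factor is a Moebius map of the disc. Strictness inside the disc needs at least one
  factor.
\<close>

lemma finite_blaschke_disc_algebra:
  assumes "finite_blaschke \<phi>"
  shows "\<phi> \<in> disc_algebra" "cmod z = 1 \<Longrightarrow> cmod (\<phi> z) = 1" "cmod z < 1 \<Longrightarrow> cmod (\<phi> z) < 1"
proof -
  obtain \<psi> :: real and q :: nat and a :: "nat \<Rightarrow> complex" where q: "1 \<le> q" and a: "\<And>i. i < q \<Longrightarrow> cmod (a i) < 1"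
    and \<phi>: "\<And>z. z \<in> cball 0 1 \<Longrightarrow> \<phi> z = cis \<psi> * (\<Prod>i<q. (z - a i) / (1 - cnj (a i) * z))"
    using assms unfolding finite_blaschke_def by blast
  let ?B = "\<lambda>z. cis \<psi> * (\<Prod>i<q. disc_moebius (a i) z)"
  have \<phi>B: "?B z = \<phi> z" if "cmod z \<le> 1" for z using \<phi>[of z] that by (simp add: disc_moebius_def)
  have "?B holomorphic_on ball 0 1" "continuous_on (cball 0 1) ?B"
    using disc_moebius_disc_algebra[OF a] by (auto intro!: holomorphic_intros continuous_intros simp: disc_algebra_def)
  then show "\<phi> \<in> disc_algebra"
    unfolding disc_algebra_def
    by (auto intro: holomorphic_transform[of ?B] continuous_on_eq[of _ ?B] simp: \<phi>B)
  have norm: "cmod (\<phi> z) = (\<Prod>i<q. cmod (disc_moebius (a i) z))" if "cmod z \<le> 1" for z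
    unfolding \<phi>B[OF that, symmetric] by (simp add: norm_mult prod_norm)
  show "cmod (\<phi> z) = 1" if "cmod z = 1"
    using norm[of z] that disc_moebius_circle[OF a that] by simp
  show "cmod (\<phi> z) < 1" if "cmod z < 1"
  proof -
    have lt: "cmod (disc_moebius (a i) z) < 1" if "i < q" for i
      using disc_moebius_ball[OF a[OF that] \<open>cmod z < 1\<close>] .
    obtain m where m: "q = Suc m" using q by (cases q) auto
    have "(\<Prod>i<m. cmod (disc_moebius (a i) z)) \<le> 1"
      using lt m by (intro prod_le_1) (auto simp: less_imp_le)
    then have "(\<Prod>i<q. cmod (disc_moebius (a i) z)) \<le> 1 * cmod (disc_moebius (a m) z)"
      unfolding m prod.lessThan_Suc by (intro mult_right_mono) auto
    also have "\<dots> < 1" using lt[of m] m by simp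
    finally show ?thesis using norm[of z] that by simp
  qed
qed

lemma linear_deriv_0:
  assumes "\<And>z. cmod z < 1 \<Longrightarrow> F z = \<alpha> * z"
  shows "deriv F 0 = \<alpha>"
proof -
  have "eventually (\<lambda>z. F z = \<alpha> * z) (nhds 0)"
    unfolding eventually_nhds by (intro exI[of _ "ball 0 1"]) (auto simp: assms)
  then have "deriv F 0 = deriv (\<lambda>z. \<alpha> * z) 0" by (rule deriv_cong_ev) simp
  also have "\<dots> = \<alpha>" by simp
  finally show ?thesis .
qed

text \<open>
  The equality case of the Schwarz lemma, with the unimodular constant identified as the
  derivative.
\<close>

lemma schwarz_rotation:
  assumes F: "F holomorphic_on ball 0 1" "F 0 = 0" "\<And>z. cmod z < 1 \<Longrightarrow> cmod (F z) < 1"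
    and "(\<exists>z. cmod z < 1 \<and> z \<noteq> 0 \<and> cmod (F z) = cmod z) \<or> cmod (deriv F 0) = 1"
  shows "cmod (deriv F 0) = 1 \<and> (\<forall>z. cmod z < 1 \<longrightarrow> F z = deriv F 0 * z)"
proof -
  obtain \<alpha> where "\<forall>z. cmod z < 1 \<longrightarrow> F z = \<alpha> * z" "cmod \<alpha> = 1"
    using Schwarz_Lemma(3)[OF F, of 0] assms(4) by auto
  moreover have "deriv F 0 = \<alpha>" using calculation by (intro linear_deriv_0) auto
  ultimately show ?thesis by simp
qed

lemma schwarz_quotient:
  assumes F: "F holomorphic_on ball 0 1" "F 0 = 0" "\<And>z. cmod z < 1 \<Longrightarrow> cmod (F z) < 1"
    and d: "cmod (deriv F 0) < 1"
  obtains h where "h holomorphic_on ball 0 1" "\<And>z. cmod z < 1 \<Longrightarrow> F z = z * h z" "h 0 = deriv F 0"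
    "\<And>z. cmod z < 1 \<Longrightarrow> cmod (h z) < 1"
proof -
  obtain h where h: "h holomorphic_on ball 0 1" "\<And>z. cmod z < 1 \<Longrightarrow> F z = z * h z" "deriv F 0 = h 0"
    using Schwarz3[OF F(1,2)] by blast
  have "cmod (h z) < 1" if z: "cmod z < 1" for z
  proof (cases "z = 0")
    case False
    have "cmod (F z) \<le> cmod z" by (rule Schwarz_Lemma(1)[OF F z])
    moreover have "cmod (F z) \<noteq> cmod z"
      using schwarz_rotation[OF F] False z d by auto
    ultimately have "cmod z * cmod (h z) < cmod z * 1" using h(2)[OF z] by (simp add: norm_mult)
    then show ?thesis using False by (simp only: mult_less_cancel_left_pos zero_less_norm_iff not_False_eq_True)
  qed (use h d in auto)
  then show ?thesis using that h by metis
qed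

text \<open>
  Apply the Schwarz lemma to \<open>h\<close> followed by the Moebius map taking \<open>h 0\<close> to 0. Writing \<open>l\<close>,
  \<open>t\<close>, \<open>x\<close> for the moduli of \<open>h 0\<close>, \<open>h z\<close>, \<open>z\<close>, this gives \<open>|t - l| \<le> x (1 - l t)\<close>.
\<close>

lemma schwarz_pick_at_0:
  assumes h: "h holomorphic_on ball 0 1" "\<And>z. cmod z < 1 \<Longrightarrow> cmod (h z) < 1" and z: "cmod z < 1"
  shows "cmod (h z) * (1 + cmod (h 0) * cmod z) \<le> cmod (h 0) + cmod z"
proof -
  define c l t x where "c = h 0" and "l = cmod (h 0)" and "t = cmod (h z)" and "x = cmod z"
  have l: "l < 1" "0 \<le> l" and t: "t < 1" "0 \<le> t" using h(2)[of 0] h(2)[OF z] by (auto simp: l_def t_def)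
  have c: "cmod c < 1" using l by (simp add: c_def l_def)
  define G where "G = (\<lambda>z. disc_moebius c (h z))"
  have "G holomorphic_on ball 0 1"
    unfolding G_def disc_moebius_def using one_minus_cnj_mult_nonzero[OF c] h(2)
    by (intro holomorphic_intros h) (auto simp: less_imp_le)
  moreover have "G 0 = 0" by (simp add: G_def c_def disc_moebius_def)
  moreover have "cmod (G z) < 1" if "cmod z < 1" for z
    unfolding G_def by (intro disc_moebius_ball c h that)
  ultimately have "cmod (G z) \<le> x" unfolding x_def by (intro Schwarz_Lemma(1) z)
  then have "(cmod (G z))\<^sup>2 \<le> x\<^sup>2" by (intro power_mono) auto
  then have 1: "1 - x\<^sup>2 \<le> (1 - l\<^sup>2) * (1 - t\<^sup>2) / (cmod (1 - cnj c * h z))\<^sup>2"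
    using disc_moebius_defect[OF c, of "h z"] t by (simp add: G_def l_def t_def c_def)
  have lt: "l * t < 1" using l t mult_mono[of l 1 t 1] mult_strict_mono'[of l 1 t 1] by auto
  have "1 - l * t \<le> cmod (1 - cnj c * h z)"
    using norm_triangle_ineq2[of 1 "cnj c * h z"] by (simp add: norm_mult l_def t_def c_def)
  then have "(1 - l * t)\<^sup>2 \<le> (cmod (1 - cnj c * h z))\<^sup>2" using lt by (intro power_mono) auto
  moreover have "0 \<le> (1 - l\<^sup>2) * (1 - t\<^sup>2)" using l t by (intro mult_nonneg_nonneg) (auto simp: abs_square_le_1)
  ultimately have "(1 - l\<^sup>2) * (1 - t\<^sup>2) / (cmod (1 - cnj c * h z))\<^sup>2 \<le> (1 - l\<^sup>2) * (1 - t\<^sup>2) / (1 - l * t)\<^sup>2"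
    using lt by (intro divide_left_mono mult_pos_pos) (auto simp: zero_less_power)
  with 1 have "1 - x\<^sup>2 \<le> (1 - l\<^sup>2) * (1 - t\<^sup>2) / (1 - l * t)\<^sup>2" by linarith
  then have "(1 - x\<^sup>2) * (1 - l * t)\<^sup>2 \<le> (1 - l\<^sup>2) * (1 - t\<^sup>2)"
    using lt by (simp add: pos_le_divide_eq)
  then have "(t - l)\<^sup>2 \<le> (x * (1 - l * t))\<^sup>2"
    by (simp add: power2_eq_square algebra_simps)
  then have "t - l \<le> x * (1 - l * t)"
    using lt by (intro power2_le_imp_le[of "t - l"]) (auto simp: x_def)
  then show ?thesis by (simp add: l_def t_def x_def algebra_simps)
qed

text \<open>
  The Schwarz lemma alone gives a contraction on compact subsets, with a rate that deteriorates
  towards the boundary. The quantity \<open>|z| / (1 - |z|)\<close> contracts at a rate uniform in the whole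
  disc: it is infinite on the circle and comparable to \<open>|z|\<close> near 0, and by Schwarz-Pick each
  step multiplies it by at most \<open>(l + |z|) / (1 + |z|) \<le> (1 + l) / 2\<close>, where \<open>l\<close> is the modulus
  of the derivative at 0. Exponential mixing of Hoelder functions depends on this uniformity.
\<close>

lemma schwarz_contraction:
  assumes F: "F holomorphic_on ball 0 1" "F 0 = 0" "\<And>z. cmod z < 1 \<Longrightarrow> cmod (F z) < 1"
    and d: "cmod (deriv F 0) < 1" and z: "cmod z < 1"
  shows "cmod (F z) / (1 - cmod (F z)) \<le> (1 + cmod (deriv F 0)) / 2 * (cmod z / (1 - cmod z))"
proof -
  obtain h where h: "h holomorphic_on ball 0 1" "\<And>z. cmod z < 1 \<Longrightarrow> F z = z * h z" "h 0 = deriv F 0"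
    "\<And>z. cmod z < 1 \<Longrightarrow> cmod (h z) < 1"
    using schwarz_quotient[OF F d] by blast
  define l t x s where "l = cmod (deriv F 0)" and "t = cmod (h z)" and "x = cmod z" and "s = (1 + l) / 2"
  have nn: "0 \<le> l" "l < 1" "0 \<le> t" "0 \<le> x" "x < 1" using d z by (auto simp: l_def t_def x_def)
  have pick: "t * (1 + l * x) \<le> l + x"
    using schwarz_pick_at_0[OF h(1,4) z] by (simp add: h(3) l_def t_def x_def)
  have y: "cmod (F z) = x * t" using h(2)[OF z] by (simp add: norm_mult x_def t_def)
  have key: "t * (1 - x + s * x) \<le> s"
  proof -
    have f: "0 \<le> 1 - x + s * x" using nn by (auto simp: s_def)
    \<comment> \<open>Up to the positive factor \<open>1 + l x\<close>, the claim has defect \<open>(1 - l) (1 - x)\<^sup>2 / 2\<close>.\<close>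
    have "t * (1 + l * x) * (1 - x + s * x) \<le> (l + x) * (1 - x + s * x)"
      by (rule mult_right_mono[OF pick f])
    also have "\<dots> = s * (1 + l * x) - (1 - l) * (1 - x)\<^sup>2 / 2"
      by (simp add: s_def power2_eq_square field_simps)
    also have "\<dots> \<le> s * (1 + l * x)" using nn by simp
    finally have "(t * (1 - x + s * x)) * (1 + l * x) \<le> s * (1 + l * x)" by (simp add: mult_ac)
    moreover have "0 < 1 + l * x" using nn by (simp add: add_pos_nonneg)
    ultimately show ?thesis by (simp only: mult_le_cancel_right_pos)
  qed
  have "x * t < 1" using F(3)[OF z] by (simp add: y)
  moreover have "x * t * (1 - x) \<le> s * x * (1 - x * t)"
    using mult_left_mono[OF key nn(4)] by (simp add: algebra_simps)
  ultimately have "x * t / (1 - x * t) \<le> s * (x / (1 - x))"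
    using nn by (simp add: divide_simps mult_ac)
  then show ?thesis by (simp add: y s_def l_def x_def)
qed

text \<open>
  The quotient \<open>F z / z\<close> vanishes at 0, so the Schwarz lemma applies a second time.
\<close>

lemma schwarz_square:
  assumes F: "F holomorphic_on ball 0 1" "F 0 = 0" "\<And>z. cmod z < 1 \<Longrightarrow> cmod (F z) < 1"
    and d: "deriv F 0 = 0" and z: "cmod z < 1"
  shows "cmod (F z) \<le> (cmod z)\<^sup>2"
proof -
  obtain h where h: "h holomorphic_on ball 0 1" "\<And>z. cmod z < 1 \<Longrightarrow> F z = z * h z" "h 0 = deriv F 0"
    "\<And>z. cmod z < 1 \<Longrightarrow> cmod (h z) < 1"
    using schwarz_quotient[OF F] d by auto
  have "cmod (h z) \<le> cmod z" using h d by (intro Schwarz_Lemma(1) z) auto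
  then have "cmod z * cmod (h z) \<le> cmod z * cmod z" by (intro mult_left_mono) auto
  then show ?thesis using h(2)[OF z] by (simp add: norm_mult power2_eq_square)
qed

section \<open>Self-maps of the disc with an interior fixed point\<close>

lemma disc_algebra_compose:
  assumes "F \<in> disc_algebra" "G \<in> disc_algebra" 
    "\<And>z. cmod z < 1 \<Longrightarrow> cmod (G z) < 1" "\<And>z. cmod z \<le> 1 \<Longrightarrow> cmod (G z) \<le> 1"
  shows "(\<lambda>z. F (G z)) \<in> disc_algebra"
proof -
  have F: "F holomorphic_on ball 0 1" "continuous_on (cball 0 1) F"
    and G: "G holomorphic_on ball 0 1" "continuous_on (cball 0 1) G"
    using assms by (auto simp: disc_algebra_def)
  have "F \<circ> G holomorphic_on ball 0 1"
    by (rule holomorphic_on_compose_gen[OF G(1) F(1)]) (use assms(3) in auto)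
  moreover have "continuous_on (cball 0 1) (\<lambda>z. F (G z))"
    by (rule continuous_on_compose2[OF F(2) G(2)]) (use assms(4) in auto)
  ultimately show ?thesis by (simp add: disc_algebra_def comp_def)
qed

text \<open>
  What the proof uses of a finite Blaschke product with a fixed point in the disc.
\<close>

locale disc_self_map =
  fixes \<phi> :: "complex \<Rightarrow> complex" and w :: complex
  assumes disc_algebra: "\<phi> \<in> disc_algebra"
    and circle_to_circle: "\<And>z. cmod z = 1 \<Longrightarrow> cmod (\<phi> z) = 1"
    and disc_to_disc: "\<And>z. cmod z < 1 \<Longrightarrow> cmod (\<phi> z) < 1"
    and w: "cmod w < 1" and fixed: "\<phi> w = w"
begin

sublocale circle_system "harmonic_measure w" \<phi>
  by (intro circle_system_harmonic disc_algebra circle_to_circle w fixed)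

abbreviation \<nu> :: "complex measure" where
  "\<nu> \<equiv> harmonic_measure w"

abbreviation corr :: "(complex \<Rightarrow> complex) \<Rightarrow> (complex \<Rightarrow> complex) \<Rightarrow> nat \<Rightarrow> real" where
  "corr \<equiv> correlation \<nu> \<phi>"

lemma w_square: "(cmod w)\<^sup>2 < 1"
  using w by (simp add: abs_square_less_1)

lemma iterate_disc: "cmod z < 1 \<Longrightarrow> cmod ((\<phi> ^^ n) z) < 1"
  by (induction n) (auto intro: disc_to_disc)

lemma iterate_closed_disc: "cmod z \<le> 1 \<Longrightarrow> cmod ((\<phi> ^^ n) z) \<le> 1"
  using iterate_disc[of z n] iterate_circle[of z n] by fastforce

lemma iterate_disc_algebra: "\<phi> ^^ n \<in> disc_algebra"
proof (induction n)
  case 0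
  then show ?case using disc_algebra_ident by (simp add: id_def)
next
  case (Suc n)
  then show ?case
    using disc_algebra_compose[OF disc_algebra Suc] iterate_disc iterate_closed_disc by (simp add: comp_def)
qed

lemma iterate_fixed: "(\<phi> ^^ n) w = w"
  by (induction n) (auto simp: fixed)

lemma deriv_at_fixed: "(\<phi> has_field_derivative deriv \<phi> w) (at w)"
  using disc_algebra w by (intro holomorphic_derivI[of _ "ball 0 1"]) (auto simp: disc_algebra_def)

lemma deriv_iterate: "deriv (\<phi> ^^ n) w = deriv \<phi> w ^ n"
proof -
  have "((\<phi> ^^ n) has_field_derivative deriv \<phi> w ^ n) (at w)"
  proof (induction n)
    case (Suc n)
    have "(\<phi> \<circ> (\<phi> ^^ n) has_field_derivative deriv \<phi> w * deriv \<phi> w ^ n) (at w)"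
      by (rule DERIV_chain) (use deriv_at_fixed Suc in \<open>simp_all add: iterate_fixed\<close>)
    then show ?case by (simp add: comp_def)
  qed (auto simp: id_def)
  then show ?thesis by (rule DERIV_imp_deriv)
qed

text \<open>
  The map \<open>\<phi>\<close> in the coordinate in which its fixed point is 0.
\<close>

definition centred :: "complex \<Rightarrow> complex" where
  "centred u = disc_moebius w (\<phi> (disc_moebius (- w) u))"

lemma centred_holomorphic: "centred holomorphic_on ball 0 1"
proof -
  have "(\<lambda>u. disc_moebius w (\<phi> u)) \<in> disc_algebra"
    using iterate_closed_disc[of _ 1] 
    by (intro disc_algebra_compose[OF disc_moebius_disc_algebra[OF w] disc_algebra] disc_to_disc) auto
  then have "(\<lambda>u. disc_moebius w (\<phi> (disc_moebius (- w) u))) \<in> disc_algebra"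
    by (rule disc_algebra_compose)
      (use w disc_moebius_ball[of "- w"] disc_moebius_circle[of "- w"] disc_moebius_disc_algebra[of "- w"]
        in \<open>auto simp: le_less\<close>)
  then show ?thesis unfolding disc_algebra_def centred_def[abs_def] by simp
qed

lemma centred_0: "centred 0 = 0"
  by (simp add: centred_def disc_moebius_def fixed)

lemma centred_disc: "cmod u < 1 \<Longrightarrow> cmod (centred u) < 1"
  unfolding centred_def using w by (intro disc_moebius_ball disc_to_disc) auto

lemma centred_conjugates: "cmod z < 1 \<Longrightarrow> disc_moebius w (\<phi> z) = centred (disc_moebius w z)"
  by (simp add: centred_def disc_moebius_inverse w)

lemma deriv_centred: "deriv centred 0 = deriv \<phi> w"
proof (rule DERIV_imp_deriv)
  have ww: "1 - cnj w * w \<noteq> 0" using one_minus_cnj_mult_nonzero[of w w] w by simp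
  have 0: "disc_moebius (- w) 0 = w" by (simp add: disc_moebius_def)
  have 1: "(disc_moebius (- w) has_field_derivative (1 - cnj w * w)) (at 0)"
    unfolding disc_moebius_def[abs_def] by (auto intro!: derivative_eq_intros)
  have 2: "(disc_moebius w has_field_derivative 1 / (1 - cnj w * w)) (at w)"
    unfolding disc_moebius_def[abs_def] using ww by (auto intro!: derivative_eq_intros)
  have 3: "((\<lambda>u. \<phi> (disc_moebius (- w) u)) has_field_derivative deriv \<phi> w * (1 - cnj w * w)) (at 0)"
    by (rule DERIV_chain2[OF _ 1]) (simp add: 0 deriv_at_fixed)
  have "((\<lambda>u. disc_moebius w (\<phi> (disc_moebius (- w) u))) has_field_derivative 
       1 / (1 - cnj w * w) * (deriv \<phi> w * (1 - cnj w * w))) (at 0)"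
    by (rule DERIV_chain2[OF _ 3]) (simp add: 0 fixed 2)
  then show "(centred has_field_derivative deriv \<phi> w) (at 0)"
    using ww by (simp add: centred_def[abs_def])
qed

lemma norm_deriv_le_1: "cmod (deriv \<phi> w) \<le> 1"
  using Schwarz_Lemma(2)[OF centred_holomorphic centred_0 centred_disc, of 0] by (simp add: deriv_centred)

lemma moebius_iterate_contracts:
  assumes d: "cmod (deriv \<phi> w) < 1" and z: "cmod z < 1"
  shows "cmod (disc_moebius w ((\<phi> ^^ n) z)) / (1 - cmod (disc_moebius w ((\<phi> ^^ n) z))) \<le>
    ((1 + cmod (deriv \<phi> w)) / 2) ^ n * (cmod (disc_moebius w z) / (1 - cmod (disc_moebius w z)))"
proof (induction n)
  case (Suc n)
  let ?m = "\<lambda>n. cmod (disc_moebius w ((\<phi> ^^ n) z))"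
  have "?m (Suc n) = cmod (centred (disc_moebius w ((\<phi> ^^ n) z)))"
    using centred_conjugates[OF iterate_disc[OF z]] by simp
  then have "?m (Suc n) / (1 - ?m (Suc n)) \<le> (1 + cmod (deriv \<phi> w)) / 2 * (?m n / (1 - ?m n))"
    using schwarz_contraction[OF centred_holomorphic centred_0 centred_disc, of "disc_moebius w ((\<phi> ^^ n) z)"]
      d disc_moebius_ball[OF w iterate_disc[OF z]] by (simp only: deriv_centred)
  also have "\<dots> \<le> (1 + cmod (deriv \<phi> w)) / 2 * (((1 + cmod (deriv \<phi> w)) / 2) ^ n * (?m 0 / (1 - ?m 0)))"
    using Suc by (intro mult_left_mono) auto
  finally show ?case by (simp add: mult.assoc)
qed simp

text \<open>
  The bound grows only like the inverse distance to the unit circle, so it stays exponentially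
  small even on circles that approach the unit circle at a sufficiently slow exponential rate.
\<close>

lemma iterate_bound:
  assumes d: "cmod (deriv \<phi> w) < 1" and z: "cmod z < 1"
  shows "cmod ((\<phi> ^^ n) z - w) \<le> 16 / (1 - (cmod w)\<^sup>2) * (((1 + cmod (deriv \<phi> w)) / 2) ^ n / (1 - cmod z))"
proof -
  let ?m = "\<lambda>n. cmod (disc_moebius w ((\<phi> ^^ n) z))"
  let ?s = "((1 + cmod (deriv \<phi> w)) / 2) ^ n"
  have m: "0 \<le> ?m k" "?m k < 1" for k using disc_moebius_ball[OF w iterate_disc[OF z]] by auto
  have gap: "0 < (1 - (cmod w)\<^sup>2) * (1 - cmod z) / 8" using w_square z by simp
  have "?m n \<le> ?m n / (1 - ?m n)" using m[of n] by (simp add: field_simps)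
  also have "\<dots> \<le> ?s * (?m 0 / (1 - ?m 0))" using moebius_iterate_contracts[OF assms, of n] by simp
  also have "\<dots> \<le> ?s * (1 / ((1 - (cmod w)\<^sup>2) * (1 - cmod z) / 8))"
    using m[of 0] gap disc_moebius_gap[OF w less_imp_le[OF z]] by (intro mult_left_mono frac_le) auto
  finally have "2 * ?m n \<le> 16 / (1 - (cmod w)\<^sup>2) * (?s / (1 - cmod z))" by (simp add: field_simps)
  then show ?thesis
    using norm_diff_le_disc_moebius[OF w iterate_closed_disc[OF less_imp_le[OF z]], of n] by linarith
qed

lemma iterate_superattracting:
  assumes d: "deriv \<phi> w = 0" and z: "cmod z < 1"
  shows "cmod ((\<phi> ^^ n) z - w) \<le> 2 * cmod (disc_moebius w z) ^ (2 ^ n)"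
proof -
  have "cmod (disc_moebius w ((\<phi> ^^ n) z)) \<le> cmod (disc_moebius w z) ^ (2 ^ n)"
  proof (induction n)
    case (Suc n)
    have "cmod (disc_moebius w ((\<phi> ^^ Suc n) z)) = cmod (centred (disc_moebius w ((\<phi> ^^ n) z)))"
      using centred_conjugates[OF iterate_disc[OF z]] by simp
    also have "\<dots> \<le> (cmod (disc_moebius w ((\<phi> ^^ n) z)))\<^sup>2"
      using d by (intro schwarz_square centred_holomorphic centred_0 centred_disc disc_moebius_ball w iterate_disc z)
        (auto simp: deriv_centred)
    also have "\<dots> \<le> (cmod (disc_moebius w z) ^ (2 ^ n))\<^sup>2" using Suc by (intro power_mono) auto
    finally show ?case by (simp add: power_mult[symmetric] mult.commute)
  qed simp
  then show ?thesis
    using norm_diff_le_disc_moebius[OF w iterate_closed_disc[OF less_imp_le[OF z]], of n] by linarith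
qed

text \<open>
  Since the harmonic mean of \<open>z\<^sup>j\<close> is \<open>w\<^sup>j\<close>, subtracting the product of the means amounts to
  subtracting this constant from the \<open>j\<close>th power of the iterate.
\<close>

lemma covariance_monomials:
  "covariance \<nu> \<phi> (\<lambda>z. z ^ j) (\<lambda>z. z powi k) n =
    (LINT z|\<nu>. ((\<phi> ^^ n) z ^ j - w ^ j) * z powi (- k))"
proof -
  have c: "continuous_on (sphere 0 1) (\<lambda>z. (\<phi> ^^ n) z ^ j * z powi (- k))"
    "continuous_on (sphere 0 1) (\<lambda>z. w ^ j * z powi (- k))"
    by (intro continuous_intros disc_algebra_continuous_circle iterate_disc_algebra; auto)+
  have cnj: "cnj z powi k = z powi (- k)" if "cmod z = 1" for z
    by (simp add: cnj_circle[OF that] power_int_minus power_int_inverse)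
  have "(LINT z|\<nu>. z ^ j) = w ^ j"
    using harmonic_mean_value[OF disc_algebra_power[OF disc_algebra_ident] w] .
  moreover have "(LINT z|\<nu>. cnj (z powi k)) = (LINT z|\<nu>. z powi (- k))"
    by (intro Bochner_Integration.integral_cong refl) (simp add: cnj)
  moreover have "(LINT z|\<nu>. (\<phi> ^^ n) z ^ j * cnj (z powi k)) = (LINT z|\<nu>. (\<phi> ^^ n) z ^ j * z powi (- k))"
    by (intro Bochner_Integration.integral_cong refl) (simp add: cnj)
  ultimately show ?thesis
    unfolding covariance_def left_diff_distrib
      Bochner_Integration.integral_diff[OF integrable_continuous[OF c(1)] integrable_continuous[OF c(2)]]
    by simp
qed

lemma iterate_power_minus_fixed: "(\<lambda>z. (\<phi> ^^ n) z ^ j - w ^ j) \<in> disc_algebra"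
  by (intro disc_algebra_diff disc_algebra_power disc_algebra_const iterate_disc_algebra)

lemma covariance_monomials_nonpos:
  "covariance \<nu> \<phi> (\<lambda>z. z ^ j) (\<lambda>z. z powi (- int k)) n = 0"
proof -
  have "(\<lambda>z. ((\<phi> ^^ n) z ^ j - w ^ j) * z ^ k) \<in> disc_algebra"
    by (intro disc_algebra_mult iterate_power_minus_fixed disc_algebra_power disc_algebra_ident)
  from harmonic_mean_value[OF this w] show ?thesis
    unfolding covariance_monomials by (simp add: iterate_fixed)
qed

text \<open>
  Up to the factor \<open>1 - |w|\<^sup>2\<close>, the correlation is the modulus of a Taylor coefficient at 0 of
  the quotient \<open>H\<close>, estimated by Cauchy's inequality on the circle of radius \<open>r\<close>. There the
  denominators are at least \<open>r - |w|\<close> and \<open>1 - |w|\<close>, and a difference of \<open>j\<close>th powers in the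
  unit disc is at most \<open>j\<close> times the difference.
\<close>

lemma correlation_monomials_nat:
  assumes r: "cmod w < r" "r < 1" and E: "\<And>z. cmod z = r \<Longrightarrow> cmod ((\<phi> ^^ n) z - w) \<le> E"
  shows "corr (\<lambda>z. z ^ j) (\<lambda>z. z powi k) n \<le>
    2 / (r - cmod w) * real j * E / r ^ nat \<bar>k\<bar>"
proof (cases "k \<le> 0")
  have r0: "r > 0" using r norm_ge_zero[of w] by linarith
  have E0: "0 \<le> E" using order_trans[OF norm_ge_zero E[of "of_real r"]] r0 by simp
  case True
  then show ?thesis
    using covariance_monomials_nonpos[of j "nat (- k)" n] r r0 E0 by (simp add: correlation_eq)
next
  case False
  have r0: "r > 0" using r norm_ge_zero[of w] by linarith
  have E0: "0 \<le> E" using order_trans[OF norm_ge_zero E[of "of_real r"]] r0 by simp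
  obtain m where m: "k = int (Suc m)" using False by (metis not_le pos_int_cases Suc_pred)
  obtain H where H: "H \<in> disc_algebra"
    "\<And>z. cmod z \<le> 1 \<Longrightarrow> (\<phi> ^^ n) z ^ j - w ^ j = (z - w) * (1 - cnj w * z) * H z"
    using disc_algebra_factor[OF iterate_power_minus_fixed w, of n j] by (auto simp: iterate_fixed)
  have "covariance \<nu> \<phi> (\<lambda>z. z ^ j) (\<lambda>z. z powi k) n = 
     complex_of_real (1 - (cmod w)\<^sup>2) * ((deriv ^^ m) H 0 / fact m)"
    unfolding covariance_monomials m using H by (intro harmonic_coefficient w) auto
  then have cor: "corr (\<lambda>z. z ^ j) (\<lambda>z. z powi k) n = 
    (1 - (cmod w)\<^sup>2) * (cmod ((deriv ^^ m) H 0) / fact m)"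
    using w_square by (simp add: correlation_eq norm_mult norm_divide del: of_real_diff)
  define D where "D = real j * E / ((r - cmod w) * (1 - cmod w))"
  have D0: "D \<ge> 0" unfolding D_def using r w E0 by (intro divide_nonneg_nonneg mult_nonneg_nonneg) auto
  have "cmod ((deriv ^^ m) H 0) \<le> fact m * D / r ^ m"
  proof (rule Cauchy_inequality)
    show "H holomorphic_on ball 0 r" "continuous_on (cball 0 r) H"
      using H(1) r by (auto simp: disc_algebra_def elim: holomorphic_on_subset continuous_on_subset)
    fix z :: complex assume "cmod (0 - z) = r"
    then have z: "cmod z = r" by simp
    have "cmod ((z - w) * (1 - cnj w * z) * H z) = cmod ((\<phi> ^^ n) z ^ j - w ^ j)"
      using H(2)[of z] z r by simp
    also have "\<dots> \<le> real j * cmod ((\<phi> ^^ n) z - w)"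
      using z r w by (intro norm_power_diff iterate_closed_disc) auto
    also have "\<dots> \<le> real j * E" using E[OF z] by (intro mult_left_mono) auto
    finally have 1: "cmod (z - w) * cmod (1 - cnj w * z) * cmod (H z) \<le> real j * E" by (simp add: norm_mult)
    have "1 - cmod w \<le> cmod (1 - cnj w * z)" using z r by (intro norm_one_minus_cnj_mult_ge) simp
    moreover have "r - cmod w \<le> cmod (z - w)" using norm_triangle_ineq2[of z w] z by simp
    ultimately have "(r - cmod w) * (1 - cmod w) * cmod (H z) \<le> cmod (z - w) * cmod (1 - cnj w * z) * cmod (H z)"
      using r w by (intro mult_right_mono mult_mono) auto
    with 1 have "(r - cmod w) * (1 - cmod w) * cmod (H z) \<le> real j * E" by linarith
    moreover have "0 < (r - cmod w) * (1 - cmod w)" using r w by simp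
    ultimately show "cmod (H z) \<le> D" unfolding D_def by (simp add: pos_le_divide_eq mult.commute)
  qed (use r0 in auto)
  then have "cmod ((deriv ^^ m) H 0) / fact m \<le> D / r ^ m" by (simp add: field_simps)
  also have "\<dots> \<le> D / r ^ Suc m"
    using D0 r0 r power_decreasing[of m "Suc m" r] by (intro divide_left_mono) auto
  finally have "(1 - (cmod w)\<^sup>2) * (cmod ((deriv ^^ m) H 0) / fact m) \<le> (1 - (cmod w)\<^sup>2) * (D / r ^ Suc m)"
    using w_square by (intro mult_left_mono) auto
  also have "\<dots> = (1 + cmod w) * (real j * E / (r - cmod w) / r ^ Suc m)"
  proof -
    have "1 - (cmod w)\<^sup>2 = (1 + cmod w) * (1 - cmod w)" by (simp add: power2_eq_square algebra_simps)
    then show ?thesis using w unfolding D_def by (simp del: power_Suc)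
  qed
  also have "\<dots> \<le> 2 * (real j * E / (r - cmod w) / r ^ Suc m)"
    using w r r0 E0 by (intro mult_right_mono divide_nonneg_nonneg mult_nonneg_nonneg) auto
  finally show ?thesis using cor m by (simp del: power_Suc add: nat_add_distrib)
qed

lemma correlation_monomials:
  assumes r: "cmod w < r" "r < 1" and E: "\<And>z. cmod z = r \<Longrightarrow> cmod ((\<phi> ^^ n) z - w) \<le> E"
  shows "corr (\<lambda>z. z powi j) (\<lambda>z. z powi k) n \<le>
    2 / (r - cmod w) * \<bar>real_of_int j\<bar> * E / r ^ nat \<bar>k\<bar>"
proof (cases "j \<ge> 0")
  case True
  then show ?thesis using correlation_monomials_nat[OF r E, of "nat j" k] by (simp add: power_int_def)
next
  case False
  then show ?thesis
    using correlation_monomials_nat[OF r E, of "nat (- j)" "- k"] correlation_powi_uminus[of "- j" "- k" n]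
    by (simp add: power_int_def)
qed

text \<open>
  The covariances are the Taylor coefficients at 0 of a function whose value at \<open>w\<close> is a
  multiple of the derivative of the \<open>n\<close>th iterate at the fixed point. They therefore determine
  the multiplier of \<open>\<phi>\<close>.
\<close>

lemma covariance_power_series:
  "(\<lambda>m. covariance \<nu> \<phi> (\<lambda>z. z) (\<lambda>z. z powi int (Suc m)) n * w ^ m) sums (deriv \<phi> w ^ n)"
proof -
  obtain H where H: "H \<in> disc_algebra"
    "\<And>z. cmod z \<le> 1 \<Longrightarrow> (\<phi> ^^ n) z ^ 1 - w ^ 1 = (z - w) * (1 - cnj w * z) * H z"
    "H w = deriv (\<lambda>z. (\<phi> ^^ n) z ^ 1 - w ^ 1) w / (1 - (cmod w)\<^sup>2)"
    using disc_algebra_factor[OF iterate_power_minus_fixed w, of n 1] by (auto simp: iterate_fixed)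
  have "(\<phi> ^^ n) field_differentiable at w"
    using iterate_disc_algebra w
    by (intro holomorphic_on_imp_differentiable_at[of _ "ball 0 1"]) (auto simp: disc_algebra_def)
  then have "deriv (\<lambda>z. (\<phi> ^^ n) z ^ 1 - w ^ 1) w = deriv \<phi> w ^ n"
    by (simp add: deriv_iterate)
  then have Hw: "complex_of_real (1 - (cmod w)\<^sup>2) * H w = deriv \<phi> w ^ n"
    using H(3) w_square of_real_eq_1_iff[of "(cmod w)\<^sup>2", where 'a = complex] by simp
  have cov: "covariance \<nu> \<phi> (\<lambda>z. z) (\<lambda>z. z powi int (Suc m)) n =
     complex_of_real (1 - (cmod w)\<^sup>2) * ((deriv ^^ m) H 0 / fact m)" for m
  proof -
    have "(LINT z|\<nu>. ((\<phi> ^^ n) z ^ 1 - w ^ 1) * z powi (- int (Suc m))) =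
      complex_of_real (1 - (cmod w)\<^sup>2) * ((deriv ^^ m) H 0 / fact m)"
      using H by (intro harmonic_coefficient w) auto
    then show ?thesis using covariance_monomials[of 1 "int (Suc m)" n] by simp
  qed
  have "(\<lambda>m. (deriv ^^ m) H 0 / fact m * (w - 0) ^ m) sums H w"
    using H(1) w by (intro holomorphic_power_series[of _ _ 1]) (auto simp: disc_algebra_def)
  then have "(\<lambda>m. complex_of_real (1 - (cmod w)\<^sup>2) * ((deriv ^^ m) H 0 / fact m * (w - 0) ^ m)) sums (complex_of_real (1 - (cmod w)\<^sup>2) * H w)"
    by (rule sums_mult)
  then show ?thesis unfolding cov Hw by (simp only: mult.assoc diff_0_right)
qed

end

section \<open>Mixing and exponential mixing\<close>

lemma disc_moebius_lipschitz:
  assumes "cmod w < 1" "cmod x \<le> 1" "cmod y \<le> 1"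
  shows "cmod (disc_moebius w x - disc_moebius w y) \<le> cmod (x - y) / (1 - cmod w)\<^sup>2"
proof -
  have nz: "1 - cnj w * x \<noteq> 0" "1 - cnj w * y \<noteq> 0"
    using one_minus_cnj_mult_nonzero assms by auto
  have "(cmod w)\<^sup>2 \<le> 1" using assms(1) by (simp add: abs_square_le_1)
  then have c: "cmod (1 - cnj w * w) \<le> 1"
  proof -
    have "cnj w * w = (cmod w)\<^sup>2" by (metis complex_norm_square mult.commute)
    then have "1 - cnj w * w = of_real (1 - (cmod w)\<^sup>2)" by simp
    then show ?thesis using \<open>(cmod w)\<^sup>2 \<le> 1\<close> by (simp only: norm_of_real) simp
  qed
  have "disc_moebius w x - disc_moebius w y =
    (1 - cnj w * w) * (x - y) / ((1 - cnj w * x) * (1 - cnj w * y))"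
    using nz by (simp add: disc_moebius_def diff_frac_eq) (simp add: algebra_simps)
  then have "cmod (disc_moebius w x - disc_moebius w y) =
    cmod (1 - cnj w * w) * cmod (x - y) / (cmod (1 - cnj w * x) * cmod (1 - cnj w * y))"
    by (simp only: norm_mult norm_divide)
  also have "\<dots> \<le> 1 * cmod (x - y) / ((1 - cmod w) * (1 - cmod w))"
    using c norm_one_minus_cnj_mult_ge assms by (intro frac_le mult_mono mult_nonneg_nonneg mult_pos_pos) auto
  finally show ?thesis by (simp add: power2_eq_square)
qed

text \<open>
  A Lipschitz function on a set of diameter 2 is Hoelder continuous for every exponent up to 1.
\<close>

lemma disc_moebius_holder:
  assumes w: "cmod w < 1" and \<alpha>: "0 < \<alpha>" "\<alpha> \<le> 1"
  shows "disc_moebius w \<in> holder_space \<alpha>"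
  unfolding holder_space_def
proof (intro CollectI exI ballI)
  fix x y :: complex assume "x \<in> sphere 0 1" "y \<in> sphere 0 1"
  then have xy: "cmod x = 1" "cmod y = 1" by auto
  have "cmod (x - y) \<le> 2" using norm_triangle_ineq4[of x y] xy by simp
  have "cmod (x - y) \<le> 2 * cmod (x - y) powr \<alpha>"
  proof (cases "x = y")
    case False
    have "cmod (x - y) = cmod (x - y) powr (1 - \<alpha>) * cmod (x - y) powr \<alpha>"
      using False by (simp flip: powr_add)
    also have "\<dots> \<le> 2 powr (1 - \<alpha>) * cmod (x - y) powr \<alpha>"
      using \<alpha> \<open>cmod (x - y) \<le> 2\<close> by (intro mult_right_mono powr_mono2) auto
    also have "\<dots> \<le> 2 powr 1 * cmod (x - y) powr \<alpha>"
      using \<alpha> by (intro mult_right_mono powr_mono) auto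
    finally show ?thesis by simp
  qed simp
  then have "cmod (x - y) / (1 - cmod w)\<^sup>2 \<le> 2 * cmod (x - y) powr \<alpha> / (1 - cmod w)\<^sup>2"
    by (intro divide_right_mono) auto
  then show "cmod (disc_moebius w x - disc_moebius w y) \<le> (2 / (1 - cmod w)\<^sup>2) * cmod (x - y) powr \<alpha>"
    using disc_moebius_lipschitz[OF w, of x y] xy by simp
qed

text \<open>
  For a Hoelder function both suprema in the norm are taken over sets bounded above, and so they
  dominate the individual values.
\<close>

lemma holder_norm_bounds:
  assumes f: "f \<in> holder_space \<alpha>" and \<alpha>: "0 < \<alpha>"
  shows "cmod x = 1 \<Longrightarrow> cmod (f x) \<le> holder_norm \<alpha> f"
    "cmod x = 1 \<Longrightarrow> cmod y = 1 \<Longrightarrow> cmod (f x - f y) \<le> holder_norm \<alpha> f * cmod (x - y) powr \<alpha>"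
    "0 \<le> holder_norm \<alpha> f"
    "continuous_on (sphere 0 1) f"
proof -
  obtain K where K: "\<And>x y. cmod x = 1 \<Longrightarrow> cmod y = 1 \<Longrightarrow> cmod (f x - f y) \<le> K * cmod (x - y) powr \<alpha>"
  proof -
    obtain K where "\<forall>x\<in>sphere 0 1. \<forall>y\<in>sphere 0 1. cmod (f x - f y) \<le> K * cmod (x - y) powr \<alpha>"
      using f unfolding holder_space_def by blast
    then show thesis by (intro that[of K]) auto
  qed
  show cont: "continuous_on (sphere 0 1) f" by (rule holder_continuous[OF \<alpha> K])
  let ?P = "{(x, y). x \<in> sphere 0 1 \<and> y \<in> sphere 0 1 \<and> x \<noteq> (y :: complex)}"
  let ?q = "\<lambda>(x, y). cmod (f x - f y) / cmod (x - y) powr \<alpha>"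
  define S H where "S = (SUP x\<in>sphere 0 1. cmod (f x))" and "H = (SUP p\<in>?P. ?q p)"
  have N: "holder_norm \<alpha> f = S + H" by (simp add: holder_norm_def S_def H_def)
  have "bdd_above ((\<lambda>x. cmod (f x)) ` sphere 0 1)"
    by (intro bounded_imp_bdd_above compact_imp_bounded compact_continuous_image continuous_intros cont) auto
  then have S: "cmod (f x) \<le> S" if "cmod x = 1" for x
    unfolding S_def by (rule cSUP_upper[rotated]) (use that in auto)
  have "bdd_above (?q ` ?P)"
    by (rule bdd_aboveI2[of _ _ K]) (auto simp: pos_divide_le_eq K)
  then have H: "?q (x, y) \<le> H" if "cmod x = 1" "cmod y = 1" "x \<noteq> y" for x y
    unfolding H_def by (rule cSUP_upper[rotated]) (use that in auto)
  have S0: "0 \<le> S" using order_trans[OF norm_ge_zero S[of 1]] by simp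
  have "0 \<le> ?q (1, -1)" by simp
  also have "\<dots> \<le> H" by (rule H) auto
  finally have H0: "0 \<le> H" .
  show "0 \<le> holder_norm \<alpha> f" using S0 H0 N by simp
  show "cmod (f x) \<le> holder_norm \<alpha> f" if "cmod x = 1" for x
    using S[OF that] H0 N by simp
  show "cmod (f x - f y) \<le> holder_norm \<alpha> f * cmod (x - y) powr \<alpha>" if "cmod x = 1" "cmod y = 1" for x y
  proof (cases "x = y")
    case False
    have "cmod (f x - f y) \<le> H * cmod (x - y) powr \<alpha>"
      using H[OF that False] False by (simp add: pos_divide_le_eq)
    also have "\<dots> \<le> holder_norm \<alpha> f * cmod (x - y) powr \<alpha>"
      using S0 N by (intro mult_right_mono) auto
    finally show ?thesis .
  qed simp
qed

context disc_self_map
begin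

lemma mixing_if_attracting:
  assumes d: "cmod (deriv \<phi> w) < 1"
  shows "mixing \<nu> \<phi>"
proof (rule mixing_if_monomials)
  fix j k :: int
  define r where "r = (1 + cmod w) / 2"
  have r: "cmod w < r" "r < 1" using w by (auto simp: r_def)
  let ?s = "(1 + cmod (deriv \<phi> w)) / 2"
  let ?b = "\<lambda>n. 2 / (r - cmod w) * \<bar>real_of_int j\<bar> * (16 / (1 - (cmod w)\<^sup>2) * (?s ^ n / (1 - r))) / r ^ nat \<bar>k\<bar>"
  have le: "corr (\<lambda>z. z powi j) (\<lambda>z. z powi k) n \<le> ?b n" for n
    using iterate_bound[OF d] r by (intro correlation_monomials r) auto
  have "?b \<longlonglongrightarrow> 2 / (r - cmod w) * \<bar>real_of_int j\<bar> * (16 / (1 - (cmod w)\<^sup>2) * (0 / (1 - r))) / r ^ nat \<bar>k\<bar>"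
    using d r norm_ge_zero[of w] by (intro tendsto_intros LIMSEQ_realpow_zero) auto
  then have lim: "?b \<longlonglongrightarrow> 0" by simp
  show "(\<lambda>n. corr (\<lambda>z. z powi j) (\<lambda>z. z powi k) n) \<longlonglongrightarrow> 0"
    by (rule tendsto_sandwich[OF always_eventually always_eventually tendsto_const lim])
       (intro allI correlation_nonneg, intro allI le)
qed

text \<open>
  In the disc the conjugated map is a rotation; the identity extends to the boundary by
  continuity.
\<close>

lemma moebius_eigenfunction:
  assumes d: "cmod (deriv \<phi> w) = 1" and z: "cmod z \<le> 1"
  shows "disc_moebius w (\<phi> z) = deriv \<phi> w * disc_moebius w z"
proof -
  let ?D = "\<lambda>z. disc_moebius w (\<phi> z) - deriv \<phi> w * disc_moebius w z"
  have "(\<lambda>u. disc_moebius w (\<phi> u)) \<in> disc_algebra"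
    using iterate_closed_disc[of _ 1] 
    by (intro disc_algebra_compose[OF disc_moebius_disc_algebra[OF w] disc_algebra] disc_to_disc) auto
  then have "?D \<in> disc_algebra"
    by (intro disc_algebra_diff disc_algebra_mult disc_algebra_const disc_moebius_disc_algebra w)
  then have "continuous_on (closure (ball 0 1)) ?D" by (simp add: disc_algebra_def)
  moreover have "?D u = 0" if "u \<in> ball 0 1" for u
  proof -
    have "cmod u < 1" using that by simp
    then show ?thesis
      using schwarz_rotation[OF centred_holomorphic centred_0 centred_disc] d disc_moebius_ball[OF w]
      by (simp add: deriv_centred centred_conjugates)
  qed
  moreover have "z \<in> closure (ball 0 1)" using z by simp
  ultimately have "?D z = 0" by (rule continuous_constant_on_closure)
  then show ?thesis by simp
qed

lemma moebius_correlation: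
  assumes d: "cmod (deriv \<phi> w) = 1"
  shows "corr (disc_moebius w) (disc_moebius w) n = 1"
proof -
  let ?m = "disc_moebius w"
  have it: "?m ((\<phi> ^^ n) z) = deriv \<phi> w ^ n * ?m z" if "cmod z = 1" for z n
    by (induction n) (use that in \<open>simp_all add: moebius_eigenfunction[OF d] iterate_circle\<close>)
  have "(LINT z|\<nu>. ?m ((\<phi> ^^ n) z) * cnj (?m z)) = (LINT z|\<nu>. deriv \<phi> w ^ n)"
  proof (intro Bochner_Integration.integral_cong refl)
    fix z assume "z \<in> space \<nu>"
    then have z: "cmod z = 1" by simp
    have "?m z * cnj (?m z) = 1" using disc_moebius_circle[OF w z] by (simp flip: complex_norm_square)
    then show "?m ((\<phi> ^^ n) z) * cnj (?m z) = deriv \<phi> w ^ n" by (simp add: it[OF z] mult.assoc)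
  qed
  also have "\<dots> = deriv \<phi> w ^ n" by (simp add: mass_one)
  finally show ?thesis
    using harmonic_mean_value[OF disc_moebius_disc_algebra[OF w] w] d
    by (simp add: correlation_def disc_moebius_def norm_power)
qed

lemma not_mixing_if_rotation:
  assumes d: "cmod (deriv \<phi> w) = 1"
  shows "\<not> mixing \<nu> \<phi>"
proof
  assume "mixing \<nu> \<phi>"
  moreover have "disc_moebius w \<in> L2_functions \<nu>"
    by (intro L2_continuous disc_algebra_continuous_circle disc_moebius_disc_algebra w)
  ultimately have "(\<lambda>n. corr (disc_moebius w) (disc_moebius w) n) \<longlonglongrightarrow> 0"
    by (simp add: mixing_def)
  then show False unfolding moebius_correlation[OF d] by (simp add: LIMSEQ_const_iff)
qed

lemma not_exponentially_mixing_if_rotation: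
  assumes d: "cmod (deriv \<phi> w) = 1" and \<alpha>: "0 < \<alpha>" "\<alpha> \<le> 1"
  shows "\<not> exponentially_mixing_on_holder \<nu> \<phi> \<alpha>"
proof
  assume "exponentially_mixing_on_holder \<nu> \<phi> \<alpha>"
  then obtain \<kappa> C where \<kappa>: "\<kappa> > 0" and le: "\<And>f g n. f \<in> holder_space \<alpha> \<Longrightarrow> g \<in> holder_space \<alpha> \<Longrightarrow> n \<ge> 1 \<Longrightarrow>
      corr f g n \<le> C * exp (- \<kappa> * real n) * holder_norm \<alpha> f * holder_norm \<alpha> g"
    unfolding exponentially_mixing_on_holder_def by blast
  define H where "H = holder_norm \<alpha> (disc_moebius w)"
  have "1 \<le> C * exp (- \<kappa>) ^ n * H * H" if "n \<ge> 1" for n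
    using le[OF disc_moebius_holder[OF w \<alpha>] disc_moebius_holder[OF w \<alpha>] that] 
    by (simp add: moebius_correlation[OF d] H_def exp_of_nat_mult[symmetric] mult.commute)
  then have "eventually (\<lambda>n. 1 \<le> C * exp (- \<kappa>) ^ n * H * H) sequentially"
    by (intro eventually_sequentiallyI)
  moreover have "(\<lambda>n. C * exp (- \<kappa>) ^ n * H * H) \<longlonglongrightarrow> C * 0 * H * H"
    using \<kappa> by (intro tendsto_intros LIMSEQ_realpow_zero) auto
  ultimately have "1 \<le> C * 0 * H * H"
    by (intro tendsto_lowerbound[of _ _ sequentially]) auto
  then show False by simp
qed

text \<open>
  Replace both functions by their approximants of degree \<open>M\<close>, at the price of the term with
  \<open>M\<^bsup>-\<alpha>/2\<^esup>\<close>. The approximants have at most \<open>(3M)\<^sup>2\<close> pairs of monomials, each contributing a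
  factor \<open>M\<close> from the degree and a factor \<open>M / t\<close> from evaluating the bound for the iterates at
  distance \<open>t / M\<close> from the circle. At that radius \<open>r\<^sup>M \<ge> 1/2\<close>, so Cauchy's inequality loses
  only a constant.
\<close>

lemma correlation_holder_bound:
  assumes d: "cmod (deriv \<phi> w) < 1" and \<alpha>: "0 < \<alpha>" "\<alpha> \<le> 1"
    and f: "f \<in> holder_space \<alpha>" and g: "g \<in> holder_space \<alpha>" and M: "M \<ge> 1"
  defines "t \<equiv> (1 - cmod w) / 2" and "s \<equiv> (1 + cmod (deriv \<phi> w)) / 2"
  shows "corr f g n \<le>
    (576 / (t\<^sup>2 * (1 - (cmod w)\<^sup>2)) * (real M ^ 4 * s ^ n) + 30 * real M powr (- \<alpha> / 2)) * (holder_norm \<alpha> f * holder_norm \<alpha> g)"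
proof -
  define A B where "A = holder_norm \<alpha> f" and "B = holder_norm \<alpha> g"
  note Af = holder_norm_bounds[OF f \<alpha>(1), folded A_def] and Bg = holder_norm_bounds[OF g \<alpha>(1), folded B_def]
  have \<alpha>2: "\<alpha> \<le> 2" and M0: "M > 0" using \<alpha> M by auto
  obtain a where a: "\<And>k. cmod (a k) \<le> A"
    "\<And>x. cmod x = 1 \<Longrightarrow> cmod (f x - (\<Sum>k\<in>{- int M..int M}. a k * x powi k)) \<le> 3 * A * real M powr (- \<alpha> / 2)"
    using trig_approx_holder[OF \<alpha>(1) \<alpha>2 Af(3,2,1) M0] by metis
  obtain b where b: "\<And>k. cmod (b k) \<le> B"
    "\<And>x. cmod x = 1 \<Longrightarrow> cmod (g x - (\<Sum>k\<in>{- int M..int M}. b k * x powi k)) \<le> 3 * B * real M powr (- \<alpha> / 2)"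
    using trig_approx_holder[OF \<alpha>(1) \<alpha>2 Bg(3,2,1) M0] by metis
  let ?p = "\<lambda>x. \<Sum>k\<in>{- int M..int M}. a k * x powi k" and ?q = "\<lambda>x. \<Sum>k\<in>{- int M..int M}. b k * x powi k"
  define \<delta> where "\<delta> = real M powr (- \<alpha> / 2)"
  have \<delta>: "0 \<le> \<delta>" "\<delta> \<le> 1" using M \<alpha> powr_mono[of "- \<alpha> / 2" 0 "real M"] by (auto simp: \<delta>_def)
  have L2: "f \<in> L2_functions \<nu>" "g \<in> L2_functions \<nu>"
    "?p \<in> L2_functions \<nu>" "?q \<in> L2_functions \<nu>"
    by (intro L2_continuous Af Bg trig_polynomial_continuous trig_polynomial_sum; simp)+
  have "l2_norm \<nu> (\<lambda>z. f z - ?p z) \<le> 3 * A * \<delta>"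
    using a(2) by (intro l2_norm_le L2_functions_diff L2) (auto simp: \<delta>_def)
  moreover have "l2_norm \<nu> g \<le> B" by (intro l2_norm_le L2 Bg)
  ultimately have e1: "2 * l2_norm \<nu> (\<lambda>z. f z - ?p z) * l2_norm \<nu> g \<le> 2 * (3 * A * \<delta>) * B"
    using Af(3) \<delta> by (intro mult_mono) (auto simp: l2_norm_nonneg)
  have "cmod (?p x) \<le> 4 * A" if "cmod x = 1" for x
  proof -
    have "cmod (?p x) \<le> cmod (f x) + cmod (f x - ?p x)" using norm_triangle_ineq4[of "f x" "f x - ?p x"] by simp
    also have "\<dots> \<le> A + 3 * A * 1"
      using Af(1)[OF that] order_trans[OF a(2)[OF that, folded \<delta>_def] mult_left_mono[OF \<delta>(2)]] Af(3)
      by (intro add_mono) auto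
    finally show ?thesis by simp
  qed
  then have "l2_norm \<nu> ?p \<le> 4 * A" by (intro l2_norm_le L2)
  moreover have "l2_norm \<nu> (\<lambda>z. g z - ?q z) \<le> 3 * B * \<delta>"
    using b(2) by (intro l2_norm_le L2_functions_diff L2) (auto simp: \<delta>_def)
  ultimately have e2: "2 * l2_norm \<nu> ?p * l2_norm \<nu> (\<lambda>z. g z - ?q z) \<le> 2 * (4 * A) * (3 * B * \<delta>)"
    using Af(3) \<delta> by (intro mult_mono) (auto simp: l2_norm_nonneg)
  define r where "r = 1 - t / real M"
  have t: "0 < t" "t \<le> 1 / 2" using w by (auto simp: t_def)
  have tM: "t / real M \<le> t" using t M by (simp add: pos_divide_le_eq)
  moreover note tM
  moreover have "1 - t = cmod w + t" by (simp add: t_def field_simps)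
  moreover have "0 < t / real M" using t M by simp
  ultimately have r: "cmod w + t \<le> r" "r < 1" by (auto simp: r_def)
  then have r0: "0 < r" using t norm_ge_zero[of w] by linarith
  have s: "0 < s" by (simp add: s_def add_pos_nonneg)
  define E where "E = 16 / (1 - (cmod w)\<^sup>2) * (s ^ n / (1 - r))"
  have E0: "0 \<le> E" unfolding E_def using w_square s r r0 by (intro mult_nonneg_nonneg divide_nonneg_nonneg) auto
  have mono: "corr (\<lambda>z. z powi j) (\<lambda>z. z powi k) n \<le> 2 / t * real M * E * 2"
    if "j \<in> {- int M..int M}" "k \<in> {- int M..int M}" for j k
  proof -
    have "corr (\<lambda>z. z powi j) (\<lambda>z. z powi k) n \<le>
       2 / (r - cmod w) * \<bar>real_of_int j\<bar> * E / r ^ nat \<bar>k\<bar>"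
      using r t iterate_bound[OF d] by (intro correlation_monomials) (auto simp: E_def s_def intro: less_le_trans)
    also have "\<dots> = 2 / (r - cmod w) * \<bar>real_of_int j\<bar> * E * (1 / r ^ nat \<bar>k\<bar>)" by simp
    also have "\<dots> \<le> 2 / t * real M * E * 2"
    proof (intro mult_mono)
      show "2 / (r - cmod w) \<le> 2 / t" using t r by (intro divide_left_mono mult_pos_pos) auto
      show "\<bar>real_of_int j\<bar> \<le> real M" using that(1) by auto
      have "1 / 2 \<le> 1 - real M * (t / real M)" using t M by simp
      also have "\<dots> \<le> r ^ M"
        using Bernoulli_inequality[of "- (t / real M)" M] t M tM by (simp add: r_def)
      also have "\<dots> \<le> r ^ nat \<bar>k\<bar>" using that(2) r r0 by (intro power_decreasing) auto
      finally show "1 / r ^ nat \<bar>k\<bar> \<le> 2" using r0 by (simp add: field_simps)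
    qed (use t r r0 E0 in auto)
    finally show ?thesis .
  qed
  have card: "card {- int M..int M} = 2 * M + 1" by simp
  have "corr ?p ?q n \<le> 
    (\<Sum>k\<in>{- int M..int M}. \<Sum>l\<in>{- int M..int M}. cmod (a k) * cmod (b l) * corr (\<lambda>z. z powi k) (\<lambda>z. z powi l) n)"
    by (rule correlation_sum_le) (auto intro!: L2_continuous continuous_intros)
  also have "\<dots> \<le> (\<Sum>k\<in>{- int M..int M}. \<Sum>l\<in>{- int M..int M}. A * B * (2 / t * real M * E * 2))"
    using a(1) b(1) mono Af(3) Bg(3) by (intro sum_mono mult_mono mult_nonneg_nonneg) (auto simp: correlation_nonneg)
  also have "\<dots> = real (2 * M + 1) ^ 2 * (A * B * (2 / t * real M * E * 2))"
    by (simp only: sum_constant card power2_eq_square mult.assoc)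
  also have "\<dots> \<le> (3 * real M) ^ 2 * (A * B * (2 / t * real M * E * 2))"
    using M t E0 Af(3) Bg(3) by (intro mult_right_mono power_mono mult_nonneg_nonneg) auto
  also have "\<dots> = 576 / (t\<^sup>2 * (1 - (cmod w)\<^sup>2)) * (real M ^ 4 * s ^ n) * (A * B)"
    using t M w_square by (simp add: E_def r_def power2_eq_square power4_eq_xxxx field_simps)
  finally have pq: "corr ?p ?q n \<le> 576 / (t\<^sup>2 * (1 - (cmod w)\<^sup>2)) * (real M ^ 4 * s ^ n) * (A * B)" .
  have "corr f g n \<le> corr ?p ?q n
      + 2 * l2_norm \<nu> (\<lambda>z. f z - ?p z) * l2_norm \<nu> g
     + 2 * l2_norm \<nu> ?p * l2_norm \<nu> (\<lambda>z. g z - ?q z)"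
    by (intro correlation_perturb L2)
  also have "\<dots> \<le> 576 / (t\<^sup>2 * (1 - (cmod w)\<^sup>2)) * (real M ^ 4 * s ^ n) * (A * B) + 2 * (3 * A * \<delta>) * B + 2 * (4 * A) * (3 * B * \<delta>)"
    by (intro add_mono pq e1 e2)
  also have "\<dots> = (576 / (t\<^sup>2 * (1 - (cmod w)\<^sup>2)) * (real M ^ 4 * s ^ n) + 30 * \<delta>) * (A * B)"
    by (simp add: algebra_simps)
  finally show ?thesis unfolding \<delta>_def A_def B_def .
qed

text \<open>
  With \<open>M\<close> of order \<open>s\<^bsup>-n/8\<^esup>\<close>, the first term of the preceding bound is of order \<open>s\<^bsup>n/2\<^esup>\<close> and
  the second of order \<open>s\<^bsup>\<alpha>n/16\<^esup>\<close>; the latter dominates.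
\<close>

lemma exponentially_mixing_if_attracting:
  assumes d: "cmod (deriv \<phi> w) < 1" and \<alpha>: "0 < \<alpha>" "\<alpha> \<le> 1"
  shows "exponentially_mixing_on_holder \<nu> \<phi> \<alpha>"
proof -
  define s where "s = (1 + cmod (deriv \<phi> w)) / 2"
  have s: "0 < s" "s < 1" using d by (auto simp: s_def add_pos_nonneg)
  define D where "D = 576 / (((1 - cmod w) / 2)\<^sup>2 * (1 - (cmod w)\<^sup>2))"
  have D: "0 \<le> D" unfolding D_def using w_square by (intro divide_nonneg_nonneg mult_nonneg_nonneg) auto
  define \<kappa> where "\<kappa> = \<alpha> / 16 * (- ln s)"
  have "\<kappa> > 0" using \<alpha> s by (simp add: \<kappa>_def mult_pos_neg)
  moreover have "16 * D + 30 > 0" using D by simp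
  moreover have "corr f g n \<le> (16 * D + 30) * exp (- \<kappa> * real n) * holder_norm \<alpha> f * holder_norm \<alpha> g"
    if f: "f \<in> holder_space \<alpha>" and g: "g \<in> holder_space \<alpha>" for f g n
  proof -
    \<comment> \<open>This is \<open>s\<close> to the power \<open>- n / 8\<close>, before rounding to an integer.\<close>
    define x where "x = exp (real n * (- ln s) / 8)"
    define M where "M = nat \<lceil>x\<rceil>"
    have x1: "1 \<le> x" using s by (simp add: x_def mult_nonneg_nonpos)
    have Mx: "x \<le> real M" unfolding M_def by (rule real_nat_ceiling_ge)
    have "real M \<le> x + 1" using x1 unfolding M_def by linarith
    then have M2: "real M \<le> 2 * x" using x1 by linarith
    have M1: "M \<ge> 1" using Mx x1 by linarith
    have sn: "s ^ n = inverse (x ^ 8)"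
    proof -
      have "s ^ n = exp (real n * ln s)" using s by (simp add: exp_of_nat_mult)
      also have "\<dots> = inverse (exp (real 8 * (real n * (- ln s) / 8)))" by (simp flip: exp_minus)
      finally show ?thesis unfolding x_def exp_of_nat_mult .
    qed
    have "real M ^ 4 * s ^ n \<le> (2 * x) ^ 4 * s ^ n"
      using M2 s by (intro mult_right_mono power_mono) auto
    also have "\<dots> = 16 * x powr (- 4)"
      unfolding sn using x1 by (simp add: powr_minus powr_numeral power_mult_distrib field_simps flip: power_add)
    also have "x powr (- 4) \<le> x powr (- \<alpha> / 2)" using x1 \<alpha> by (intro powr_mono) auto
    finally have 1: "real M ^ 4 * s ^ n \<le> 16 * x powr (- \<alpha> / 2)" by simp
    have 2: "real M powr (- \<alpha> / 2) \<le> x powr (- \<alpha> / 2)" using Mx x1 \<alpha> by (intro powr_mono2') auto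
    have 3: "x powr (- \<alpha> / 2) = exp (- \<kappa> * real n)" by (simp add: x_def powr_def \<kappa>_def)
    have "D * (real M ^ 4 * s ^ n) + 30 * real M powr (- \<alpha> / 2) \<le> D * (16 * x powr (- \<alpha> / 2)) + 30 * x powr (- \<alpha> / 2)"
      using 1 2 D by (intro add_mono mult_left_mono) auto
    also have "\<dots> = (16 * D + 30) * exp (- \<kappa> * real n)" unfolding 3 by (simp add: algebra_simps)
    finally have "(D * (real M ^ 4 * s ^ n) + 30 * real M powr (- \<alpha> / 2)) * (holder_norm \<alpha> f * holder_norm \<alpha> g) 
        \<le> (16 * D + 30) * exp (- \<kappa> * real n) * (holder_norm \<alpha> f * holder_norm \<alpha> g)"
      using holder_norm_bounds(3)[OF f \<alpha>(1)] holder_norm_bounds(3)[OF g \<alpha>(1)] by (intro mult_right_mono) auto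
    then show ?thesis
      using correlation_holder_bound[OF d \<alpha> f g M1, of n] by (simp add: D_def s_def mult.assoc)
  qed
  ultimately show ?thesis unfolding exponentially_mixing_on_holder_def by blast
qed

end

section \<open>Fourier coefficients and the spaces \<open>H\<^sub>\<theta>\<close>\<close>

lemma powi_L2: "(\<lambda>z. z powi k) \<in> L2_functions circle_measure"
  by (intro circle.L2_continuous continuous_intros) auto

lemma fourier_integrand_integrable:
  assumes "f \<in> L2_functions circle_measure"
  shows "integrable circle_measure (\<lambda>z. f z * z powi k)"
proof -
  have "integrable circle_measure (\<lambda>z. f z * cnj (z powi (- k)))"
    by (intro L2_functions_product assms powi_L2)
  also have "?this \<longleftrightarrow> integrable circle_measure (\<lambda>z. f z * z powi k)"
    by (intro Bochner_Integration.integrable_cong refl)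
       (simp add: cnj_circle power_int_minus power_int_inverse)
  finally show ?thesis .
qed

lemma fourier_coeff_diff:
  assumes "f \<in> L2_functions circle_measure" "g \<in> L2_functions circle_measure"
  shows "fourier_coeff (\<lambda>z. f z - g z) k = fourier_coeff f k - fourier_coeff g k"
  using fourier_integrand_integrable[OF assms(1)] fourier_integrand_integrable[OF assms(2)]
  by (simp add: fourier_coeff_def left_diff_distrib)

lemma fourier_coeff_powi: "fourier_coeff (\<lambda>z. z powi j) k = (if k = j then 1 else 0)"
proof -
  have "fourier_coeff (\<lambda>z. z powi j) k = (LINT z|circle_measure. z powi (j - k))"
    unfolding fourier_coeff_def
  proof (intro Bochner_Integration.integral_cong refl)
    fix z assume "z \<in> space circle_measure"
    then have "z \<noteq> 0" by auto
    then show "z powi j * z powi (- k) = z powi (j - k)" by (simp add: power_int_add[symmetric])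
  qed
  then show ?thesis by (simp add: circle_monomial_integral)
qed

lemma fourier_coeff_sum:
  assumes "finite K"
  shows "fourier_coeff (\<lambda>z. \<Sum>k\<in>K. c k * z powi k) j = (if j \<in> K then c j else 0)"
proof -
  have "fourier_coeff (\<lambda>z. \<Sum>k\<in>K. c k * z powi k) j = (\<Sum>k\<in>K. LINT z|circle_measure. c k * (z powi k * z powi (- j)))"
    unfolding fourier_coeff_def sum_distrib_right mult.assoc
    by (intro Bochner_Integration.integral_sum integrable_mult_right fourier_integrand_integrable powi_L2)
  also have "\<dots> = (\<Sum>k\<in>K. c k * fourier_coeff (\<lambda>z. z powi k) j)"
    by (simp add: fourier_coeff_def)
  also have "\<dots> = (\<Sum>k\<in>K. if k = j then c k else 0)"
    by (intro sum.cong) (auto simp: fourier_coeff_powi)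
  finally show ?thesis using assms by simp
qed

text \<open>
  Among the trigonometric polynomials with frequencies in \<open>K\<close>, the Fourier partial sum is the
  best approximation in \<open>L\<^sub>2\<close>, so it is at least as good as the polynomial provided by density.
\<close>

lemma fourier_partial_sum_approx:
  assumes f: "f \<in> L2_functions circle_measure" and \<epsilon>: "\<epsilon> > 0"
  obtains K where "finite K" "(LINT z|circle_measure. (cmod (f z - (\<Sum>k\<in>K. fourier_coeff f k * z powi k)))\<^sup>2) < \<epsilon>"
proof -
  obtain p where p: "p \<in> trig_polynomials" "(LINT z|circle_measure. (cmod (f z - p z))\<^sup>2) < \<epsilon>"
    using circle.trig_polynomials_dense[OF f \<epsilon>] by blast
  obtain c K where K: "p = (\<lambda>z. \<Sum>k\<in>K. c k * z powi k)" "finite K"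
    using p(1) by (auto simp: trig_polynomials_def)
  define S where "S = (\<lambda>z. \<Sum>k\<in>K. fourier_coeff f k * z powi k)"
  define a where "a = (\<lambda>z. f z - S z)"
  define b where "b = (\<lambda>z. \<Sum>k\<in>K. (fourier_coeff f k - c k) * z powi k)"
  have SL2: "S \<in> L2_functions circle_measure" and bL2: "b \<in> L2_functions circle_measure"
    unfolding S_def b_def using K(2) by (auto intro!: circle.trig_L2 trig_polynomial_sum)
  have aL2: "a \<in> L2_functions circle_measure" unfolding a_def by (intro L2_functions_diff f SL2)
  have ab: "f z - p z = a z + b z" for z
    by (simp add: a_def b_def S_def K(1) left_diff_distrib sum_subtractf)
  have orth: "(LINT z|circle_measure. a z * cnj (b z)) = 0"
  proof -
    have "(LINT z|circle_measure. a z * cnj (b z)) = (LINT z|circle_measure. (\<Sum>k\<in>K. cnj (fourier_coeff f k - c k) * (a z * z powi (- k))))"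
      by (intro Bochner_Integration.integral_cong refl)
         (simp add: b_def sum_distrib_left cnj_circle power_int_minus power_int_inverse mult_ac)
    also have "\<dots> = (\<Sum>k\<in>K. LINT z|circle_measure. cnj (fourier_coeff f k - c k) * (a z * z powi (- k)))"
      by (intro Bochner_Integration.integral_sum integrable_mult_right fourier_integrand_integrable aL2)
    also have "\<dots> = (\<Sum>k\<in>K. cnj (fourier_coeff f k - c k) * fourier_coeff a k)"
      by (simp add: fourier_coeff_def)
    also have "\<dots> = 0"
    proof (intro sum.neutral ballI)
      fix k assume "k \<in> K"
      then have "fourier_coeff S k = fourier_coeff f k" unfolding S_def by (simp add: fourier_coeff_sum K(2))
      then have "fourier_coeff a k = 0" unfolding a_def fourier_coeff_diff[OF f SL2] by simp
      then show "cnj (fourier_coeff f k - c k) * fourier_coeff a k = 0" by simp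
    qed
    finally show ?thesis .
  qed
  have "(LINT z|circle_measure. (cmod (a z))\<^sup>2) \<le> (LINT z|circle_measure. (cmod (f z - p z))\<^sup>2)"
  proof -
    have "(cmod (f z - p z))\<^sup>2 = (cmod (a z))\<^sup>2 + (cmod (b z))\<^sup>2 + 2 * Re (a z * cnj (b z))" for z
      unfolding ab cmod_power2 by (simp add: power2_eq_square algebra_simps)
    then have "(LINT z|circle_measure. (cmod (f z - p z))\<^sup>2) = 
      (LINT z|circle_measure. (cmod (a z))\<^sup>2 + (cmod (b z))\<^sup>2 + 2 * Re (a z * cnj (b z)))" by simp
    also have "\<dots> = (LINT z|circle_measure. (cmod (a z))\<^sup>2) + (LINT z|circle_measure. (cmod (b z))\<^sup>2) + 2 * Re (LINT z|circle_measure. a z * cnj (b z))"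
      using L2_functions_integrable[OF aL2] L2_functions_integrable[OF bL2] L2_functions_product[OF aL2 bL2]
      by (simp del: times_complex.sel)
    also have "\<dots> = (LINT z|circle_measure. (cmod (a z))\<^sup>2) + (LINT z|circle_measure. (cmod (b z))\<^sup>2)"
      unfolding orth by simp
    finally show ?thesis by (simp add: integral_nonneg_AE)
  qed
  with p(2) have "(LINT z|circle_measure. (cmod (a z))\<^sup>2) < \<epsilon>" by linarith
  then show ?thesis using that[OF K(2)] unfolding a_def S_def by blast
qed

text \<open>
  Subtracting a trigonometric polynomial changes only finitely many Fourier coefficients.
\<close>

lemma H_theta_norm_finite:
  assumes f: "f \<in> H_theta \<theta>"
  shows "theta_norm_finite \<theta> f"
proof -
  have fL2: "f \<in> L2_functions circle_measure" using f by (simp add: H_theta_def)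
  obtain p where p: "p \<in> trig_polynomials" "theta_norm_finite \<theta> (\<lambda>z. f z - p z)"
    using f zero_less_one unfolding H_theta_def by blast
  obtain c K where K: "p = (\<lambda>z. \<Sum>k\<in>K. c k * z powi k)" "finite K"
    using p(1) by (auto simp: trig_polynomials_def)
  let ?F = "\<lambda>g k. (cmod (fourier_coeff g k))\<^sup>2 * \<theta> powi (- 2 * \<bar>k\<bar>)"
  have "?F (\<lambda>z. f z - p z) summable_on (UNIV - K)"
    using p(2) K(2) unfolding theta_norm_finite_def by (rule summable_on_cofin_subset)
  also have "?this \<longleftrightarrow> ?F f summable_on (UNIV - K)"
  proof (rule summable_on_cong)
    fix k assume "k \<in> UNIV - K"
    then have "fourier_coeff p k = 0" using K by (simp add: fourier_coeff_sum)
    then show "?F (\<lambda>z. f z - p z) k = ?F f k"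
      by (simp add: fourier_coeff_diff[OF fL2 circle.trig_L2[OF p(1)]])
  qed
  finally have "?F f summable_on (UNIV - K)" .
  then have "?F f summable_on (UNIV - K \<union> K)"
    by (rule summable_on_Un_disjoint) (use K(2) in auto)
  moreover have "UNIV - K \<union> K = UNIV" by auto
  ultimately show ?thesis unfolding theta_norm_finite_def by simp
qed

lemma theta_norm_nonneg: "0 < \<theta> \<Longrightarrow> 0 \<le> theta_norm \<theta> f"
  unfolding theta_norm_def by (intro real_sqrt_ge_zero infsum_nonneg mult_nonneg_nonneg) auto

lemma theta_weight:
  assumes "\<theta> > (0 :: real)"
  shows "\<theta> powi (- (2 * \<bar>k\<bar>)) = 1 / (\<theta> ^ nat \<bar>k\<bar>)\<^sup>2"
proof -
  have "- (2 * \<bar>k\<bar>) = - int (nat \<bar>k\<bar> * 2)" by simp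
  then have "\<theta> powi (- (2 * \<bar>k\<bar>)) = inverse (\<theta> ^ (nat \<bar>k\<bar> * 2))" by (simp only: power_int_minus power_int_of_nat)
  then show ?thesis by (simp add: power_mult field_simps)
qed

lemma fourier_coeff_le_theta_norm:
  assumes \<theta>: "\<theta> > 0" and f: "theta_norm_finite \<theta> f"
  shows "cmod (fourier_coeff f k) \<le> \<theta> ^ nat \<bar>k\<bar> * theta_norm \<theta> f"
proof -
  let ?F = "\<lambda>k. (cmod (fourier_coeff f k))\<^sup>2 * \<theta> powi (- 2 * \<bar>k\<bar>)"
  have "sum ?F {k} \<le> infsum ?F UNIV"
    using f \<theta> unfolding theta_norm_finite_def by (intro finite_sum_le_infsum) auto
  then have "(cmod (fourier_coeff f k))\<^sup>2 / (\<theta> ^ nat \<bar>k\<bar>)\<^sup>2 \<le> (theta_norm \<theta> f)\<^sup>2"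
    unfolding theta_norm_def using \<theta> by (simp add: theta_weight infsum_nonneg)
  then have "(cmod (fourier_coeff f k))\<^sup>2 \<le> (\<theta> ^ nat \<bar>k\<bar> * theta_norm \<theta> f)\<^sup>2"
    using \<theta> by (simp add: pos_divide_le_eq power_mult_distrib mult.commute)
  then show ?thesis
    using \<theta> theta_norm_nonneg[OF \<theta>] by (intro power2_le_imp_le[of "cmod (fourier_coeff f k)"]) auto
qed

lemma powi_H_theta:
  assumes "\<theta> > 0"
  shows "(\<lambda>z. z powi k) \<in> H_theta \<theta>"
proof -
  have "(\<lambda>z. z powi k) \<in> trig_polynomials"
    using trig_polynomial_sum[of "{k}" "\<lambda>_. 1"] by simp
  moreover have "theta_norm_finite \<theta> (\<lambda>z. z powi k - z powi k)" "theta_norm \<theta> (\<lambda>z. z powi k - z powi k) = 0"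
    by (simp_all add: theta_norm_finite_def theta_norm_def fourier_coeff_const)
  ultimately show ?thesis using powi_L2[of k] unfolding H_theta_def by force
qed

lemma theta_norm_powi:
  assumes "\<theta> > 0"
  shows "theta_norm \<theta> (\<lambda>z. z powi k) = 1 / \<theta> ^ nat \<bar>k\<bar>"
proof -
  let ?F = "\<lambda>j. (cmod (fourier_coeff (\<lambda>z. z powi k) j))\<^sup>2 * \<theta> powi (- 2 * \<bar>j\<bar>)"
  have "infsum ?F UNIV = infsum ?F {k}"
    by (rule infsum_cong_neutral) (auto simp: fourier_coeff_powi)
  also have "\<dots> = (1 / \<theta> ^ nat \<bar>k\<bar>)\<^sup>2"
    using assms by (simp add: fourier_coeff_powi theta_weight power_divide)
  finally show ?thesis unfolding theta_norm_def using assms by simp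
qed

text \<open>
  The Poisson kernel is bounded by \<open>(1 + |w|) / (1 - |w|)\<close>.
\<close>

lemma L2_harmonic_if_L2_circle:
  assumes w: "cmod w < 1" and f: "f \<in> L2_functions circle_measure"
  shows "f \<in> L2_functions (harmonic_measure w)"
    "(LINT z|harmonic_measure w. (cmod (f z))\<^sup>2) \<le> 2 / (1 - cmod w) * (LINT z|circle_measure. (cmod (f z))\<^sup>2)"
proof -
  let ?P = "\<lambda>z. (1 - (cmod w)\<^sup>2) / (cmod (z - w))\<^sup>2"
  have fm: "f \<in> borel_measurable circle_measure" by (rule L2_functions_measurable[OF f])
  then have f2m: "(\<lambda>z. (cmod (f z))\<^sup>2) \<in> borel_measurable circle_measure" by measurable
  have P0: "0 \<le> ?P z" for z using w by (intro divide_nonneg_nonneg) (auto simp: abs_square_le_1)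
  have Pm: "?P \<in> borel_measurable circle_measure"
    using w by (intro continuous_on_circle_measurable continuous_intros) auto
  have P: "?P z \<le> 2 / (1 - cmod w)" if "cmod z = 1" for z
  proof -
    have "1 - cmod w \<le> cmod (z - w)" using norm_triangle_ineq2[of z w] that by simp
    then have "(1 - cmod w)\<^sup>2 \<le> (cmod (z - w))\<^sup>2" using w by (intro power_mono) auto
    moreover have "0 < (cmod (z - w))\<^sup>2 * (1 - cmod w)\<^sup>2" using w that by (intro mult_pos_pos) auto
    ultimately have "?P z \<le> (1 - (cmod w)\<^sup>2) / (1 - cmod w)\<^sup>2"
      using w by (intro divide_left_mono) (auto simp: abs_square_le_1)
    also have "\<dots> = (1 + cmod w) / (1 - cmod w)"
      using w by (simp add: power2_eq_square divide_simps) (simp add: algebra_simps)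
    also have "\<dots> \<le> 2 / (1 - cmod w)" using w by (intro divide_right_mono) auto
    finally show ?thesis .
  qed
  have le: "?P z * (cmod (f z))\<^sup>2 \<le> 2 / (1 - cmod w) * (cmod (f z))\<^sup>2" if "cmod z = 1" for z
    using P[OF that] by (intro mult_right_mono) auto
  have int: "integrable circle_measure (\<lambda>z. 2 / (1 - cmod w) * (cmod (f z))\<^sup>2)"
    using L2_functions_integrable[OF f] by simp
  have intP: "integrable circle_measure (\<lambda>z. ?P z * (cmod (f z))\<^sup>2)"
  proof (rule Bochner_Integration.integrable_bound[OF int])
    show "(\<lambda>z. ?P z * (cmod (f z))\<^sup>2) \<in> borel_measurable circle_measure"
      by (intro borel_measurable_times Pm f2m)
    show "AE z in circle_measure. norm (?P z * (cmod (f z))\<^sup>2) \<le> norm (2 / (1 - cmod w) * (cmod (f z))\<^sup>2)"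
    proof (rule AE_I2)
      fix z assume "z \<in> space circle_measure"
      then have "cmod z = 1" by simp
      from le[OF this] show "norm (?P z * (cmod (f z))\<^sup>2) \<le> norm (2 / (1 - cmod w) * (cmod (f z))\<^sup>2)"
        using P0[of z] w by (simp only: real_norm_def abs_of_nonneg mult_nonneg_nonneg zero_le_power2)
    qed
  qed
  have "integrable (harmonic_measure w) (\<lambda>z. (cmod (f z))\<^sup>2)"
    unfolding harmonic_measure_def
    by (subst integrable_density) (use intP f2m Pm P0 in auto)
  moreover have "f \<in> borel_measurable (harmonic_measure w)"
    using fm by (simp cong: measurable_cong_sets)
  ultimately show "f \<in> L2_functions (harmonic_measure w)" by (simp add: L2_functions_def)
  have "(LINT z|harmonic_measure w. (cmod (f z))\<^sup>2) = (LINT z|circle_measure. ?P z * (cmod (f z))\<^sup>2)"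
    using f2m by (subst harmonic_integral[OF w]) (simp_all cong: measurable_cong_sets)
  also have "\<dots> \<le> (LINT z|circle_measure. 2 / (1 - cmod w) * (cmod (f z))\<^sup>2)"
    using le by (intro integral_mono intP int) auto
  finally show "(LINT z|harmonic_measure w. (cmod (f z))\<^sup>2) \<le> 2 / (1 - cmod w) * (LINT z|circle_measure. (cmod (f z))\<^sup>2)"
    by simp
qed

lemma fourier_partial_sum_approx_harmonic:
  assumes w: "cmod w < 1" and f: "f \<in> L2_functions circle_measure" and \<epsilon>: "\<epsilon> > 0"
  obtains K where "finite K" "l2_norm (harmonic_measure w) (\<lambda>z. f z - (\<Sum>k\<in>K. fourier_coeff f k * z powi k)) < \<epsilon>"
proof -
  have pos: "\<epsilon>\<^sup>2 * (1 - cmod w) / 2 > 0" using w \<epsilon> by simp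
  obtain K where K: "finite K" "(LINT z|circle_measure. (cmod (f z - (\<Sum>k\<in>K. fourier_coeff f k * z powi k)))\<^sup>2) < \<epsilon>\<^sup>2 * (1 - cmod w) / 2"
    using fourier_partial_sum_approx[OF f pos] by blast
  have "(LINT z|harmonic_measure w. (cmod (f z - (\<Sum>k\<in>K. fourier_coeff f k * z powi k)))\<^sup>2) \<le>
    2 / (1 - cmod w) * (LINT z|circle_measure. (cmod (f z - (\<Sum>k\<in>K. fourier_coeff f k * z powi k)))\<^sup>2)"
    by (intro L2_harmonic_if_L2_circle w L2_functions_diff f circle.trig_L2 trig_polynomial_sum K)
  also have "\<dots> < 2 / (1 - cmod w) * (\<epsilon>\<^sup>2 * (1 - cmod w) / 2)"
    using K(2) w by (intro mult_strict_left_mono) auto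
  also have "\<dots> = \<epsilon>\<^sup>2" using w by simp
  finally have "l2_norm (harmonic_measure w) (\<lambda>z. f z - (\<Sum>k\<in>K. fourier_coeff f k * z powi k)) < \<epsilon>"
    unfolding l2_norm_def using \<epsilon> by (intro real_less_lsqrt) (auto simp: integral_nonneg_AE)
  then show ?thesis using that K(1) by blast
qed

section \<open>Double exponential mixing\<close>

lemma sum_half_powers_int_le:
  assumes "finite (K :: int set)"
  shows "(\<Sum>k\<in>K. (1 / 2) ^ nat \<bar>k\<bar>) \<le> (4 :: real)"
proof -
  define m where "m = nat (Max (insert 0 (abs ` K)))"
  have fin: "finite (insert 0 (abs ` K))" using assms by simp
  have m: "\<bar>k\<bar> \<le> int m" if "k \<in> K" for k
    using Max_ge[OF fin, of "\<bar>k\<bar>"] Max_ge[OF fin, of 0] that by (simp add: m_def)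
  have sub: "K \<subseteq> int ` {..m} \<union> (\<lambda>k. - int k) ` {..m}"
  proof
    fix k assume "k \<in> K"
    then have "nat \<bar>k\<bar> \<in> {..m}" using m by fastforce
    moreover have "k = int (nat \<bar>k\<bar>) \<or> k = - int (nat \<bar>k\<bar>)" by auto
    ultimately show "k \<in> int ` {..m} \<union> (\<lambda>k. - int k) ` {..m}" by blast
  qed
  have geo: "(\<Sum>k\<le>m. (1 / 2 :: real) ^ k) \<le> 2"
  proof -
    have "(\<Sum>k\<le>m. (1 / 2 :: real) ^ k) = 2 - (1 / 2) ^ m" by (induction m) auto
    then show ?thesis by simp
  qed
  have "(\<Sum>k\<in>K. (1 / 2 :: real) ^ nat \<bar>k\<bar>) \<le> (\<Sum>k\<in>int ` {..m} \<union> (\<lambda>k. - int k) ` {..m}. (1 / 2) ^ nat \<bar>k\<bar>)"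
    using sub by (intro sum_mono2) auto
  also have "\<dots> \<le> (\<Sum>k\<in>int ` {..m}. (1 / 2) ^ nat \<bar>k\<bar>) + (\<Sum>k\<in>(\<lambda>k. - int k) ` {..m}. (1 / 2) ^ nat \<bar>k\<bar>)"
    by (subst sum.union_inter[symmetric]) (auto intro!: sum_nonneg)
  also have "\<dots> = (\<Sum>k\<le>m. (1 / 2) ^ k) + (\<Sum>k\<le>m. (1 / 2) ^ k)"
    by (subst (1 2) sum.reindex) (auto simp: inj_on_def)
  finally show ?thesis using geo by linarith
qed

context disc_self_map
begin

text \<open>
  Choosing \<open>\<theta> = r / 4\<close> leaves room for two losses: the factor \<open>|j|\<close> and the factor \<open>r\<^bsup>-|k|\<^esup>\<close> in
  the bound for monomials. After absorbing them the double sum over all pairs of frequencies is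
  bounded independently of the partial sums. On the circle of radius \<open>r\<close> the Moebius map has
  modulus at most \<open>\<sigma>\<close>, which squares at each step.
\<close>

lemma double_exponentially_mixing_if_superattracting:
  assumes d: "deriv \<phi> w = 0"
  shows "double_exponentially_mixing \<nu> \<phi>"
proof -
  define r where "r = (1 + cmod w) / 2"
  have r: "cmod w < r" "r < 1" "0 < r" using w by (auto simp: r_def add_pos_nonneg)
  define \<theta> where "\<theta> = r / 4"
  have \<theta>: "0 < \<theta>" "\<theta> < 1" using r by (auto simp: \<theta>_def)
  define \<sigma> where "\<sigma> = 1 - (1 - (cmod w)\<^sup>2) * (1 - r) / 8"
  have gap: "0 < (1 - (cmod w)\<^sup>2) * (1 - r)" using w_square r by simp
  have "(1 - (cmod w)\<^sup>2) * (1 - r) \<le> 1 * 1" using w_square r by (intro mult_mono) auto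
  then have \<sigma>: "0 < \<sigma>" "\<sigma> < 1" using gap by (auto simp: \<sigma>_def)
  define C where "C = 64 / (r - cmod w)"
  have C: "C > 0" using r by (simp add: C_def)
  have partial: "corr (\<lambda>z. \<Sum>k\<in>K. fourier_coeff f k * z powi k) (\<lambda>z. \<Sum>k\<in>L. fourier_coeff g k * z powi k) n
      \<le> C * \<sigma> ^ (2 ^ n) * theta_norm \<theta> f * theta_norm \<theta> g"
    if f: "theta_norm_finite \<theta> f" and g: "theta_norm_finite \<theta> g" and K: "finite K" "finite L" for f g K L n
  proof -
    define A B where "A = theta_norm \<theta> f" and "B = theta_norm \<theta> g"
    have AB: "0 \<le> A" "0 \<le> B" using theta_norm_nonneg[OF \<theta>(1)] by (auto simp: A_def B_def)
    define E where "E = 2 * \<sigma> ^ (2 ^ n)"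
    have E0: "0 \<le> E" using \<sigma> by (simp add: E_def)
    have mono: "corr (\<lambda>z. z powi j) (\<lambda>z. z powi k) n \<le>
         2 / (r - cmod w) * \<bar>real_of_int j\<bar> * E / r ^ nat \<bar>k\<bar>" for j k
    proof (rule correlation_monomials[OF r(1,2)])
      fix z assume z: "cmod z = r"
      have "cmod (disc_moebius w z) \<le> \<sigma>"
        using disc_moebius_gap[OF w, of z] z r by (simp add: \<sigma>_def)
      then have "cmod (disc_moebius w z) ^ (2 ^ n) \<le> \<sigma> ^ (2 ^ n)" by (intro power_mono) auto
      then show "cmod ((\<phi> ^^ n) z - w) \<le> E"
        using iterate_superattracting[OF d, of z n] z r by (simp add: E_def)
    qed
    have summand: "cmod (fourier_coeff f j) * cmod (fourier_coeff g k) * corr (\<lambda>z. z powi j) (\<lambda>z. z powi k) n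
      \<le> (2 * A * B * E / (r - cmod w)) * ((1 / 2) ^ nat \<bar>j\<bar> * (1 / 2) ^ nat \<bar>k\<bar>)" for j k
    proof -
      have "cmod (fourier_coeff f j) * cmod (fourier_coeff g k) * corr (\<lambda>z. z powi j) (\<lambda>z. z powi k) n
        \<le> (\<theta> ^ nat \<bar>j\<bar> * A) * (\<theta> ^ nat \<bar>k\<bar> * B) * (2 / (r - cmod w) * \<bar>real_of_int j\<bar> * E / r ^ nat \<bar>k\<bar>)"
        using fourier_coeff_le_theta_norm[OF \<theta>(1) f] fourier_coeff_le_theta_norm[OF \<theta>(1) g] mono[of j k] AB \<theta>
        by (intro mult_mono mult_nonneg_nonneg) (auto simp: A_def B_def correlation_nonneg)
      also have "\<dots> = (2 * A * B * E / (r - cmod w)) * ((\<theta> ^ nat \<bar>j\<bar> * \<bar>real_of_int j\<bar>) * (\<theta> / r) ^ nat \<bar>k\<bar>)"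
        by (simp add: power_divide)
      also have "\<dots> \<le> (2 * A * B * E / (r - cmod w)) * ((1 / 2) ^ nat \<bar>j\<bar> * (1 / 2) ^ nat \<bar>k\<bar>)"
      proof (intro mult_left_mono mult_mono)
        have "\<bar>real_of_int j\<bar> = real (nat \<bar>j\<bar>)" by simp
        also have "\<dots> \<le> 2 ^ nat \<bar>j\<bar>" by (metis less_imp_le of_nat_less_two_power)
        finally have "\<theta> ^ nat \<bar>j\<bar> * \<bar>real_of_int j\<bar> \<le> (1 / 4) ^ nat \<bar>j\<bar> * 2 ^ nat \<bar>j\<bar>"
          using \<theta> r by (intro mult_mono power_mono) (auto simp: \<theta>_def)
        also have "\<dots> = (1 / 2) ^ nat \<bar>j\<bar>" by (simp flip: power_mult_distrib)
        finally show "\<theta> ^ nat \<bar>j\<bar> * \<bar>real_of_int j\<bar> \<le> (1 / 2) ^ nat \<bar>j\<bar>" .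
        show "(\<theta> / r) ^ nat \<bar>k\<bar> \<le> (1 / 2) ^ nat \<bar>k\<bar>" using r by (intro power_mono) (auto simp: \<theta>_def)
        show "0 \<le> 2 * A * B * E / (r - cmod w)" using AB E0 r by (intro divide_nonneg_nonneg mult_nonneg_nonneg) auto
      qed (use \<theta> r in auto)
      finally show ?thesis .
    qed
    have "corr (\<lambda>z. \<Sum>k\<in>K. fourier_coeff f k * z powi k) (\<lambda>z. \<Sum>k\<in>L. fourier_coeff g k * z powi k) n \<le>
      (\<Sum>j\<in>K. \<Sum>k\<in>L. cmod (fourier_coeff f j) * cmod (fourier_coeff g k) * corr (\<lambda>z. z powi j) (\<lambda>z. z powi k) n)"
      using K by (intro correlation_sum_le) (auto intro!: L2_continuous continuous_intros)
    also have "\<dots> \<le> (\<Sum>j\<in>K. \<Sum>k\<in>L. (2 * A * B * E / (r - cmod w)) * ((1 / 2) ^ nat \<bar>j\<bar> * (1 / 2) ^ nat \<bar>k\<bar>))"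
      by (intro sum_mono summand)
    also have "\<dots> = (2 * A * B * E / (r - cmod w)) * ((\<Sum>j\<in>K. (1 / 2) ^ nat \<bar>j\<bar>) * (\<Sum>k\<in>L. (1 / 2) ^ nat \<bar>k\<bar>))"
      unfolding sum_product[of "\<lambda>j. (1 / 2) ^ nat \<bar>j\<bar>" K] by (simp only: sum_distrib_left)
    also have "\<dots> \<le> (2 * A * B * E / (r - cmod w)) * (4 * 4)"
      using sum_half_powers_int_le[OF K(1)] sum_half_powers_int_le[OF K(2)] AB E0 r
      by (intro mult_left_mono mult_mono divide_nonneg_nonneg mult_nonneg_nonneg) (auto intro!: sum_nonneg)
    also have "\<dots> = C * \<sigma> ^ (2 ^ n) * A * B" by (simp add: C_def E_def)
    finally show ?thesis unfolding A_def B_def .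
  qed
  have bound: "corr f g n \<le> C * \<sigma> ^ (2 ^ n) * theta_norm \<theta> f * theta_norm \<theta> g"
    if f: "f \<in> H_theta \<theta>" and g: "g \<in> H_theta \<theta>" for f g n
  proof (rule field_le_epsilon)
    fix e :: real assume e: "e > 0"
    have fL2: "f \<in> L2_functions circle_measure" and gL2: "g \<in> L2_functions circle_measure"
      using f g by (auto simp: H_theta_def)
    have pos: "l2_norm \<nu> h + 1 > 0" for h using l2_norm_nonneg[of \<nu> h] by linarith
    obtain K where K: "finite K" "l2_norm \<nu> (\<lambda>z. f z - (\<Sum>k\<in>K. fourier_coeff f k * z powi k)) < e / (4 * (l2_norm \<nu> g + 1))"
      using fourier_partial_sum_approx_harmonic[OF w fL2 divide_pos_pos[OF e mult_pos_pos[OF _ pos[of g]], of 4]] by auto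
    let ?p = "\<lambda>z. \<Sum>k\<in>K. fourier_coeff f k * z powi k"
    obtain L where L: "finite L" "l2_norm \<nu> (\<lambda>z. g z - (\<Sum>k\<in>L. fourier_coeff g k * z powi k)) < e / (4 * (l2_norm \<nu> ?p + 1))"
      using fourier_partial_sum_approx_harmonic[OF w gL2 divide_pos_pos[OF e mult_pos_pos[OF _ pos[of ?p]], of 4]] by auto
    let ?q = "\<lambda>z. \<Sum>k\<in>L. fourier_coeff g k * z powi k"
    have cancel: "e / (4 * x) * x = e / 4" if "x > 0" for x using that by simp
    have "l2_norm \<nu> (\<lambda>z. f z - ?p z) * l2_norm \<nu> g \<le> e / (4 * (l2_norm \<nu> g + 1)) * (l2_norm \<nu> g + 1)"
      using K(2) e pos[of g] by (intro mult_mono) (auto simp: l2_norm_nonneg)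
    then have 1: "2 * l2_norm \<nu> (\<lambda>z. f z - ?p z) * l2_norm \<nu> g \<le> e / 2"
      unfolding cancel[OF pos] by simp
    have "l2_norm \<nu> (\<lambda>z. g z - ?q z) * l2_norm \<nu> ?p \<le> e / (4 * (l2_norm \<nu> ?p + 1)) * (l2_norm \<nu> ?p + 1)"
      using L(2) e pos[of ?p] by (intro mult_mono) (auto simp: l2_norm_nonneg)
    then have 2: "2 * l2_norm \<nu> ?p * l2_norm \<nu> (\<lambda>z. g z - ?q z) \<le> e / 2"
      unfolding cancel[OF pos] by (simp add: mult_ac)
    have "corr f g n \<le> corr ?p ?q n + 2 * l2_norm \<nu> (\<lambda>z. f z - ?p z) * l2_norm \<nu> g
         + 2 * l2_norm \<nu> ?p * l2_norm \<nu> (\<lambda>z. g z - ?q z)"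
      by (intro correlation_perturb L2_harmonic_if_L2_circle w fL2 gL2 trig_L2 trig_polynomial_sum K L)
    with 1 2 partial[OF H_theta_norm_finite[OF f] H_theta_norm_finite[OF g] K(1) L(1), of n]
    show "corr f g n \<le> C * \<sigma> ^ (2 ^ n) * theta_norm \<theta> f * theta_norm \<theta> g + e" by linarith
  qed
  have exp: "\<sigma> ^ (2 ^ n) = exp (- (- ln \<sigma>) * exp (ln 2 * real n))" for n
  proof -
    have "exp (ln 2 * real n) = (2 :: real) ^ n" by (metis exp_ln exp_of_nat2_mult mult.commute zero_less_numeral)
    moreover have "exp (2 ^ n * ln \<sigma>) = \<sigma> ^ (2 ^ n)"
      using exp_of_nat_mult[of "2 ^ n" "ln \<sigma>"] \<sigma> by simp
    ultimately show ?thesis by (simp add: mult.commute)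
  qed
  have "- ln \<sigma> > 0" "ln (2 :: real) > 0" using \<sigma> by auto
  then show ?thesis
    unfolding double_exponentially_mixing_def
    using \<theta> C bound unfolding exp by (intro exI[of _ \<theta>] conjI exI[of _ "- ln \<sigma>"] exI[of _ "ln 2"] exI[of _ C] ballI allI impI) auto
qed

lemma l2_norm_powi: "l2_norm \<nu> (\<lambda>z. z powi k) \<le> 1"
  by (intro l2_norm_le L2_continuous continuous_intros) (auto simp: norm_power_int)

text \<open>
  Test the hypothesis on \<open>z\<close> and \<open>z\<^sup>k\<close>, whose norms are \<open>\<theta>\<^sup>-\<^sup>1\<close> and \<open>\<theta>\<^sup>-\<^sup>k\<close>, and insert the
  result in the power series for \<open>\<lambda>\<^sup>n\<close>, \<open>\<lambda>\<close> being the multiplier. That series is evaluated at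
  \<open>w\<close>, and nothing prevents \<open>\<theta>\<close> from being smaller than \<open>|w|\<close>. Therefore the bound \<open>\<epsilon> \<theta>\<^bsup>-m\<^esup>\<close> for
  the \<open>m\<close>th coefficient is weakened to its power \<open>\<tau>\<close>, legitimately because the coefficients are
  bounded as well, with \<open>\<tau>\<close> so small that \<open>|w| < \<theta>\<^sup>\<tau>\<close>.
\<close>

lemma superattracting_if_double_exponentially_mixing:
  assumes mix: "double_exponentially_mixing \<nu> \<phi>"
  shows "deriv \<phi> w = 0"
proof (rule ccontr)
  assume nz: "deriv \<phi> w \<noteq> 0"
  obtain \<theta> \<beta> \<gamma> C where \<theta>: "0 < \<theta>" "\<theta> < 1" and pos: "\<beta> > 0" "\<gamma> > 0" "C > 0"
    and mix: "\<And>f g n. f \<in> H_theta \<theta> \<Longrightarrow> g \<in> H_theta \<theta> \<Longrightarrow> n \<ge> 1 \<Longrightarrow>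
      corr f g n \<le> C * exp (- \<beta> * exp (\<gamma> * real n)) * theta_norm \<theta> f * theta_norm \<theta> g"
    using mix unfolding double_exponentially_mixing_def by blast
  let ?c = "\<lambda>m n. covariance \<nu> \<phi> (\<lambda>z. z) (\<lambda>z. z powi int (Suc m)) n"
  define \<epsilon> where "\<epsilon> n = exp (- \<beta> * exp (\<gamma> * real n))" for n :: nat
  define D where "D = max 2 (C / \<theta>\<^sup>2)"
  have D: "D \<ge> 2" "D \<ge> C / \<theta>\<^sup>2" by (auto simp: D_def)
  have L2: "(\<lambda>z. z powi k) \<in> L2_functions \<nu>" for k
    by (intro L2_continuous continuous_intros) auto
  have c2: "cmod (?c m n) \<le> D" for m n
  proof -
    have "cmod (?c m n) \<le> 2 * l2_norm \<nu> (\<lambda>z. z powi 1) * l2_norm \<nu> (\<lambda>z. z powi int (Suc m))"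
      using correlation_le[OF L2[of 1] L2[of "int (Suc m)"], of n] by (simp only: correlation_eq power_int_1_right)
    also have "\<dots> \<le> 2 * 1 * 1" by (intro mult_mono l2_norm_powi) (auto simp: l2_norm_nonneg)
    finally show ?thesis using D by simp
  qed
  have c1: "cmod (?c m n) \<le> D * (\<epsilon> n / \<theta> ^ m)" if "n \<ge> 1" for m n
  proof -
    have "cmod (?c m n) \<le> C * \<epsilon> n * theta_norm \<theta> (\<lambda>z. z powi 1) * theta_norm \<theta> (\<lambda>z. z powi int (Suc m))"
      using mix[OF powi_H_theta[OF \<theta>(1), of 1] powi_H_theta[OF \<theta>(1), of "int (Suc m)"] that]
      by (simp only: correlation_eq power_int_1_right \<epsilon>_def)
    also have "\<dots> = C / \<theta>\<^sup>2 * (\<epsilon> n / \<theta> ^ m)"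
      by (simp add: theta_norm_powi[OF \<theta>(1)] power2_eq_square nat_add_distrib del: power_int_1_right)
    also have "\<dots> \<le> D * (\<epsilon> n / \<theta> ^ m)" using D \<theta> by (intro mult_right_mono) (auto simp: \<epsilon>_def)
    finally show ?thesis .
  qed
  define q where "q = (1 + cmod w) / 2"
  have q: "0 < q" "q < 1" "cmod w < q" using w by (auto simp: q_def add_pos_nonneg)
  \<comment> \<open>The largest exponent up to 1 with \<open>q \<le> \<theta>\<^sup>\<tau>\<close>; both logarithms are negative.\<close>
  define \<tau> where "\<tau> = min 1 (ln q / ln \<theta>)"
  have \<tau>: "0 < \<tau>" "\<tau> \<le> 1" using q \<theta> by (auto simp: \<tau>_def divide_neg_neg)
  have "\<tau> * ln \<theta> \<ge> ln q / ln \<theta> * ln \<theta>" using \<theta> by (intro mult_right_mono_neg) (auto simp: \<tau>_def)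
  then have "ln q \<le> \<tau> * ln \<theta>" using \<theta> by simp
  then have \<theta>\<tau>: "q \<le> \<theta> powr \<tau>" using q \<theta> by (simp add: powr_def ln_ge_iff[symmetric] flip: ln_le_cancel_iff) 
  define \<rho> where "\<rho> = cmod w / \<theta> powr \<tau>"
  have "\<rho> \<le> cmod w / q" unfolding \<rho>_def using \<theta>\<tau> q \<theta> by (intro divide_left_mono mult_pos_pos) auto
  also have "\<dots> < 1" using q by simp
  finally have \<rho>: "0 \<le> \<rho>" "\<rho> < 1" using \<theta> by (auto simp: \<rho>_def)
  have interp: "cmod (?c m n * w ^ m) \<le> D * \<epsilon> n powr \<tau> * \<rho> ^ m" if n: "n \<ge> 1" for m n
  proof -
    define x where "x = \<epsilon> n / \<theta> ^ m"
    have x: "x > 0" using \<theta> by (simp add: x_def \<epsilon>_def)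
    have "min 1 x \<le> x powr \<tau>"
    proof (cases "x \<le> 1")
      case True
      then show ?thesis using powr_mono'[of \<tau> 1 x] x \<tau> by simp
    next
      case False
      then show ?thesis using ge_one_powr_ge_zero[of x \<tau>] \<tau> by simp
    qed
    have "cmod (?c m n) \<le> D * min 1 x"
      using c1[OF n, of m] c2[of m n] by (simp add: x_def min_def)
    also have "\<dots> \<le> D * x powr \<tau>" using D \<open>min 1 x \<le> x powr \<tau>\<close> by (intro mult_left_mono) auto
    finally have "cmod (?c m n) * cmod w ^ m \<le> D * x powr \<tau> * cmod w ^ m" by (intro mult_right_mono) auto
    also have "x powr \<tau> = \<epsilon> n powr \<tau> / (\<theta> powr \<tau>) ^ m"
      using \<theta> by (simp add: x_def powr_divide \<epsilon>_def powr_powr mult.commute flip: powr_realpow)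
    finally show ?thesis by (simp add: norm_mult norm_power \<rho>_def power_divide)
  qed
  have decay: "cmod (deriv \<phi> w) ^ n \<le> D / (1 - \<rho>) * \<epsilon> n powr \<tau>" if n: "n \<ge> 1" for n
  proof -
    have s: "(\<lambda>m. D * \<epsilon> n powr \<tau> * \<rho> ^ m) sums (D * \<epsilon> n powr \<tau> * (1 / (1 - \<rho>)))"
      using \<rho> by (intro sums_mult geometric_sums) auto
    have "cmod (\<Sum>m. ?c m n * w ^ m) \<le> (\<Sum>m. D * \<epsilon> n powr \<tau> * \<rho> ^ m)"
      by (rule norm_suminf_le[OF interp[OF n] sums_summable[OF s]])
    then have "cmod (deriv \<phi> w ^ n) \<le> D * \<epsilon> n powr \<tau> * (1 / (1 - \<rho>))"
      unfolding sums_unique[OF covariance_power_series, symmetric] sums_unique[OF s, symmetric] .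
    then show ?thesis by (simp add: norm_power)
  qed
  define b where "b = \<tau> * \<beta>"
  define D' where "D' = D / (1 - \<rho>)"
  have D': "D' > 0" using D \<rho> by (simp add: D'_def)
  have b: "b > 0" using \<tau> pos by (simp add: b_def)
  define c where "c = - ln (cmod (deriv \<phi> w))"
  have log: "b * (\<gamma>\<^sup>2 * (real n)\<^sup>2 / 2) \<le> ln D' + c * real n" if n: "n \<ge> 1" for n
  proof -
    have "\<epsilon> n powr \<tau> = exp (- b * exp (\<gamma> * real n))" by (simp add: \<epsilon>_def powr_def b_def mult.assoc)
    then have "cmod (deriv \<phi> w) ^ n \<le> D' * exp (- b * exp (\<gamma> * real n))" using decay[OF n] by (simp add: D'_def)
    then have "ln (cmod (deriv \<phi> w) ^ n) \<le> ln (D' * exp (- b * exp (\<gamma> * real n)))"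
      using nz D' by (intro ln_mono) auto
    then have 1: "b * exp (\<gamma> * real n) \<le> ln D' + c * real n"
      using nz D' by (simp add: ln_realpow ln_mult c_def mult.commute)
    have "1 + \<gamma> * real n + (\<gamma> * real n)\<^sup>2 / 2 \<le> exp (\<gamma> * real n)"
      using pos by (intro exp_lower_Taylor_quadratic) auto
    moreover have "0 \<le> \<gamma> * real n" using pos by simp
    ultimately have "\<gamma>\<^sup>2 * (real n)\<^sup>2 / 2 \<le> exp (\<gamma> * real n)" unfolding power_mult_distrib by linarith
    then have "b * (\<gamma>\<^sup>2 * (real n)\<^sup>2 / 2) \<le> b * exp (\<gamma> * real n)" using b by (intro mult_left_mono) auto
    with 1 show ?thesis by linarith
  qed
  \<comment> \<open>The quadratic lower bound for the exponential already outgrows the linear right-hand side.\<close>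
  define a where "a = b * \<gamma>\<^sup>2 / 2"
  have a: "a > 0" using b pos by (simp add: a_def)
  obtain n0 :: nat where n0: "(\<bar>c\<bar> + \<bar>ln D'\<bar> + 1) / a < real n0" using reals_Archimedean2 by blast
  define n where "n = max 1 n0"
  have "(\<bar>c\<bar> + \<bar>ln D'\<bar> + 1) / a < real n" using n0 by (simp add: n_def)
  then have big: "\<bar>c\<bar> + \<bar>ln D'\<bar> + 1 < a * real n" using a by (simp add: field_simps)
  have n1: "n \<ge> 1" by (simp add: n_def)
  have "(\<bar>c\<bar> + \<bar>ln D'\<bar> + 1) * real n \<le> a * real n * real n"
    using big by (intro mult_right_mono) auto
  also have "\<dots> \<le> ln D' + c * real n" using log[OF n1] by (simp add: a_def power2_eq_square)
  also have "\<dots> \<le> \<bar>ln D'\<bar> * real n + \<bar>c\<bar> * real n"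
    using n1 mult_left_mono[of 1 "real n" "\<bar>ln D'\<bar>"] by (intro add_mono mult_right_mono) auto
  finally have "real n \<le> 0" by (simp add: algebra_simps)
  then show False using n1 by simp
qed

end

theorem corollary1p5:
  fixes \<phi> :: "complex \<Rightarrow> complex" and w :: complex and \<alpha> :: real
  assumes "finite_blaschke \<phi>"
    and "w \<in> ball 0 1" and "\<phi> w = w"
    and "0 < \<alpha>" and "\<alpha> \<le> 1"
  shows "(\<not> mixing (harmonic_measure w) \<phi> \<longleftrightarrow> cmod (deriv \<phi> w) = 1) \<and>
         (exponentially_mixing_on_holder (harmonic_measure w) \<phi> \<alpha> \<longleftrightarrow> cmod (deriv \<phi> w) < 1) \<and>
         (double_exponentially_mixing (harmonic_measure w) \<phi> \<longleftrightarrow> deriv \<phi> w = 0)"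
proof -
  interpret disc_self_map \<phi> w
    using assms finite_blaschke_disc_algebra[OF assms(1)] by unfold_locales auto
  consider "cmod (deriv \<phi> w) = 1" | "cmod (deriv \<phi> w) < 1" using norm_deriv_le_1 by linarith
  then show ?thesis
    using mixing_if_attracting not_mixing_if_rotation exponentially_mixing_if_attracting[OF _ assms(4,5)]
      not_exponentially_mixing_if_rotation[OF _ assms(4,5)] double_exponentially_mixing_if_superattracting
      superattracting_if_double_exponentially_mixing
    by cases auto
qed

end
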